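(* Let $p,q$ be distinct primes, let $G=C_{pq}$ be the cyclic group of order $pq$ with subgroups $P$ of order $p$ and $Q$ of order $q$, and let $X$ be a $G$-space such that $X^H$ is nonempty and simply connected for every subgroup $H\le G$. Suppose the cohomology diagram of $X$ over $\mathcal{O}_G$ is injective (as an object of $Vec^*_G$). Then the cohomology diagram of $X^Q$ as a $P$-space is injective (as an object of $Vec^*_P$), and similarly the cohomology diagram of $X^P$ as a $Q$-space is injective (as an object of $Vec^*_Q$). Moreover, the cohomology diagram of $X$ as a $P\cong C_p$-space (respectively, as a $Q\cong C_q$-space), obtained by restricting the action, is injective as an object of $Vec^*_{P}$ (respectively, $Vec^*_{Q}$).
   Context: Orbit category: for a finite group $\Gamma$, $\mathcal{O}_\Gamma$ is the category whose objects are the $\Gamma$-sets $\Gamma/H$ ($H\le\Gamma$) and whose morphisms are $\Gamma$-maps. $Vec^*_\Gamma$ is the category of covariant functors from $\mathcal{O}_\Gamma$ to graded $\mathbb{Q}$-vector spaces. An object $I$ of a category is injective if for every injective morphism $f:X\to Y$ (for $Vec^*_\Gamma$: injective at every $\Gamma/H$) and every morphism $g:X\to I$ there is $h:Y\to I$ with $h\circ f=g$. For a $\Gamma$-space $X$ and $H\le\Gamma$, $X^H=\{x\in X: hx=x\ \text{for all } h\in H\}$. The cohomology diagram of the $\Gamma$-space $X$ is the covariant functor on $\mathcal{O}_\Gamma$ given by $\Gamma/H\mapsto H^*(X^H;\mathbb{Q})$, with maps induced by the maps $X^K\to X^H$ corresponding to $\Gamma$-maps $\Gamma/H\to\Gamma/K$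 (inclusions of fixed point sets for the projections $\Gamma/H\to\Gamma/K$, $H\subset K$). It is regarded as a diagram of graded algebras with zero differential and, forgetting multiplication, as an object of $Vec^*_\Gamma$. *)

theory Defs
  imports
    "HOL-Computational_Algebra.Primes"
    "HOL-Homology.Homology"
    "HOL-Algebra.Module"
    "HOL-Algebra.Left_Coset"
    "HOL-Algebra.Group_Action"
    "HOL-Algebra.Elementary_Groups"
begin

definition rat_field :: "rat ring" where
  "rat_field = \<lparr>carrier = UNIV, monoid.mult = (*), one = 1, zero = 0, add = (+)\<rparr>"

definition linear_maps :: "(rat, 'v) module \<Rightarrow> (rat, 'w) module \<Rightarrow> ('v \<Rightarrow> 'w) set" where
  "linear_maps V W =
     {f \<in> carrier V \<rightarrow> carrier W.
        (\<forall>x\<in>carrier V. \<forall>y\<in>carrier V. f (x \<oplus>\<^bsub>V\<^esub> y) = f x \<oplus>\<^bsub>W\<^esub> f y) \<and>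
        (\<forall>r. \<forall>x\<in>carrier V. f (r \<odot>\<^bsub>V\<^esub> x) = r \<odot>\<^bsub>W\<^esub> f x)}"

text \<open>
  The objects of the orbit category of \<open>\<Gamma>\<close> are the \<open>\<Gamma>\<close>-sets \<open>\<Gamma>/H\<close> of left cosets; the object
  \<open>\<Gamma>/H\<close> is represented by the subgroup \<open>H\<close>, which is itself an element (the base point) of \<open>\<Gamma>/H\<close>.
\<close>

definition orbit_maps ::
    "('g, 'm) monoid_scheme \<Rightarrow> 'g set \<Rightarrow> 'g set \<Rightarrow> ('g set \<Rightarrow> 'g set) set" where
  "orbit_maps \<Gamma> H K =
     {f \<in> lcosets\<^bsub>\<Gamma>\<^esub> H \<rightarrow>\<^sub>E lcosets\<^bsub>\<Gamma>\<^esub> K.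
        \<forall>g\<in>carrier \<Gamma>. \<forall>C\<in>lcosets\<^bsub>\<Gamma>\<^esub> H. f (g <#\<^bsub>\<Gamma>\<^esub> C) = g <#\<^bsub>\<Gamma>\<^esub> f C}"

text \<open>
  \<open>ob D H n\<close> is the degree \<open>n\<close> part of the value at \<open>\<Gamma>/H\<close>, and \<open>mor D H K f n\<close> is the degree \<open>n\<close>
  part of the map induced by \<open>f : \<Gamma>/H \<rightarrow> \<Gamma>/K\<close>.
\<close>

record ('g, 'v) diagram =
  ob :: "'g set \<Rightarrow> nat \<Rightarrow> (rat, 'v) module"
  mor :: "'g set \<Rightarrow> 'g set \<Rightarrow> ('g set \<Rightarrow> 'g set) \<Rightarrow> nat \<Rightarrow> 'v \<Rightarrow> 'v"

definition vec_diagram :: "('g, 'm) monoid_scheme \<Rightarrow> ('g, 'v) diagram \<Rightarrow> bool" where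
  "vec_diagram \<Gamma> D \<longleftrightarrow>
     (\<forall>H n. subgroup H \<Gamma> \<longrightarrow> module rat_field (ob D H n)) \<and>
     (\<forall>H K f n. subgroup H \<Gamma> \<and> subgroup K \<Gamma> \<and> f \<in> orbit_maps \<Gamma> H K \<longrightarrow>
        mor D H K f n \<in> linear_maps (ob D H n) (ob D K n)) \<and>
     (\<forall>H n. subgroup H \<Gamma> \<longrightarrow>
        (\<forall>x\<in>carrier (ob D H n). mor D H H (\<lambda>C\<in>lcosets\<^bsub>\<Gamma>\<^esub> H. C) n x = x)) \<and>
     (\<forall>H K L f f' n.
        subgroup H \<Gamma> \<and> subgroup K \<Gamma> \<and> subgroup L \<Gamma> \<and>
        f \<in> orbit_maps \<Gamma> H K \<and> f' \<in> orbit_maps \<Gamma> K L \<longrightarrow>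
        (\<forall>x\<in>carrier (ob D H n).
           mor D H L (compose (lcosets\<^bsub>\<Gamma>\<^esub> H) f' f) n x = mor D K L f' n (mor D H K f n x)))"

definition diagram_map ::
    "('g, 'm) monoid_scheme \<Rightarrow> ('g, 'v) diagram \<Rightarrow> ('g, 'w) diagram \<Rightarrow>
     ('g set \<Rightarrow> nat \<Rightarrow> 'v \<Rightarrow> 'w) \<Rightarrow> bool" where
  "diagram_map \<Gamma> D E \<eta> \<longleftrightarrow>
     (\<forall>H n. subgroup H \<Gamma> \<longrightarrow> \<eta> H n \<in> linear_maps (ob D H n) (ob E H n)) \<and>
     (\<forall>H K f n. subgroup H \<Gamma> \<and> subgroup K \<Gamma> \<and> f \<in> orbit_maps \<Gamma> H K \<longrightarrow>
        (\<forall>x\<in>carrier (ob D H n). \<eta> K n (mor D H K f n x) = mor E H K f n (\<eta> H n x)))"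

text \<open>
  A definition cannot quantify over types, so the test objects \<open>A\<close> and \<open>B\<close> range over all diagrams
  whose vector spaces have carriers in a type \<open>'u\<close>, playing the role of a universe; \<open>'u\<close> is
  independent of the type of \<open>I\<close>. For finite \<open>\<Gamma>\<close> and infinite \<open>'u\<close> the notion does not depend on \<open>'u\<close>,
  by Baer's criterion. For finite \<open>'u\<close> all test objects are zero and every
  diagram is injective.
\<close>

definition injective_diagram ::
    "'u itself \<Rightarrow> ('g, 'm) monoid_scheme \<Rightarrow> ('g, 'v) diagram \<Rightarrow> bool" where
  "injective_diagram U \<Gamma> I \<longleftrightarrow>
     vec_diagram \<Gamma> I \<and>
     (\<forall>(A :: ('g, 'u) diagram) (B :: ('g, 'u) diagram) f g.
        vec_diagram \<Gamma> A \<and> vec_diagram \<Gamma> B \<and>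
        diagram_map \<Gamma> A B f \<and> (\<forall>H n. subgroup H \<Gamma> \<longrightarrow> inj_on (f H n) (carrier (ob A H n))) \<and>
        diagram_map \<Gamma> A I g \<longrightarrow>
        (\<exists>h. diagram_map \<Gamma> B I h \<and>
             (\<forall>H n. subgroup H \<Gamma> \<longrightarrow> (\<forall>x\<in>carrier (ob A H n). h H n (f H n x) = g H n x))))"

type_synonym 'a cochain = "((nat \<Rightarrow> real) \<Rightarrow> 'a) \<Rightarrow> rat"

text \<open>
  An \<open>n\<close>-cochain is a rational function on the singular \<open>n\<close>-simplices, extended by \<open>0\<close> to
  all other arguments.
\<close>

definition cochains :: "nat \<Rightarrow> 'a topology \<Rightarrow> 'a cochain set" where
  "cochains n X = {c. \<forall>\<sigma>. \<not> singular_simplex n X \<sigma> \<longrightarrow> c \<sigma> = 0}"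

definition coboundary :: "nat \<Rightarrow> 'a topology \<Rightarrow> 'a cochain \<Rightarrow> 'a cochain" where
  "coboundary n X c =
     (\<lambda>\<sigma>. if singular_simplex (Suc n) X \<sigma>
          then \<Sum>k\<le>Suc n. (- 1) ^ k * c (singular_face (Suc n) k \<sigma>) else 0)"

definition cocycles :: "nat \<Rightarrow> 'a topology \<Rightarrow> 'a cochain set" where
  "cocycles n X = {c \<in> cochains n X. coboundary n X c = (\<lambda>\<sigma>. 0)}"

definition coboundaries :: "nat \<Rightarrow> 'a topology \<Rightarrow> 'a cochain set" where
  "coboundaries n X =
     (case n of 0 \<Rightarrow> {\<lambda>\<sigma>. 0} | Suc m \<Rightarrow> coboundary m X ` cochains m X)"

definition cohomology_class :: "nat \<Rightarrow> 'a topology \<Rightarrow> 'a cochain \<Rightarrow> 'a cochain set" where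
  "cohomology_class n X c = {\<lambda>\<sigma>. c \<sigma> + b \<sigma> | b. b \<in> coboundaries n X}"

text \<open>
  The record type of modules extends that of rings; the multiplicative fields \<open>mult\<close> and \<open>one\<close>
  play no role for a module.
\<close>

definition cohomology :: "nat \<Rightarrow> 'a topology \<Rightarrow> (rat, 'a cochain set) module" where
  "cohomology n X =
     \<lparr>carrier = cohomology_class n X ` cocycles n X,
      monoid.mult = undefined, one = undefined,
      zero = coboundaries n X,
      add = (\<lambda>A B. {\<lambda>\<sigma>. a \<sigma> + b \<sigma> | a b. a \<in> A \<and> b \<in> B}),
      smult = (\<lambda>r A. \<Union>a\<in>A. cohomology_class n X (\<lambda>\<sigma>. r * a \<sigma>))\<rparr>"

definition cochain_pullback ::
    "nat \<Rightarrow> 'a topology \<Rightarrow> ('a \<Rightarrow> 'b) \<Rightarrow> 'b cochain \<Rightarrow> 'a cochain" where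
  "cochain_pullback n X f c = (\<lambda>\<sigma>. if singular_simplex n X \<sigma> then c (simplex_map n f \<sigma>) else 0)"

text \<open>
  The map \<open>H\<^sup>n(Y) \<rightarrow> H\<^sup>n(X)\<close> induced by \<open>f : X \<rightarrow> Y\<close>. All members of a class \<open>A\<close> have cohomologous
  pullbacks, so the union is a single class.
\<close>

definition cohomology_map ::
    "nat \<Rightarrow> 'a topology \<Rightarrow> ('a \<Rightarrow> 'b) \<Rightarrow> 'b cochain set \<Rightarrow> 'a cochain set" where
  "cohomology_map n X f A = (\<Union>a\<in>A. cohomology_class n X (cochain_pullback n X f a))"

text \<open>
  The acting groups are finite and discrete, so continuity of the action means that every group
  element acts continuously.
\<close>

definition group_space ::
    "('g, 'm) monoid_scheme \<Rightarrow> 'a topology \<Rightarrow> ('g \<Rightarrow> 'a \<Rightarrow> 'a) \<Rightarrow> bool" where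
  "group_space \<Gamma> X \<phi> \<longleftrightarrow>
     group_action \<Gamma> (topspace X) \<phi> \<and> (\<forall>g\<in>carrier \<Gamma>. continuous_map X X (\<phi> g))"

definition fixed_space :: "'a topology \<Rightarrow> ('g \<Rightarrow> 'a \<Rightarrow> 'a) \<Rightarrow> 'g set \<Rightarrow> 'a topology" where
  "fixed_space X \<phi> H = subtopology X {x \<in> topspace X. \<forall>h\<in>H. \<phi> h x = x}"

definition action_on :: "'a topology \<Rightarrow> ('g \<Rightarrow> 'a \<Rightarrow> 'a) \<Rightarrow> 'g \<Rightarrow> 'a \<Rightarrow> 'a" where
  "action_on Y \<phi> = (\<lambda>g. restrict (\<phi> g) (topspace Y))"

text \<open>
  As for the library's \<open>simply_connected\<close> (which is restricted to type class topologies), the empty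
  space is not excluded.
\<close>

definition simply_connected_space :: "'a topology \<Rightarrow> bool" where
  "simply_connected_space X \<longleftrightarrow>
     path_connected_space X \<and>
     (\<forall>p. pathin X p \<and> p 1 = p 0 \<longrightarrow>
        homotopic_with (\<lambda>r. r 0 = p 0 \<and> r 1 = p 0) (top_of_set {0..1}) X p (\<lambda>_. p 0))"

text \<open>
  A \<open>\<Gamma>\<close>-map \<open>f : \<Gamma>/H \<rightarrow> \<Gamma>/K\<close> is determined by the coset \<open>f(H) = aK\<close>, and it corresponds to the map
  \<open>X\<^sup>K \<rightarrow> X\<^sup>H\<close>, \<open>x \<mapsto> ax\<close>, which does not depend on the representative \<open>a\<close>. For \<open>H \<subseteq> K\<close> and the
  projection it is the inclusion. The group \<open>\<Gamma>\<close> enters only through the subgroups \<open>H\<close> and the orbit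
  maps \<open>f\<close> at which the diagram is evaluated; so the same \<open>X\<close> and \<open>\<phi>\<close>, used over a subgroup of
  \<open>\<Gamma>\<close>, give the diagram of the restricted action.
\<close>

definition orbit_action ::
    "('g \<Rightarrow> 'a \<Rightarrow> 'a) \<Rightarrow> 'g set \<Rightarrow> ('g set \<Rightarrow> 'g set) \<Rightarrow> 'a \<Rightarrow> 'a" where
  "orbit_action \<phi> H f = \<phi> (SOME a. a \<in> f H)"

definition cohomology_diagram ::
    "'a topology \<Rightarrow> ('g \<Rightarrow> 'a \<Rightarrow> 'a) \<Rightarrow> ('g, 'a cochain set) diagram" where
  "cohomology_diagram X \<phi> =
     \<lparr>ob = (\<lambda>H n. cohomology n (fixed_space X \<phi> H)),
      mor = (\<lambda>H K f n. cohomology_map n (fixed_space X \<phi> K) (orbit_action \<phi> H f))\<rparr>"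

lemma cring_rat_field: "cring rat_field"
  by (rule cringI; (rule abelian_groupI comm_monoidI)?) 
     (auto simp: rat_field_def algebra_simps intro: exI[of _ "- _"])

lemma coboundary_add: "coboundary n X (\<lambda>\<sigma>. c \<sigma> + d \<sigma>) = (\<lambda>\<sigma>. coboundary n X c \<sigma> + coboundary n X d \<sigma>)"
  by (auto simp: coboundary_def fun_eq_iff algebra_simps sum.distrib)

lemma coboundary_scale: "coboundary n X (\<lambda>\<sigma>. r * d \<sigma>) = (\<lambda>\<sigma>. r * coboundary n X d \<sigma>)"
  by (auto simp: coboundary_def fun_eq_iff algebra_simps sum_distrib_left)

lemma coboundary_zero: "coboundary n X (\<lambda>\<sigma>. 0) = (\<lambda>\<sigma>. 0)"
  by (auto simp: coboundary_def fun_eq_iff)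

lemma coboundaries_zero: "(\<lambda>\<sigma>. 0) \<in> coboundaries n X"
  by (cases n) (auto simp: coboundaries_def cochains_def image_iff coboundary_zero intro!: exI[of _ "\<lambda>\<sigma>. 0"])

lemma coboundaries_add: "b \<in> coboundaries n X \<Longrightarrow> c \<in> coboundaries n X \<Longrightarrow> (\<lambda>\<sigma>. b \<sigma> + c \<sigma>) \<in> coboundaries n X"
proof (cases n)
  case (Suc m)
  assume "b \<in> coboundaries n X" "c \<in> coboundaries n X"
  then obtain b' c' where "b = coboundary m X b'" "c = coboundary m X c'" "b' \<in> cochains m X" "c' \<in> cochains m X"
    by (auto simp: coboundaries_def Suc)
  then show ?thesis
    by (auto simp: coboundaries_def Suc image_iff coboundary_add cochains_def intro!: exI[of _ "\<lambda>\<sigma>. b' \<sigma> + c' \<sigma>"])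
qed (auto simp: coboundaries_def)

lemma coboundaries_scale: "c \<in> coboundaries n X \<Longrightarrow> (\<lambda>\<sigma>. r * c \<sigma>) \<in> coboundaries n X"
proof (cases n)
  case (Suc m)
  assume "c \<in> coboundaries n X"
  then obtain c' where "c = coboundary m X c'" "c' \<in> cochains m X"
    by (auto simp: coboundaries_def Suc)
  then show ?thesis
    by (auto simp: coboundaries_def Suc image_iff coboundary_scale cochains_def intro!: exI[of _ "\<lambda>\<sigma>. r * c' \<sigma>"])
qed (auto simp: coboundaries_def)

lemma in_cohomology_class_iff: "x \<in> cohomology_class n X c \<longleftrightarrow> (\<lambda>\<sigma>. x \<sigma> - c \<sigma>) \<in> coboundaries n X"
proof
  assume "(\<lambda>\<sigma>. x \<sigma> - c \<sigma>) \<in> coboundaries n X"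
  then show "x \<in> cohomology_class n X c"
    unfolding cohomology_class_def by (intro CollectI exI[of _ "\<lambda>\<sigma>. x \<sigma> - c \<sigma>"]) auto
qed (auto simp: cohomology_class_def)

lemma cohomology_class_cong: assumes "(\<lambda>\<sigma>. c \<sigma> - d \<sigma>) \<in> coboundaries n X"
  shows "cohomology_class n X c = cohomology_class n X d"
proof (intro Set.set_eqI iffI)
  fix x assume "x \<in> cohomology_class n X c"
  then show "x \<in> cohomology_class n X d" using coboundaries_add[OF _ assms, of "\<lambda>\<sigma>. x \<sigma> - c \<sigma>"] by (simp add: in_cohomology_class_iff)
next
  fix x assume "x \<in> cohomology_class n X d"
  then show "x \<in> cohomology_class n X c" using coboundaries_add[OF _ coboundaries_scale[OF assms, of "-1"], of "\<lambda>\<sigma>. x \<sigma> - d \<sigma>"]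
    by (simp add: in_cohomology_class_iff)
qed

lemma cohomology_class_self: "c \<in> cohomology_class n X c" by (simp add: in_cohomology_class_iff coboundaries_zero)

lemma cohomology_add_class: "cohomology_class n X c \<oplus>\<^bsub>cohomology n X\<^esub> cohomology_class n X d = cohomology_class n X (\<lambda>\<sigma>. c \<sigma> + d \<sigma>)"
proof (intro Set.set_eqI iffI)
  fix x assume "x \<in> cohomology_class n X c \<oplus>\<^bsub>cohomology n X\<^esub> cohomology_class n X d"
  then obtain a b where ab: "x = (\<lambda>\<sigma>. a \<sigma> + b \<sigma>)" "a \<in> cohomology_class n X c" "b \<in> cohomology_class n X d"
    by (auto simp: cohomology_def)
  show "x \<in> cohomology_class n X (\<lambda>\<sigma>. c \<sigma> + d \<sigma>)"
    using coboundaries_add[OF ab(2)[unfolded in_cohomology_class_iff] ab(3)[unfolded in_cohomology_class_iff]] by (simp add: in_cohomology_class_iff ab(1) algebra_simps)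
next
  fix x assume x: "x \<in> cohomology_class n X (\<lambda>\<sigma>. c \<sigma> + d \<sigma>)"
  then have "(\<lambda>\<sigma>. x \<sigma> - d \<sigma>) \<in> cohomology_class n X c" by (simp add: in_cohomology_class_iff algebra_simps)
  then show "x \<in> cohomology_class n X c \<oplus>\<^bsub>cohomology n X\<^esub> cohomology_class n X d"
    unfolding cohomology_def using cohomology_class_self[of d n X]
    by (simp, intro exI[of _ "\<lambda>\<sigma>. x \<sigma> - d \<sigma>"] exI[of _ d]) auto
qed

lemma UN_cohomology_class:
  assumes "\<And>a. a \<in> cohomology_class n X c \<Longrightarrow> cohomology_class m Y (g a) = cohomology_class m Y (g c)"
  shows "(\<Union>a\<in>cohomology_class n X c. cohomology_class m Y (g a)) = cohomology_class m Y (g c)"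
  using assms cohomology_class_self[of c n X] by blast

lemma cohomology_smult_class: "r \<odot>\<^bsub>cohomology n X\<^esub> cohomology_class n X c = cohomology_class n X (\<lambda>\<sigma>. r * c \<sigma>)"
proof -
  have "cohomology_class n X (\<lambda>\<sigma>. r * a \<sigma>) = cohomology_class n X (\<lambda>\<sigma>. r * c \<sigma>)" if "a \<in> cohomology_class n X c" for a
    using coboundaries_scale[OF that[unfolded in_cohomology_class_iff], of r] by (intro cohomology_class_cong) (simp add: algebra_simps)
  from UN_cohomology_class[of n X c n X "\<lambda>a \<sigma>. r * a \<sigma>", OF this] show ?thesis by (simp add: cohomology_def)
qed

lemma cohomology_zero_class: "\<zero>\<^bsub>cohomology n X\<^esub> = cohomology_class n X (\<lambda>\<sigma>. 0)"
  by (simp add: cohomology_def cohomology_class_def)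

lemma carrier_cohomology: "carrier (cohomology n X) = cohomology_class n X ` cocycles n X"
  by (simp add: cohomology_def)

lemma cocycles_add: "b \<in> cocycles n X \<Longrightarrow> c \<in> cocycles n X \<Longrightarrow> (\<lambda>\<sigma>. b \<sigma> + c \<sigma>) \<in> cocycles n X"
  by (auto simp: cocycles_def coboundary_add cochains_def)

lemma cocycles_scale: "c \<in> cocycles n X \<Longrightarrow> (\<lambda>\<sigma>. r * c \<sigma>) \<in> cocycles n X"
  by (auto simp: cocycles_def coboundary_scale cochains_def)

lemma cocycles_zero: "(\<lambda>\<sigma>. 0) \<in> cocycles n X"
  by (auto simp: cocycles_def coboundary_zero cochains_def)

lemma module_cohomology: "module rat_field (cohomology n X)"
proof (rule moduleI)
  show "cring rat_field" by (rule cring_rat_field)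
  show "abelian_group (cohomology n X)"
  proof (rule abelian_groupI)
    fix x assume "x \<in> carrier (cohomology n X)"
    then obtain c where c: "c \<in> cocycles n X" "x = cohomology_class n X c" by (auto simp: carrier_cohomology)
    show "\<exists>y\<in>carrier (cohomology n X). y \<oplus>\<^bsub>cohomology n X\<^esub> x = \<zero>\<^bsub>cohomology n X\<^esub>"
      using cocycles_scale[OF c(1), of "-1"]
      by (intro bexI[of _ "cohomology_class n X (\<lambda>\<sigma>. (-1) * c \<sigma>)"]) (auto simp: carrier_cohomology cohomology_add_class c(2) cohomology_zero_class)
  qed (auto simp: carrier_cohomology cohomology_add_class cohomology_zero_class algebra_simps intro!: cocycles_zero cocycles_add)
qed (auto simp: carrier_cohomology rat_field_def cohomology_smult_class cohomology_add_class algebra_simps intro!: cocycles_scale)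

lemma coboundary_cochain_pullback: assumes f: "continuous_map X Y f"
  shows "cochain_pullback (Suc n) X f (coboundary n Y c) = coboundary n X (cochain_pullback n X f c)"
proof
  fix \<sigma>
  show "cochain_pullback (Suc n) X f (coboundary n Y c) \<sigma> = coboundary n X (cochain_pullback n X f c) \<sigma>"
  proof (cases "singular_simplex (Suc n) X \<sigma>")
    case True
    have "singular_face (Suc n) k (simplex_map (Suc n) f \<sigma>) = simplex_map n f (singular_face (Suc n) k \<sigma>)"
       "singular_simplex n X (singular_face (Suc n) k \<sigma>)" if "k \<le> Suc n" for k
      using singular_face_simplex_map[of "Suc n" k f \<sigma>] that singular_simplex_singular_face[OF True, of k]
      by (auto simp: simplex_map_def singular_face_def fun_eq_iff simplical_face_in_standard_simplex)
    then show ?thesis using True singular_simplex_simplex_map[OF True f]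
      unfolding cochain_pullback_def coboundary_def
      by (auto intro!: sum.cong simp del: sum.atMost_Suc)
  qed (auto simp: cochain_pullback_def coboundary_def)
qed

lemma coboundaries_cochain_pullback: assumes f: "continuous_map X Y f" and b: "b \<in> coboundaries n Y"
  shows "cochain_pullback n X f b \<in> coboundaries n X"
    
proof (cases n)
  case 0 then show ?thesis using b by (auto simp: coboundaries_def cochain_pullback_def)
next
  case (Suc m)
  obtain c where c: "c \<in> cochains m Y" "b = coboundary m Y c" using b by (auto simp: coboundaries_def Suc)
  have "cochain_pullback n X f b = coboundary m X (cochain_pullback m X f c)"
    using coboundary_cochain_pullback[OF f] by (simp add: c(2) Suc)
  then show ?thesis by (auto simp: coboundaries_def Suc cochains_def cochain_pullback_def)
qed

lemma cocycles_cochain_pullback: assumes f: "continuous_map X Y f" and c: "c \<in> cocycles n Y"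
  shows "cochain_pullback n X f c \<in> cocycles n X"
proof -
  have "coboundary n X (cochain_pullback n X f c) = cochain_pullback (Suc n) X f (coboundary n Y c)"
    using coboundary_cochain_pullback[OF f] by simp
  with c show ?thesis by (auto simp: cocycles_def cochains_def cochain_pullback_def)
qed

lemma cohomology_map_class: assumes f: "continuous_map X Y f"
  shows "cohomology_map n X f (cohomology_class n Y c) = cohomology_class n X (cochain_pullback n X f c)"
  unfolding cohomology_map_def
proof (rule UN_cohomology_class)
  fix a assume "a \<in> cohomology_class n Y c"
  from coboundaries_cochain_pullback[OF f this[unfolded in_cohomology_class_iff]] have "(\<lambda>\<sigma>. cochain_pullback n X f a \<sigma> - cochain_pullback n X f c \<sigma>) \<in> coboundaries n X"
    by (simp add: cochain_pullback_def if_distrib if_distribR cong: if_cong)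
  then show "cohomology_class n X (cochain_pullback n X f a) = cohomology_class n X (cochain_pullback n X f c)"
    by (rule cohomology_class_cong)
qed

lemma cohomology_map_linear: assumes f: "continuous_map X Y f"
  shows "cohomology_map n X f \<in> linear_maps (cohomology n Y) (cohomology n X)"
proof -
  have 1: "cochain_pullback n X f (\<lambda>\<sigma>. c \<sigma> + d \<sigma>) = (\<lambda>\<sigma>. cochain_pullback n X f c \<sigma> + cochain_pullback n X f d \<sigma>)" for c d
    by (auto simp: cochain_pullback_def)
  have 2: "cochain_pullback n X f (\<lambda>\<sigma>. r * d \<sigma>) = (\<lambda>\<sigma>. r * cochain_pullback n X f d \<sigma>)" for r d
    by (auto simp: cochain_pullback_def)
  show ?thesis unfolding linear_maps_def
    by (auto simp: carrier_cohomology cohomology_map_class[OF f] cohomology_add_class cohomology_smult_class 1 2 intro!: imageI cocycles_cochain_pullback[OF f])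
qed

lemma topspace_fixed_space: "topspace (fixed_space X \<phi> H) = {x \<in> topspace X. \<forall>h\<in>H. \<phi> h x = x}"
  by (auto simp: fixed_space_def)

lemma vec_diagram_cohomology_diagram:
  fixes \<Gamma> :: "('g, 'm) monoid_scheme" and X :: "'a topology"
  assumes X: "group_space \<Gamma> X \<phi>"
  shows "vec_diagram \<Gamma> (cohomology_diagram X \<phi>)"
proof -
  interpret group_action \<Gamma> "topspace X" \<phi> using X by (simp add: group_space_def)
  interpret group \<Gamma> using group_hom group_hom.axioms(1) by blast
  have act: "\<phi> (g \<otimes>\<^bsub>\<Gamma>\<^esub> h) x = \<phi> g (\<phi> h x)" if "g \<in> carrier \<Gamma>" "h \<in> carrier \<Gamma>" "x \<in> topspace X" for g h x
    using composition_rule that by blast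
  have base: "H \<in> lcosets\<^bsub>\<Gamma>\<^esub> H" if "subgroup H \<Gamma>" for H
    using that coset_mult_one by (metis LCOSETS_def UN_iff insertI1 lcos_mult_one one_closed subgroup.subset)
  have rep: "(SOME a. a \<in> f H) \<in> carrier \<Gamma> \<and> f H = (SOME a. a \<in> f H) <#\<^bsub>\<Gamma>\<^esub> K"
    if "subgroup H \<Gamma>" "subgroup K \<Gamma>" "f \<in> orbit_maps \<Gamma> H K" for f H K
  proof -
    have "f H \<in> lcosets\<^bsub>\<Gamma>\<^esub> K" using that base[OF that(1)] by (auto simp: orbit_maps_def)
    then obtain a where a: "a \<in> carrier \<Gamma>" "f H = a <#\<^bsub>\<Gamma>\<^esub> K" by (auto simp: LCOSETS_def)
    then have "(SOME a. a \<in> f H) \<in> f H" using lcos_self[OF a(1) that(2)] by (metis someI)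
    then show ?thesis using a that(2)
      by (metis l_repr_independence subgroup.elemlcos_carrier is_group)
  qed
  have cont: "continuous_map (fixed_space X \<phi> K) (fixed_space X \<phi> H) (orbit_action \<phi> H f)"
    if HK: "subgroup H \<Gamma>" "subgroup K \<Gamma>" "f \<in> orbit_maps \<Gamma> H K" for f H K
  proof -
    define a where "a = (SOME a. a \<in> f H)"
    have a: "a \<in> carrier \<Gamma>" "f H = a <#\<^bsub>\<Gamma>\<^esub> K" using rep[OF that] by (auto simp: a_def)
    have fixd: "\<phi> h (\<phi> a x) = \<phi> a x" if h: "h \<in> H" and x: "x \<in> topspace X" "\<forall>k\<in>K. \<phi> k x = x" for h x
    proof -
      have hc: "h \<in> carrier \<Gamma>" using h HK(1) subgroup.mem_carrier by metis
      have "h <#\<^bsub>\<Gamma>\<^esub> H = H" using h HK(1) hc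
        by (simp add: coset_join3)
      moreover have "f (h <#\<^bsub>\<Gamma>\<^esub> H) = h <#\<^bsub>\<Gamma>\<^esub> f H"
        using HK(3) base[OF HK(1)] hc by (simp add: orbit_maps_def)
      ultimately have "h <#\<^bsub>\<Gamma>\<^esub> f H = f H" by simp
      then have "h \<otimes>\<^bsub>\<Gamma>\<^esub> a \<in> a <#\<^bsub>\<Gamma>\<^esub> K" using a lcos_self[OF a(1) HK(2)] hc unfolding l_coset_def by fastforce
      then obtain k where k: "k \<in> K" "h \<otimes>\<^bsub>\<Gamma>\<^esub> a = a \<otimes>\<^bsub>\<Gamma>\<^esub> k" by (auto simp: l_coset_def)
      then show ?thesis using act[OF hc a(1) x(1)] act[OF a(1) _ x(1), of k] x(2) HK(2) subgroup.mem_carrier by metis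
    qed
    have c: "continuous_map X X (\<phi> a)" using X a(1) by (simp add: group_space_def)
    show ?thesis unfolding fixed_space_def orbit_action_def a_def[symmetric]
      using c fixd continuous_map_image_subset_topspace[OF c]
      by (auto simp: continuous_map_in_subtopology continuous_map_from_subtopology)
  qed
  have eq: "cochain_pullback n (fixed_space X \<phi> K) f c = cochain_pullback n (fixed_space X \<phi> K) g c"
    if "\<And>x. x \<in> topspace (fixed_space X \<phi> K) \<Longrightarrow> f x = g x" for n K f g and c :: "'a cochain"
  proof -
    have "simplex_map n f \<sigma> = simplex_map n g \<sigma>" if "singular_simplex n (fixed_space X \<phi> K) \<sigma>" for \<sigma>
      using that \<open>\<And>x. x \<in> topspace (fixed_space X \<phi> K) \<Longrightarrow> f x = g x\<close>
      by (auto simp: simplex_map_def singular_simplex_def continuous_map_def restrict_def fun_eq_iff Pi_iff)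
    then show ?thesis by (simp add: cochain_pullback_def cong: if_cong)
  qed
  have idm: "mor (cohomology_diagram X \<phi>) H H (\<lambda>C\<in>lcosets\<^bsub>\<Gamma>\<^esub> H. C) n x = x"
    if H: "subgroup H \<Gamma>" and x: "x \<in> carrier (cohomology n (fixed_space X \<phi> H))" for H n x
  proof -
    let ?f = "\<lambda>C\<in>lcosets\<^bsub>\<Gamma>\<^esub> H. C"
    obtain c where c: "c \<in> cocycles n (fixed_space X \<phi> H)" "x = cohomology_class n (fixed_space X \<phi> H) c"
      using x by (auto simp: carrier_cohomology)
    have f: "?f \<in> orbit_maps \<Gamma> H H" using H
      by (auto simp: orbit_maps_def LCOSETS_def lcos_m_assoc[OF subgroup.subset[OF H]])
    have "?f H = H" using base[OF H] by simp
    then have a: "(SOME a. a \<in> ?f H) \<in> H" using subgroup.one_closed[OF H] by (metis someI)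
    have "cochain_pullback n (fixed_space X \<phi> H) (orbit_action \<phi> H ?f) c = cochain_pullback n (fixed_space X \<phi> H) id c"
      by (rule eq) (use a in \<open>auto simp: topspace_fixed_space orbit_action_def\<close>)
    also have "\<dots> = c" using c(1)
      by (auto simp: cochain_pullback_def cocycles_def cochains_def fun_eq_iff singular_simplex_def extensional_restrict)
    finally show ?thesis using cohomology_map_class[OF cont[OF H H f], of n c] by (simp add: cohomology_diagram_def c(2))
  qed
  have comp: "mor (cohomology_diagram X \<phi>) H L (compose (lcosets\<^bsub>\<Gamma>\<^esub> H) f' f) n x
      = mor (cohomology_diagram X \<phi>) K L f' n (mor (cohomology_diagram X \<phi>) H K f n x)"
    if S: "subgroup H \<Gamma>" "subgroup K \<Gamma>" "subgroup L \<Gamma>" and f: "f \<in> orbit_maps \<Gamma> H K" and f': "f' \<in> orbit_maps \<Gamma> K L"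
      and x: "x \<in> carrier (cohomology n (fixed_space X \<phi> H))" for H K L f f' n x
  proof -
    let ?h = "compose (lcosets\<^bsub>\<Gamma>\<^esub> H) f' f"
    obtain c where c: "c \<in> cocycles n (fixed_space X \<phi> H)" "x = cohomology_class n (fixed_space X \<phi> H) c"
      using x by (auto simp: carrier_cohomology)
    have lc: "g <#\<^bsub>\<Gamma>\<^esub> C \<in> lcosets\<^bsub>\<Gamma>\<^esub> H" if "g \<in> carrier \<Gamma>" "C \<in> lcosets\<^bsub>\<Gamma>\<^esub> H" for g C
      using that by (auto simp: LCOSETS_def lcos_m_assoc[OF subgroup.subset[OF S(1)]])
    have h: "?h \<in> orbit_maps \<Gamma> H L" 
      using f f' lc by (auto simp: orbit_maps_def compose_def Pi_iff PiE_iff)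
    define a where "a = (SOME a. a \<in> f H)"
    define b where "b = (SOME a. a \<in> f' K)"
    define d where "d = (SOME a. a \<in> ?h H)"
    have a: "a \<in> carrier \<Gamma>" "f H = a <#\<^bsub>\<Gamma>\<^esub> K" using rep[OF S(1,2) f] by (auto simp: a_def)
    have b: "b \<in> carrier \<Gamma>" "f' K = b <#\<^bsub>\<Gamma>\<^esub> L" using rep[OF S(2,3) f'] by (auto simp: b_def)
    have d: "d \<in> carrier \<Gamma>" "?h H = d <#\<^bsub>\<Gamma>\<^esub> L" using rep[OF S(1,3) h] by (auto simp: d_def)
    have "?h H = f' (a <#\<^bsub>\<Gamma>\<^esub> K)" using base[OF S(1)] a by (simp add: compose_def)
    also have "\<dots> = (a \<otimes>\<^bsub>\<Gamma>\<^esub> b) <#\<^bsub>\<Gamma>\<^esub> L" using f' base[OF S(2)] a b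
      by (auto simp: orbit_maps_def lcos_m_assoc[OF subgroup.subset[OF S(3)]])
    finally obtain l where l: "l \<in> L" "d = a \<otimes>\<^bsub>\<Gamma>\<^esub> b \<otimes>\<^bsub>\<Gamma>\<^esub> l"
      using lcos_self[OF d(1) S(3)] d(2) by (auto simp: l_coset_def)
    have lcar: "l \<in> carrier \<Gamma>" using l S(3) subgroup.mem_carrier by metis
    have "\<phi> d x = \<phi> a (\<phi> b x)" if "x \<in> topspace X" "\<forall>k\<in>L. \<phi> k x = x" for x
      using act[OF m_closed[OF a(1) b(1)] lcar that(1)] act[OF a(1) b(1) that(1)] that(2) l by simp
    then have "cochain_pullback n (fixed_space X \<phi> L) (orbit_action \<phi> H ?h) c
       = cochain_pullback n (fixed_space X \<phi> L) (orbit_action \<phi> H f \<circ> orbit_action \<phi> K f') c"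
      by (intro eq) (auto simp: topspace_fixed_space orbit_action_def a_def b_def d_def)
    also have "\<dots> = cochain_pullback n (fixed_space X \<phi> L) (orbit_action \<phi> K f') (cochain_pullback n (fixed_space X \<phi> K) (orbit_action \<phi> H f) c)"
      using singular_simplex_simplex_map[OF _ cont[OF S(2,3) f'], of n]
      by (auto simp: cochain_pullback_def fun_eq_iff simplex_map_compose)
    finally show ?thesis 
      using cohomology_map_class[OF cont[OF S(1,3) h], of n c] cohomology_map_class[OF cont[OF S(1,2) f], of n c] cohomology_map_class[OF cont[OF S(2,3) f'], of n]
      by (simp add: cohomology_diagram_def c(2))
  qed
  show ?thesis unfolding vec_diagram_def
    using idm comp cohomology_map_linear[OF cont] by (auto simp: cohomology_diagram_def module_cohomology)
qed

end

theory Submission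
  imports Defs
begin

text \<open>
  Restricting a diagram along a functor of orbit categories preserves injectivity as soon as the
  functor has a left Kan extension that preserves injective maps: an extension problem \<open>A \<rightarrow> B\<close>,
  \<open>A \<rightarrow> F\<^sup>*I\<close> over the small category is then the same as the problem \<open>F\<^sub>!A \<rightarrow> F\<^sub>!B\<close>,
  \<open>F\<^sub>!A \<rightarrow> I\<close> over the large one, which can be solved. Both halves of the statement are of this
  form. Since \<open>G\<close> is the product of \<open>P\<close> and \<open>Q\<close>, the diagram of the \<open>P\<close>-space \<open>X\<^sup>Q\<close> is the
  restriction of the diagram of \<open>X\<close> along \<open>P/H \<mapsto> G/QH\<close>, because \<open>(X\<^sup>Q)\<^sup>H = X\<^sup>Q\<^sup>H\<close>; the diagram of
  \<open>X\<close> as a \<open>P\<close>-space is its restriction along \<open>P/H \<mapsto> G/H\<close>. Exchanging \<open>P\<close> and \<open>Q\<close> gives the rest.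

  The first functor is fully faithful, and no orbit \<open>G/QH\<close> maps to an orbit \<open>G/L\<close> with
  \<open>Q\<close> not contained in \<open>L\<close>. So its left Kan extension is extension by zero: it is \<open>A(P \<inter> L)\<close> at the
  orbits \<open>G/L\<close> with \<open>Q \<subseteq> L\<close> and \<open>0\<close> at the others (\<open>injective_system_fixed_by_Q\<close>).

  For the second functor, \<open>G/L\<close> splits as a \<open>P\<close>-set into copies of \<open>P/(P \<inter> L)\<close>, and the left Kan
  extension at \<open>L\<close> is the sum of as many copies of \<open>A(P \<inter> L)\<close>. These are permuted by \<open>Q\<close>, with
  stabiliser \<open>L \<inter> Q\<close>, so the sum can be written as the space of \<open>(L \<inter> Q)\<close>-invariant functions
  \<open>Q \<rightarrow> A(P \<inter> L)\<close>. Since the coefficients are rational, the fold maps between such sums may be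
  replaced by averages over subgroups of \<open>Q\<close>, and all verifications become identities between
  averages (\<open>injective_system_restriction\<close>).

  The induced diagram no longer lives in the type \<open>'u\<close> over which the test objects range, but in
  functions into \<open>'u\<close>. A rational vector space is a point or infinite, hence at least as large as the set
  of functions from a finite set into it (\<open>rat_module_encode_functions\<close>), and copying the induced
  diagram back into \<open>'u\<close> makes the hypothesis applicable (\<open>injective_system_extension\<close>).
\<close>

section \<open>Diagrams over the orbit category of a commutative group\<close>

text \<open>
  Over a commutative group there is a \<open>\<Gamma>\<close>-map \<open>\<Gamma>/H \<rightarrow> \<Gamma>/K\<close> only if \<open>H \<subseteq> K\<close>, and then the maps are
  the translations \<open>gH \<mapsto> agK\<close>. Hence a diagram amounts to vector spaces \<open>V H n\<close> with linear maps
  \<open>T H K a n\<close>, one for each translation by a group element; the third clause, together with the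
  fourth, makes \<open>T H K a n\<close> depend only on the coset \<open>aK\<close>. In this form no cosets have to be chosen
  when diagrams are constructed.
\<close>

definition orbit_system ::
    "('g, 'm) monoid_scheme \<Rightarrow> ('g set \<Rightarrow> nat \<Rightarrow> (rat, 'v) module) \<Rightarrow>
     ('g set \<Rightarrow> 'g set \<Rightarrow> 'g \<Rightarrow> nat \<Rightarrow> 'v \<Rightarrow> 'v) \<Rightarrow> bool" where
  "orbit_system \<Gamma> V T \<longleftrightarrow>
     (\<forall>H n. subgroup H \<Gamma> \<longrightarrow> module rat_field (V H n)) \<and>
     (\<forall>H K a n. subgroup H \<Gamma> \<and> subgroup K \<Gamma> \<and> H \<subseteq> K \<and> a \<in> carrier \<Gamma> \<longrightarrow>
        T H K a n \<in> linear_maps (V H n) (V K n)) \<and>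
     (\<forall>H h n. subgroup H \<Gamma> \<and> h \<in> H \<longrightarrow> (\<forall>x\<in>carrier (V H n). T H H h n x = x)) \<and>
     (\<forall>H K L a b n. subgroup H \<Gamma> \<and> subgroup K \<Gamma> \<and> subgroup L \<Gamma> \<and> H \<subseteq> K \<and> K \<subseteq> L \<and>
        a \<in> carrier \<Gamma> \<and> b \<in> carrier \<Gamma> \<longrightarrow>
        (\<forall>x\<in>carrier (V H n). T H L (a \<otimes>\<^bsub>\<Gamma>\<^esub> b) n x = T K L b n (T H K a n x)))"

definition system_map ::
    "('g, 'm) monoid_scheme \<Rightarrow> ('g set \<Rightarrow> nat \<Rightarrow> (rat, 'v) module) \<Rightarrow>
     ('g set \<Rightarrow> 'g set \<Rightarrow> 'g \<Rightarrow> nat \<Rightarrow> 'v \<Rightarrow> 'v) \<Rightarrow> ('g set \<Rightarrow> nat \<Rightarrow> (rat, 'w) module) \<Rightarrow>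
     ('g set \<Rightarrow> 'g set \<Rightarrow> 'g \<Rightarrow> nat \<Rightarrow> 'w \<Rightarrow> 'w) \<Rightarrow> ('g set \<Rightarrow> nat \<Rightarrow> 'v \<Rightarrow> 'w) \<Rightarrow> bool" where
  "system_map \<Gamma> V T W S \<eta> \<longleftrightarrow>
     (\<forall>H n. subgroup H \<Gamma> \<longrightarrow> \<eta> H n \<in> linear_maps (V H n) (W H n)) \<and>
     (\<forall>H K a n. subgroup H \<Gamma> \<and> subgroup K \<Gamma> \<and> H \<subseteq> K \<and> a \<in> carrier \<Gamma> \<longrightarrow>
        (\<forall>x\<in>carrier (V H n). \<eta> K n (T H K a n x) = S H K a n (\<eta> H n x)))"

definition injective_system ::
    "'u itself \<Rightarrow> ('g, 'm) monoid_scheme \<Rightarrow> ('g set \<Rightarrow> nat \<Rightarrow> (rat, 'v) module) \<Rightarrow>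
     ('g set \<Rightarrow> 'g set \<Rightarrow> 'g \<Rightarrow> nat \<Rightarrow> 'v \<Rightarrow> 'v) \<Rightarrow> bool" where
  "injective_system U \<Gamma> V T \<longleftrightarrow>
     orbit_system \<Gamma> V T \<and>
     (\<forall>(A :: 'g set \<Rightarrow> nat \<Rightarrow> (rat, 'u) module) TA (B :: 'g set \<Rightarrow> nat \<Rightarrow> (rat, 'u) module) TB f g.
        orbit_system \<Gamma> A TA \<and> orbit_system \<Gamma> B TB \<and>
        system_map \<Gamma> A TA B TB f \<and> (\<forall>H n. subgroup H \<Gamma> \<longrightarrow> inj_on (f H n) (carrier (A H n))) \<and>
        system_map \<Gamma> A TA V T g \<longrightarrow>
        (\<exists>h. system_map \<Gamma> B TB V T h \<and>
             (\<forall>H n. subgroup H \<Gamma> \<longrightarrow> (\<forall>x\<in>carrier (A H n). h H n (f H n x) = g H n x))))"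

definition translation_diagram ::
    "('g set \<Rightarrow> nat \<Rightarrow> (rat, 'v) module) \<Rightarrow>
     ('g set \<Rightarrow> 'g set \<Rightarrow> 'g \<Rightarrow> nat \<Rightarrow> 'v \<Rightarrow> 'v) \<Rightarrow> ('g, 'v) diagram" where
  "translation_diagram V T =
     \<lparr>ob = V, mor = (\<lambda>H K f n. T H K (SOME a. a \<in> f H) n)\<rparr>"

definition translation ::
    "('g, 'm) monoid_scheme \<Rightarrow> 'g set \<Rightarrow> 'g set \<Rightarrow> 'g \<Rightarrow> 'g set \<Rightarrow> 'g set" where
  "translation \<Gamma> H K a = (\<lambda>C\<in>lcosets\<^bsub>\<Gamma>\<^esub> H. a <#\<^bsub>\<Gamma>\<^esub> (C <#>\<^bsub>\<Gamma>\<^esub> K))"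

lemma linear_maps_closed: "f \<in> linear_maps V W \<Longrightarrow> x \<in> carrier V \<Longrightarrow> f x \<in> carrier W"
  by (auto simp: linear_maps_def)

lemma orbit_systemI:
  assumes "\<And>H n. subgroup H \<Gamma> \<Longrightarrow> module rat_field (V H n)"
    and "\<And>H K a n. subgroup H \<Gamma> \<Longrightarrow> subgroup K \<Gamma> \<Longrightarrow> H \<subseteq> K \<Longrightarrow> a \<in> carrier \<Gamma> \<Longrightarrow>
           T H K a n \<in> linear_maps (V H n) (V K n)"
    and "\<And>H h n x. subgroup H \<Gamma> \<Longrightarrow> h \<in> H \<Longrightarrow> x \<in> carrier (V H n) \<Longrightarrow> T H H h n x = x"
    and "\<And>H K L a b n x. subgroup H \<Gamma> \<Longrightarrow> subgroup K \<Gamma> \<Longrightarrow> subgroup L \<Gamma> \<Longrightarrow> H \<subseteq> K \<Longrightarrow> K \<subseteq> L \<Longrightarrow>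
           a \<in> carrier \<Gamma> \<Longrightarrow> b \<in> carrier \<Gamma> \<Longrightarrow> x \<in> carrier (V H n) \<Longrightarrow>
           T H L (a \<otimes>\<^bsub>\<Gamma>\<^esub> b) n x = T K L b n (T H K a n x)"
  shows "orbit_system \<Gamma> V T"
  using assms unfolding orbit_system_def by simp

lemma orbit_systemD:
  assumes "orbit_system \<Gamma> V T"
  shows "\<And>H n. subgroup H \<Gamma> \<Longrightarrow> module rat_field (V H n)"
    and "\<And>H K a n. subgroup H \<Gamma> \<Longrightarrow> subgroup K \<Gamma> \<Longrightarrow> H \<subseteq> K \<Longrightarrow> a \<in> carrier \<Gamma> \<Longrightarrow>
           T H K a n \<in> linear_maps (V H n) (V K n)"
    and "\<And>H h n x. subgroup H \<Gamma> \<Longrightarrow> h \<in> H \<Longrightarrow> x \<in> carrier (V H n) \<Longrightarrow> T H H h n x = x"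
    and "\<And>H K L a b n x. subgroup H \<Gamma> \<Longrightarrow> subgroup K \<Gamma> \<Longrightarrow> subgroup L \<Gamma> \<Longrightarrow> H \<subseteq> K \<Longrightarrow> K \<subseteq> L \<Longrightarrow>
           a \<in> carrier \<Gamma> \<Longrightarrow> b \<in> carrier \<Gamma> \<Longrightarrow> x \<in> carrier (V H n) \<Longrightarrow>
           T H L (a \<otimes>\<^bsub>\<Gamma>\<^esub> b) n x = T K L b n (T H K a n x)"
  using assms unfolding orbit_system_def by simp_all

lemma system_mapI:
  assumes "\<And>H n. subgroup H \<Gamma> \<Longrightarrow> \<eta> H n \<in> linear_maps (V H n) (W H n)"
    and "\<And>H K a n x. subgroup H \<Gamma> \<Longrightarrow> subgroup K \<Gamma> \<Longrightarrow> H \<subseteq> K \<Longrightarrow> a \<in> carrier \<Gamma> \<Longrightarrow>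
           x \<in> carrier (V H n) \<Longrightarrow> \<eta> K n (T H K a n x) = S H K a n (\<eta> H n x)"
  shows "system_map \<Gamma> V T W S \<eta>"
  using assms unfolding system_map_def by simp

lemma system_mapD:
  assumes "system_map \<Gamma> V T W S \<eta>"
  shows "\<And>H n. subgroup H \<Gamma> \<Longrightarrow> \<eta> H n \<in> linear_maps (V H n) (W H n)"
    and "\<And>H K a n x. subgroup H \<Gamma> \<Longrightarrow> subgroup K \<Gamma> \<Longrightarrow> H \<subseteq> K \<Longrightarrow> a \<in> carrier \<Gamma> \<Longrightarrow>
           x \<in> carrier (V H n) \<Longrightarrow> \<eta> K n (T H K a n x) = S H K a n (\<eta> H n x)"
  using assms unfolding system_map_def by simp_all

lemma orbit_system_cong:
  assumes "orbit_system \<Gamma> V T" and V: "\<And>H n. subgroup H \<Gamma> \<Longrightarrow> V' H n = V H n"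
    and T: "\<And>H K a n. subgroup H \<Gamma> \<Longrightarrow> subgroup K \<Gamma> \<Longrightarrow> H \<subseteq> K \<Longrightarrow> a \<in> carrier \<Gamma> \<Longrightarrow> T' H K a n = T H K a n"
    and "group \<Gamma>"
  shows "orbit_system \<Gamma> V' T'"
proof (rule orbit_systemI)
  note sys = orbit_systemD[OF assms(1)]
  interpret group \<Gamma> by fact
  show "module rat_field (V' H n)" if "subgroup H \<Gamma>" for H n using sys(1) V that by simp
  show "T' H K a n \<in> linear_maps (V' H n) (V' K n)"
    if "subgroup H \<Gamma>" "subgroup K \<Gamma>" "H \<subseteq> K" "a \<in> carrier \<Gamma>" for H K a n
    using sys(2)[OF that] V T that by simp
  show "T' H H h n x = x" if "subgroup H \<Gamma>" "h \<in> H" "x \<in> carrier (V' H n)" for H h n x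
    using sys(3)[of H h x n] V T[of H H h n] subgroup.mem_carrier[OF that(1,2)] that by simp
  show "T' H L (a \<otimes>\<^bsub>\<Gamma>\<^esub> b) n x = T' K L b n (T' H K a n x)"
    if *: "subgroup H \<Gamma>" "subgroup K \<Gamma>" "subgroup L \<Gamma>" "H \<subseteq> K" "K \<subseteq> L" "a \<in> carrier \<Gamma>" "b \<in> carrier \<Gamma>"
      and x: "x \<in> carrier (V' H n)" for H K L a b n x
  proof -
    have "H \<subseteq> L" using * by blast
    have "T' H L (a \<otimes>\<^bsub>\<Gamma>\<^esub> b) n = T H L (a \<otimes>\<^bsub>\<Gamma>\<^esub> b) n" using T[OF *(1,3) \<open>H \<subseteq> L\<close>] * by simp
    then show ?thesis using sys(4)[OF *, of x n] x V[OF *(1)] T[OF *(1,2,4,6)] T[OF *(2,3,5,7)] by simp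
  qed
qed

context comm_group
begin

lemma lcoset_set_mult:
  assumes "subgroup H G" "subgroup K G" "H \<subseteq> K" "a \<in> carrier G" "g \<in> carrier G"
  shows "a <# ((g <# H) <#> K) = (a \<otimes> g) <# K"
proof -
  have "(g <# H) <#> K = g <# (H <#> K)"
    using assms by (simp add: setmult_lcos_assoc subgroup.subset)
  also have "H <#> K = K"
  proof -
    have "H <#> K \<subseteq> K"
      using assms(3) subgroup.m_closed[OF assms(2)] unfolding set_mult_def by fast
    moreover have "K \<subseteq> H <#> K"
    proof
      fix k assume "k \<in> K"
      then have "k = \<one> \<otimes> k" using assms(2) subgroup.mem_carrier by fastforce
      then show "k \<in> H <#> K"
        using \<open>k \<in> K\<close> subgroup.one_closed[OF assms(1)] unfolding set_mult_def by blast
    qed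
    ultimately show ?thesis by blast
  qed
  finally show ?thesis using assms by (simp add: lcos_m_assoc subgroup.subset)
qed

lemma lcosets_base: "subgroup H G \<Longrightarrow> H \<in> lcosets H"
  by (metis LCOSETS_def UN_iff insertI1 lcos_mult_one one_closed subgroup.subset)

lemma translation_lcoset:
  assumes "subgroup H G" "subgroup K G" "H \<subseteq> K" "a \<in> carrier G" "g \<in> carrier G"
  shows "translation G H K a (g <# H) = (a \<otimes> g) <# K"
  using assms lcoset_set_mult by (auto simp: translation_def LCOSETS_def)

lemma translation_base:
  assumes "subgroup H G" "subgroup K G" "H \<subseteq> K" "a \<in> carrier G"
  shows "translation G H K a H = a <# K"
  using translation_lcoset[OF assms one_closed] assms by (simp add: lcos_mult_one subgroup.subset)

lemma translation_in_orbit_maps: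
  assumes "subgroup H G" "subgroup K G" "H \<subseteq> K" "a \<in> carrier G"
  shows "translation G H K a \<in> orbit_maps G H K"
proof -
  have "translation G H K a \<in> lcosets H \<rightarrow>\<^sub>E lcosets K"
  proof (rule PiE_I)
    fix C assume "C \<in> lcosets H"
    then show "translation G H K a C \<in> lcosets K"
      using assms translation_lcoset by (auto simp: LCOSETS_def)
  qed (simp add: translation_def)
  moreover have "translation G H K a (g <# C) = g <# translation G H K a C"
    if "g \<in> carrier G" "C \<in> lcosets H" for g C
    using that assms translation_lcoset
    by (auto simp: LCOSETS_def lcos_m_assoc subgroup.subset m_ac)
  ultimately show ?thesis by (simp add: orbit_maps_def)
qed

text \<open>
  Commutativity makes the stabiliser of a coset of \<open>K\<close> equal to \<open>K\<close>, whatever the coset; an orbit map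
  sends the base point, which \<open>H\<close> fixes, to such a coset.
\<close>

lemma orbit_maps_translation:
  assumes H: "subgroup H G" and K: "subgroup K G" and f: "f \<in> orbit_maps G H K"
  shows "H \<subseteq> K" and "f H \<noteq> {}"
    and "\<And>a. a \<in> f H \<Longrightarrow> a \<in> carrier G \<and> f = translation G H K a"
proof -
  have "f H \<in> lcosets K" using f lcosets_base[OF H] by (auto simp: orbit_maps_def)
  then obtain c where c: "c \<in> carrier G" "f H = c <# K" by (auto simp: LCOSETS_def)
  show "f H \<noteq> {}" using c lcos_self[OF c(1) K] by auto
  show HK: "H \<subseteq> K"
  proof
    fix h assume h: "h \<in> H"
    have hc: "h \<in> carrier G" using h H subgroup.mem_carrier by metis
    have "h <# H = H" using h H hc by (simp add: coset_join3)
    moreover have "f (h <# H) = h <# f H" using f lcosets_base[OF H] hc by (simp add: orbit_maps_def)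
    ultimately have "h <# f H = f H" by simp
    moreover have "h \<otimes> c \<in> h <# (c <# K)" using lcos_self[OF c(1) K] unfolding l_coset_def by blast
    ultimately have "h \<otimes> c \<in> c <# K" using c by simp
    then obtain k where k: "k \<in> K" "h \<otimes> c = c \<otimes> k" by (auto simp: l_coset_def)
    then have "c \<otimes> h = c \<otimes> k" using c hc m_comm by simp
    moreover have "k \<in> carrier G" using k K subgroup.mem_carrier by metis
    ultimately show "h \<in> K" using k c hc by simp
  qed
  fix a assume a: "a \<in> f H"
  have ac: "a \<in> carrier G" "f H = a <# K"
    using a c K by (metis subgroup.elemlcos_carrier is_group, metis l_repr_independence)
  have "f C = translation G H K a C" for C
  proof (cases "C \<in> lcosets H")
    case True
    then obtain g where g: "g \<in> carrier G" "C = g <# H" by (auto simp: LCOSETS_def)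
    have "f C = g <# f H" using f g lcosets_base[OF H] by (auto simp: orbit_maps_def)
    then show ?thesis
      using ac g translation_lcoset[OF H K HK] K by (simp add: lcos_m_assoc subgroup.subset m_comm)
  next
    case False
    then show ?thesis using f by (auto simp: orbit_maps_def translation_def PiE_def extensional_def)
  qed
  then show "a \<in> carrier G \<and> f = translation G H K a" using ac by auto
qed

lemma orbit_map_cases:
  assumes "subgroup H G" "subgroup K G" "f \<in> orbit_maps G H K"
  obtains a where "a \<in> carrier G" "H \<subseteq> K" "f = translation G H K a"
  using orbit_maps_translation[OF assms] by blast

lemma translation_one:
  assumes "subgroup H G" "h \<in> H"
  shows "translation G H H h = (\<lambda>C\<in>lcosets H. C)"
proof
  fix C
  show "translation G H H h C = (\<lambda>C\<in>lcosets H. C) C"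
  proof (cases "C \<in> lcosets H")
    case True
    then obtain g where g: "g \<in> carrier G" "C = g <# H" by (auto simp: LCOSETS_def)
    have h: "h \<in> carrier G" using assms subgroup.mem_carrier by metis
    have "(h \<otimes> g) <# H = g <# (h <# H)" using g h assms(1) 
      by (simp add: lcos_m_assoc subgroup.subset m_comm)
    also have "h <# H = H" using assms h by (simp add: coset_join3)
    finally show ?thesis using True g h assms translation_lcoset by simp
  qed (simp add: translation_def)
qed

lemma translation_compose:
  assumes "subgroup H G" "subgroup K G" "subgroup L G" "H \<subseteq> K" "K \<subseteq> L" "a \<in> carrier G" "b \<in> carrier G"
  shows "compose (lcosets H) (translation G K L b) (translation G H K a) = translation G H L (a \<otimes> b)"
proof
  fix C
  show "compose (lcosets H) (translation G K L b) (translation G H K a) C = translation G H L (a \<otimes> b) C"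
  proof (cases "C \<in> lcosets H")
    case True
    then obtain g where g: "g \<in> carrier G" "C = g <# H" by (auto simp: LCOSETS_def)
    then show ?thesis using assms True translation_lcoset[of H K a g] translation_lcoset[of K L b "a \<otimes> g"]
        translation_lcoset[of H L "a \<otimes> b" g]
      by (simp add: compose_def m_ac)
  qed (simp add: compose_def translation_def)
qed

lemma orbit_system_of_diagram:
  assumes D: "vec_diagram G D"
  shows "orbit_system G (ob D) (\<lambda>H K a. mor D H K (translation G H K a))"
proof (rule orbit_systemI)
  show "module rat_field (ob D H n)" if "subgroup H G" for H n
    using D that by (simp add: vec_diagram_def)
  show "mor D H K (translation G H K a) n \<in> linear_maps (ob D H n) (ob D K n)"
    if "subgroup H G" "subgroup K G" "H \<subseteq> K" "a \<in> carrier G" for H K a n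
    using D that translation_in_orbit_maps[OF that] by (simp add: vec_diagram_def)
  show "mor D H H (translation G H H h) n x = x"
    if "subgroup H G" "h \<in> H" "x \<in> carrier (ob D H n)" for H h n x
    using D[unfolded vec_diagram_def] that by (simp add: translation_one)
  show "mor D H L (translation G H L (a \<otimes> b)) n x
      = mor D K L (translation G K L b) n (mor D H K (translation G H K a) n x)"
    if "subgroup H G" "subgroup K G" "subgroup L G" "H \<subseteq> K" "K \<subseteq> L" "a \<in> carrier G" "b \<in> carrier G"
      "x \<in> carrier (ob D H n)" for H K L a b n x
  proof -
    have "mor D H L (compose (lcosets H) (translation G K L b) (translation G H K a)) n x
        = mor D K L (translation G K L b) n (mor D H K (translation G H K a) n x)"
      using D[unfolded vec_diagram_def, THEN conjunct2, THEN conjunct2, THEN conjunct2] that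
        translation_in_orbit_maps[of H K a] translation_in_orbit_maps[of K L b] by simp
    then show ?thesis using that by (simp add: translation_compose)
  qed
qed

text \<open>
  Translation by \<open>ak\<close> is translation by \<open>a\<close> followed by the translation by \<open>k\<close> of \<open>\<Gamma>/K\<close>, which is
  the identity.
\<close>

lemma orbit_system_coset_invariant:
  assumes V: "orbit_system G V T" and "subgroup H G" "subgroup K G" "H \<subseteq> K" "a \<in> carrier G"
    "x \<in> carrier (V H n)" and k: "k \<in> K"
  shows "T H K (a \<otimes> k) n x = T H K a n x"
proof -
  have "T H K (a \<otimes> k) n x = T K K k n (T H K a n x)"
    using orbit_systemD(4)[OF V, of H K K a k x n] assms subgroup.mem_carrier by fastforce
  also have "\<dots> = T H K a n x"
    using orbit_systemD(3)[OF V \<open>subgroup K G\<close> k] linear_maps_closed[OF orbit_systemD(2)[OF V assms(2-5)] assms(6)] .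
  finally show ?thesis .
qed

lemma mor_translation_diagram:
  assumes V: "orbit_system G V T" and "subgroup H G" "subgroup K G" "H \<subseteq> K" "a \<in> carrier G"
    "x \<in> carrier (V H n)"
  shows "mor (translation_diagram V T) H K (translation G H K a) n x = T H K a n x"
proof -
  define b where "b = (SOME b. b \<in> a <# K)"
  have "b \<in> a <# K" unfolding b_def using lcos_self assms by (metis someI)
  then obtain k where k: "k \<in> K" "b = a \<otimes> k" by (auto simp: l_coset_def)
  then have "T H K b n x = T H K a n x" using orbit_system_coset_invariant[OF assms] by simp
  then show ?thesis using assms by (simp add: translation_diagram_def translation_base b_def)
qed

lemma vec_diagram_translation_diagram:
  assumes V: "orbit_system G V T"
  shows "vec_diagram G (translation_diagram V T)"
proof -
  let ?D = "translation_diagram V T"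
  have ob: "ob ?D = V" by (simp add: translation_diagram_def)
  note mt = mor_translation_diagram[OF V] and VD = orbit_systemD[OF V]
  have lin: "mor ?D H K f n \<in> linear_maps (V H n) (V K n)"
    if S: "subgroup H G" "subgroup K G" and f: "f \<in> orbit_maps G H K" for H K f n
  proof -
    have "(SOME a. a \<in> f H) \<in> f H" using orbit_maps_translation(2)[OF S f] by (simp add: some_in_eq)
    then show ?thesis
      using orbit_maps_translation[OF S f] VD(2) S by (simp add: translation_diagram_def)
  qed
  have idm: "mor ?D H H (\<lambda>C\<in>lcosets H. C) n x = x" if S: "subgroup H G" and x: "x \<in> carrier (V H n)" for H n x
    using mt[OF S S _ one_closed x] VD(3)[OF S _ x, of \<one>] translation_one[OF S, of \<one>] subgroup.one_closed[OF S]
    by simp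
  have comp: "mor ?D H L (compose (lcosets H) f' f) n x = mor ?D K L f' n (mor ?D H K f n x)"
    if S: "subgroup H G" "subgroup K G" "subgroup L G" and f: "f \<in> orbit_maps G H K" "f' \<in> orbit_maps G K L"
      and x: "x \<in> carrier (V H n)" for H K L f f' n x
  proof -
    obtain a where a: "a \<in> carrier G" "H \<subseteq> K" "f = translation G H K a"
      using orbit_map_cases[OF S(1,2) f(1)] by metis
    obtain b where b: "b \<in> carrier G" "K \<subseteq> L" "f' = translation G K L b"
      using orbit_map_cases[OF S(2,3) f(2)] by metis
    have "T H K a n x \<in> carrier (V K n)" using VD(2) S a x linear_maps_closed by metis
    moreover have "T H L (a \<otimes> b) n x = T K L b n (T H K a n x)" using VD(4) a b S x by blast
    moreover have "H \<subseteq> L" using a b by blast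
    ultimately show ?thesis using a b S x by (simp add: translation_compose mt)
  qed
  show ?thesis unfolding vec_diagram_def ob using VD(1) lin idm comp by blast
qed

text \<open>
  Naturality has to be tested on translations only, as there are no other orbit maps.
\<close>

lemma diagram_map_iff_system_map:
  "diagram_map G D E \<eta> \<longleftrightarrow>
     system_map G (ob D) (\<lambda>H K a. mor D H K (translation G H K a))
       (ob E) (\<lambda>H K a. mor E H K (translation G H K a)) \<eta>"
    (is "?L \<longleftrightarrow> ?R")
proof
  assume ?L
  then show ?R unfolding diagram_map_def system_map_def using translation_in_orbit_maps by simp
next
  assume R: ?R
  have "\<eta> K n (mor D H K f n x) = mor E H K f n (\<eta> H n x)"
    if S: "subgroup H G" "subgroup K G" and f: "f \<in> orbit_maps G H K" and x: "x \<in> carrier (ob D H n)"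
    for H K f n x
  proof -
    obtain a where "a \<in> carrier G" "H \<subseteq> K" "f = translation G H K a" using orbit_map_cases[OF S f] .
    then show ?thesis using system_mapD(2)[OF R S] x by simp
  qed
  then show ?L using R unfolding diagram_map_def system_map_def by simp
qed

lemma system_map_cong:
  assumes "\<And>H n. subgroup H G \<Longrightarrow> V H n = V' H n" and "\<And>H n. subgroup H G \<Longrightarrow> W H n = W' H n"
    and "\<And>H K a n x. subgroup H G \<Longrightarrow> subgroup K G \<Longrightarrow> H \<subseteq> K \<Longrightarrow> a \<in> carrier G \<Longrightarrow> x \<in> carrier (V H n) \<Longrightarrow>
      T H K a n x = T' H K a n x"
    and "\<And>H K a n x. subgroup H G \<Longrightarrow> subgroup K G \<Longrightarrow> H \<subseteq> K \<Longrightarrow> a \<in> carrier G \<Longrightarrow> x \<in> carrier (W H n) \<Longrightarrow>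
      S H K a n x = S' H K a n x"
  shows "system_map G V T W S \<eta> \<longleftrightarrow> system_map G V' T' W' S' \<eta>"
proof
  assume \<eta>: "system_map G V T W S \<eta>"
  show "system_map G V' T' W' S' \<eta>"
  proof (rule system_mapI)
    fix H K a n x assume *: "subgroup H G" "subgroup K G" "H \<subseteq> K" "a \<in> carrier G" "x \<in> carrier (V' H n)"
    then have x: "x \<in> carrier (V H n)" using assms(1) by simp
    have "\<eta> H n x \<in> carrier (W H n)" using linear_maps_closed[OF system_mapD(1)[OF \<eta> *(1)] x] .
    then show "\<eta> K n (T' H K a n x) = S' H K a n (\<eta> H n x)"
      using system_mapD(2)[OF \<eta> *(1-4) x] assms(3)[OF *(1-4) x] assms(4)[OF *(1-4)] by simp
  qed (use system_mapD(1)[OF \<eta>] assms(1,2) in simp)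
next
  assume \<eta>: "system_map G V' T' W' S' \<eta>"
  show "system_map G V T W S \<eta>"
  proof (rule system_mapI)
    fix H K a n x assume *: "subgroup H G" "subgroup K G" "H \<subseteq> K" "a \<in> carrier G" "x \<in> carrier (V H n)"
    then have x: "x \<in> carrier (V' H n)" using assms(1) by simp
    have "\<eta> H n x \<in> carrier (W H n)"
      using linear_maps_closed[OF system_mapD(1)[OF \<eta> *(1)] x] assms(2) *(1) by simp
    then show "\<eta> K n (T H K a n x) = S H K a n (\<eta> H n x)"
      using system_mapD(2)[OF \<eta> *(1-4) x] assms(3)[OF *] assms(4)[OF *(1-4)] by simp
  qed (use system_mapD(1)[OF \<eta>] assms(1,2) in simp)
qed

lemma injective_system_cong:
  fixes U :: "'u itself"
  assumes inj: "injective_system U G V T" and V: "\<And>H n. subgroup H G \<Longrightarrow> V' H n = V H n"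
    and T: "\<And>H K a n. subgroup H G \<Longrightarrow> subgroup K G \<Longrightarrow> H \<subseteq> K \<Longrightarrow> a \<in> carrier G \<Longrightarrow> T' H K a n = T H K a n"
  shows "injective_system U G V' T'"
proof -
  have sys: "orbit_system G V' T'"
    by (rule orbit_system_cong[OF _ V T is_group]) (use inj in \<open>simp add: injective_system_def\<close>)
  have eq: "system_map G B TB V' T' \<eta> \<longleftrightarrow> system_map G B TB V T \<eta>"
    for B :: "'a set \<Rightarrow> nat \<Rightarrow> (rat, 'u) module" and TB \<eta>
    by (rule system_map_cong) (simp_all add: V T)
  show ?thesis
    unfolding injective_system_def eq by (rule conjI[OF sys inj[unfolded injective_system_def, THEN conjunct2]])
qed

lemma system_map_translation_diagram:
  assumes "orbit_system G V T" "orbit_system G W S"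
  shows "diagram_map G (translation_diagram V T) (translation_diagram W S) \<eta> \<longleftrightarrow> system_map G V T W S \<eta>"
proof -
  have ob: "ob (translation_diagram V T) = V" "ob (translation_diagram W S) = W"
    by (simp_all add: translation_diagram_def)
  show ?thesis
    unfolding diagram_map_iff_system_map ob
    by (rule system_map_cong) (simp_all add: mor_translation_diagram assms)
qed

text \<open>
  Every test diagram yields a test system and conversely, so the two notions of injectivity have the
  same extension problems.
\<close>

lemma injective_translation_diagram_iff:
  fixes U :: "'u itself"
  assumes V: "orbit_system G V T"
  shows "injective_diagram U G (translation_diagram V T) \<longleftrightarrow> injective_system U G V T"
proof
  assume inj: "injective_diagram U G (translation_diagram V T)"
  show "injective_system U G V T"
    unfolding injective_system_def
  proof (intro conjI allI impI; (elim conjE)?)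
    fix A B :: "'a set \<Rightarrow> nat \<Rightarrow> (rat, 'u) module"
    fix TA TB f g
    assume A: "orbit_system G A TA" and B: "orbit_system G B TB" and f: "system_map G A TA B TB f"
      and f_inj: "\<forall>H n. subgroup H G \<longrightarrow> inj_on (f H n) (carrier (A H n))" and g: "system_map G A TA V T g"
    show "\<exists>h. system_map G B TB V T h \<and> (\<forall>H n. subgroup H G \<longrightarrow> (\<forall>x\<in>carrier (A H n). h H n (f H n x) = g H n x))"
      using inj[unfolded injective_diagram_def, THEN conjunct2, rule_format,
          of "translation_diagram A TA" "translation_diagram B TB" f g] A B f f_inj g V
      by (simp add: vec_diagram_translation_diagram system_map_translation_diagram)
        (simp add: translation_diagram_def)
  qed (rule V)
next
  assume inj: "injective_system U G V T"
  have map_iff: "diagram_map G D (translation_diagram V T) \<eta> \<longleftrightarrow>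
      system_map G (ob D) (\<lambda>H K a. mor D H K (translation G H K a)) V T \<eta>" for D :: "('a, 'u) diagram" and \<eta>
  proof -
    have ob: "ob (translation_diagram V T) = V" by (simp add: translation_diagram_def)
    show ?thesis
      unfolding diagram_map_iff_system_map ob
      by (rule system_map_cong) (simp_all add: V mor_translation_diagram)
  qed
  show "injective_diagram U G (translation_diagram V T)"
    unfolding injective_diagram_def
  proof (intro conjI allI impI; (elim conjE)?)
    fix A B :: "('a, 'u) diagram" and f g
    assume A: "vec_diagram G A" and B: "vec_diagram G B" and f: "diagram_map G A B f"
      and f_inj: "\<forall>H n. subgroup H G \<longrightarrow> inj_on (f H n) (carrier (ob A H n))"
      and g: "diagram_map G A (translation_diagram V T) g"
    show "\<exists>h. diagram_map G B (translation_diagram V T) h \<and>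
        (\<forall>H n. subgroup H G \<longrightarrow> (\<forall>x\<in>carrier (ob A H n). h H n (f H n x) = g H n x))"
      unfolding map_iff
      by (rule inj[unfolded injective_system_def, THEN conjunct2, rule_format,
          OF conjI[OF orbit_system_of_diagram[OF A] conjI[OF orbit_system_of_diagram[OF B]
            conjI[OF f[unfolded diagram_map_iff_system_map] conjI[OF f_inj g[unfolded map_iff]]]]]])
  qed (rule vec_diagram_translation_diagram[OF V])
qed

text \<open>
  Used for diagrams, such as those of cohomology, whose functoriality is known in terms of orbit maps.
\<close>

lemma orbit_system_of_translation_diagram:
  assumes D: "vec_diagram G (translation_diagram V T)"
    and T: "\<And>H K a k n. subgroup H G \<Longrightarrow> subgroup K G \<Longrightarrow> H \<subseteq> K \<Longrightarrow> a \<in> carrier G \<Longrightarrow> k \<in> K \<Longrightarrow>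
      T H K (a \<otimes> k) n = T H K a n"
  shows "orbit_system G V T"
proof -
  have ob: "ob (translation_diagram V T) = V" by (simp add: translation_diagram_def)
  have mor: "mor (translation_diagram V T) H K (translation G H K a) n = T H K a n"
    if *: "subgroup H G" "subgroup K G" "H \<subseteq> K" "a \<in> carrier G" for H K a n
  proof -
    have "(SOME b. b \<in> a <# K) \<in> a <# K" using lcos_self that by (metis someI)
    then obtain k where "k \<in> K" "(SOME b. b \<in> a <# K) = a \<otimes> k" by (auto simp: l_coset_def)
    then show ?thesis using T[OF *] * by (simp add: translation_diagram_def translation_base)
  qed
  note sys = orbit_systemD[OF orbit_system_of_diagram[OF D], unfolded ob]
  show ?thesis
  proof (rule orbit_systemI)
    fix H h n x assume "subgroup H G" "h \<in> H" "x \<in> carrier (V H n)"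
    then show "T H H h n x = x" using sys(3)[of H h x n] mor[of H H h n] subgroup.mem_carrier by fastforce
  next
    fix H K L a b n x
    assume "subgroup H G" "subgroup K G" "subgroup L G" "H \<subseteq> K" "K \<subseteq> L" "a \<in> carrier G" "b \<in> carrier G"
      "x \<in> carrier (V H n)"
    moreover from this have "H \<subseteq> L" by blast
    ultimately show "T H L (a \<otimes> b) n x = T K L b n (T H K a n x)"
      using sys(4)[of H K L a b x n] by (simp add: mor)
  next
    fix H K a n
    assume "subgroup H G" "subgroup K G" "H \<subseteq> K" "a \<in> carrier G"
    then show "T H K a n \<in> linear_maps (V H n) (V K n)" using sys(2)[of H K a n] mor by simp
  qed (rule sys(1))
qed

end

section \<open>Rational vector spaces\<close>

lemma rat_field_simps [simp]:
  "carrier rat_field = UNIV" "\<one>\<^bsub>rat_field\<^esub> = 1" "\<zero>\<^bsub>rat_field\<^esub> = 0"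
  "x \<oplus>\<^bsub>rat_field\<^esub> y = x + y" "x \<otimes>\<^bsub>rat_field\<^esub> y = x * y"
  by (simp_all add: rat_field_def)

lemma linear_maps_add:
  "f \<in> linear_maps V W \<Longrightarrow> x \<in> carrier V \<Longrightarrow> y \<in> carrier V \<Longrightarrow> f (x \<oplus>\<^bsub>V\<^esub> y) = f x \<oplus>\<^bsub>W\<^esub> f y"
  and linear_maps_smult: "f \<in> linear_maps V W \<Longrightarrow> x \<in> carrier V \<Longrightarrow> f (r \<odot>\<^bsub>V\<^esub> x) = r \<odot>\<^bsub>W\<^esub> f x"
  by (auto simp: linear_maps_def)

lemma linear_mapsI:
  assumes "\<And>x. x \<in> carrier V \<Longrightarrow> f x \<in> carrier W"
    and "\<And>x y. x \<in> carrier V \<Longrightarrow> y \<in> carrier V \<Longrightarrow> f (x \<oplus>\<^bsub>V\<^esub> y) = f x \<oplus>\<^bsub>W\<^esub> f y"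
    and "\<And>r x. x \<in> carrier V \<Longrightarrow> f (r \<odot>\<^bsub>V\<^esub> x) = r \<odot>\<^bsub>W\<^esub> f x"
  shows "f \<in> linear_maps V W"
  using assms by (auto simp: linear_maps_def)

lemma linear_maps_compose:
  "f \<in> linear_maps V W \<Longrightarrow> g \<in> linear_maps W Z \<Longrightarrow> (\<lambda>x. g (f x)) \<in> linear_maps V Z"
  by (auto intro!: linear_mapsI simp: linear_maps_closed linear_maps_add linear_maps_smult)

locale rat_module = module rat_field M for M :: "(rat, 'v) module" (structure)
begin

lemma rat_smult_closed [simp]: "x \<in> carrier M \<Longrightarrow> r \<odot> x \<in> carrier M"
  using smult_closed by simp

lemma rat_smult_assoc: "x \<in> carrier M \<Longrightarrow> r \<odot> (s \<odot> x) = (r * s) \<odot> x"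
  using smult_assoc1[of r s x] by simp

lemma rat_smult_one [simp]: "x \<in> carrier M \<Longrightarrow> 1 \<odot> x = x"
  using smult_one by simp

lemma rat_smult_null [simp]: "x \<in> carrier M \<Longrightarrow> 0 \<odot> x = \<zero>" "r \<odot> \<zero> = \<zero>"
  using smult_l_null[of x] smult_r_null[of r] by simp_all

lemma rat_smult_distr:
  "x \<in> carrier M \<Longrightarrow> (r + s) \<odot> x = r \<odot> x \<oplus> s \<odot> x"
  "x \<in> carrier M \<Longrightarrow> y \<in> carrier M \<Longrightarrow> r \<odot> (x \<oplus> y) = r \<odot> x \<oplus> r \<odot> y"
  using smult_l_distr[of r s x] smult_r_distr[of r x y] by simp_all

end

lemma rat_moduleI: "module rat_field M \<Longrightarrow> rat_module M"
  by (simp add: rat_module_def)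

lemma linear_maps_zero:
  assumes "module rat_field V" "module rat_field W" "f \<in> linear_maps V W"
  shows "f \<zero>\<^bsub>V\<^esub> = \<zero>\<^bsub>W\<^esub>"
proof -
  interpret V: rat_module V using assms(1) by (rule rat_moduleI)
  interpret W: rat_module W using assms(2) by (rule rat_moduleI)
  have "f (0 \<odot>\<^bsub>V\<^esub> \<zero>\<^bsub>V\<^esub>) = 0 \<odot>\<^bsub>W\<^esub> f \<zero>\<^bsub>V\<^esub>" using linear_maps_smult[OF assms(3)] by blast
  then show ?thesis using linear_maps_closed[OF assms(3)] by simp
qed

lemma zero_linear_map:
  assumes "module rat_field W"
  shows "(\<lambda>x. \<zero>\<^bsub>W\<^esub>) \<in> linear_maps V W"
proof -
  interpret W: rat_module W using assms(1) by (rule rat_moduleI)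
  show ?thesis by (rule linear_mapsI) simp_all
qed

text \<open>
  Closure under additive inverses comes from closure under scaling, as \<open>-x = (-1)x\<close>.
\<close>

lemma rat_submodule:
  fixes M :: "(rat, 'v) module"
  assumes "module rat_field M" "S \<subseteq> carrier M" "\<zero>\<^bsub>M\<^esub> \<in> S"
    and "\<And>x y. x \<in> S \<Longrightarrow> y \<in> S \<Longrightarrow> x \<oplus>\<^bsub>M\<^esub> y \<in> S" and "\<And>r x. x \<in> S \<Longrightarrow> r \<odot>\<^bsub>M\<^esub> x \<in> S"
  shows "module rat_field (M\<lparr>carrier := S\<rparr>)"
proof -
  interpret rat_module M using assms(1) by (rule rat_moduleI)
  have "\<ominus>\<^bsub>M\<^esub> x \<in> S" if "x \<in> S" for x
  proof -
    have "(-1) \<odot>\<^bsub>M\<^esub> x \<oplus>\<^bsub>M\<^esub> x = (-1 + 1) \<odot>\<^bsub>M\<^esub> x" using that assms(2) rat_smult_distr(1)[of x "-1" 1] by auto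
    then have "\<ominus>\<^bsub>M\<^esub> x = (-1) \<odot>\<^bsub>M\<^esub> x" using that assms(2) by (intro minus_equality) auto
    then show ?thesis using assms(5)[OF that] by simp
  qed
  then have "submodule S rat_field M" using assms(2-5) by (intro submoduleI) auto
  then show ?thesis using assms(1) by (rule submodule.submodule_is_module)
qed

text \<open>
  A vector space that is not a point contains a rational line, hence is infinite and in bijection
  with its square; for a point the claim is trivial.
\<close>

lemma rat_module_encode_functions:
  fixes M :: "(rat, 'v) module"
  assumes "module rat_field M" "finite S"
  shows "\<exists>e :: ('b \<Rightarrow> 'v) \<Rightarrow> 'v. inj_on e (S \<rightarrow>\<^sub>E carrier M)"
proof -
  interpret rat_module M using assms(1) by (rule rat_moduleI)
  show ?thesis
  proof (cases "carrier M = {\<zero>\<^bsub>M\<^esub>}")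
    case True
    then have "S \<rightarrow>\<^sub>E carrier M = {\<lambda>x\<in>S. \<zero>\<^bsub>M\<^esub>}" by (simp add: PiE_singleton restrict_def) 
    then show ?thesis by simp
  next
    case False
    then obtain x where x: "x \<in> carrier M" "x \<noteq> \<zero>\<^bsub>M\<^esub>" by blast
    have "inj (\<lambda>r. r \<odot>\<^bsub>M\<^esub> x)"
    proof (rule injI, rule ccontr)
      fix r s assume rs: "r \<odot>\<^bsub>M\<^esub> x = s \<odot>\<^bsub>M\<^esub> x" "r \<noteq> s"
      have "r \<odot>\<^bsub>M\<^esub> x = (r - s) \<odot>\<^bsub>M\<^esub> x \<oplus>\<^bsub>M\<^esub> s \<odot>\<^bsub>M\<^esub> x" using rat_smult_distr(1)[OF x(1), of "r - s" s] by simp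
      then have "(r - s) \<odot>\<^bsub>M\<^esub> x = \<zero>\<^bsub>M\<^esub>" using rs(1) x(1) by (metis M.add.r_cancel_one' rat_smult_closed)
      then have "inverse (r - s) \<odot>\<^bsub>M\<^esub> ((r - s) \<odot>\<^bsub>M\<^esub> x) = \<zero>\<^bsub>M\<^esub>" by simp
      then show False using rs(2) x by (simp add: rat_smult_assoc)
    qed
    then have "infinite (range (\<lambda>r. r \<odot>\<^bsub>M\<^esub> x))" using finite_imageD infinite_UNIV_char_0 by blast
    moreover have "range (\<lambda>r. r \<odot>\<^bsub>M\<^esub> x) \<subseteq> carrier M" using x by auto
    ultimately have inf: "infinite (carrier M)" using finite_subset by blast
    \<comment> \<open>An infinite set is in bijection with its square; this pairing encodes one coordinate at a time.\<close>
    then obtain p where p: "bij_betw p (carrier M \<times> carrier M) (carrier M)"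
      using card_of_Times_same_infinite card_of_ordIso by blast
    have "\<exists>e :: ('b \<Rightarrow> 'v) \<Rightarrow> 'v. inj_on e (S \<rightarrow>\<^sub>E carrier M) \<and> e ` (S \<rightarrow>\<^sub>E carrier M) \<subseteq> carrier M"
      using \<open>finite S\<close>
    proof induction
      case empty
      show ?case by (intro exI[of _ "\<lambda>_. x"]) (use x in auto)
    next
      case (insert b S)
      then obtain e :: "('b \<Rightarrow> 'v) \<Rightarrow> 'v"
        where e: "inj_on e (S \<rightarrow>\<^sub>E carrier M)" "e ` (S \<rightarrow>\<^sub>E carrier M) \<subseteq> carrier M" by blast
      define e' where "e' u = p (u b, e (restrict u S))" for u
      have r: "restrict u S \<in> S \<rightarrow>\<^sub>E carrier M" "u b \<in> carrier M" "e (restrict u S) \<in> carrier M"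
        if "u \<in> insert b S \<rightarrow>\<^sub>E carrier M" for u
      proof -
        show "restrict u S \<in> S \<rightarrow>\<^sub>E carrier M" "u b \<in> carrier M" using that by (auto simp: PiE_iff)
        then show "e (restrict u S) \<in> carrier M" using e(2) by blast
      qed
      have "inj_on e' (insert b S \<rightarrow>\<^sub>E carrier M)"
      proof (rule inj_onI)
        fix u w assume u: "u \<in> insert b S \<rightarrow>\<^sub>E carrier M" and w: "w \<in> insert b S \<rightarrow>\<^sub>E carrier M" and eq: "e' u = e' w"
        have "(u b, e (restrict u S)) = (w b, e (restrict w S))"
          using eq r[OF u] r[OF w] p unfolding e'_def bij_betw_def inj_on_def by blast
        then have "u b = w b" "restrict u S = restrict w S" using inj_onD[OF e(1) _ r(1)[OF u] r(1)[OF w]] by simp_all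
        then have "u c = w c" if "c \<in> insert b S" for c using that by (metis insertE restrict_apply')
        then show "u = w" by (rule PiE_ext[OF u w])
      qed
      moreover have "e' ` (insert b S \<rightarrow>\<^sub>E carrier M) \<subseteq> carrier M"
      proof (rule image_subsetI)
        fix u assume "u \<in> insert b S \<rightarrow>\<^sub>E carrier M"
        then show "e' u \<in> carrier M" unfolding e'_def using bij_betwE[OF p] r by simp
      qed
      ultimately show ?case by blast
    qed
    then show ?thesis by blast
  qed
qed

definition function_module :: "'b set \<Rightarrow> (rat, 'v) module \<Rightarrow> (rat, 'b \<Rightarrow> 'v) module" where
  "function_module S M =
     \<lparr>carrier = S \<rightarrow>\<^sub>E carrier M, monoid.mult = undefined, one = undefined,
      zero = (\<lambda>x\<in>S. \<zero>\<^bsub>M\<^esub>), add = (\<lambda>u w. \<lambda>x\<in>S. u x \<oplus>\<^bsub>M\<^esub> w x), smult = (\<lambda>r u. \<lambda>x\<in>S. r \<odot>\<^bsub>M\<^esub> u x)\<rparr>"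

lemma function_module_simps:
  "carrier (function_module S M) = S \<rightarrow>\<^sub>E carrier M"
  "\<zero>\<^bsub>function_module S M\<^esub> = (\<lambda>x\<in>S. \<zero>\<^bsub>M\<^esub>)"
  "u \<oplus>\<^bsub>function_module S M\<^esub> w = (\<lambda>x\<in>S. u x \<oplus>\<^bsub>M\<^esub> w x)"
  "r \<odot>\<^bsub>function_module S M\<^esub> u = (\<lambda>x\<in>S. r \<odot>\<^bsub>M\<^esub> u x)"
  by (simp_all add: function_module_def)

lemma module_function_module:
  assumes "module rat_field M"
  shows "module rat_field (function_module S M)"
proof -
  interpret rat_module M using assms(1) by (rule rat_moduleI)
  have mem: "u x \<in> carrier M" if "u \<in> S \<rightarrow>\<^sub>E carrier M" "x \<in> S" for u x using that by auto
  show ?thesis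
  proof (rule moduleI)
    show "abelian_group (function_module S M)"
    proof (rule abelian_groupI)
      fix u assume u: "u \<in> carrier (function_module S M)"
      show "\<exists>w\<in>carrier (function_module S M). w \<oplus>\<^bsub>function_module S M\<^esub> u = \<zero>\<^bsub>function_module S M\<^esub>"
      proof (rule bexI)
        show "(\<lambda>x\<in>S. \<ominus>\<^bsub>M\<^esub> u x) \<in> carrier (function_module S M)"
          using u by (simp add: function_module_simps mem)
        show "(\<lambda>x\<in>S. \<ominus>\<^bsub>M\<^esub> u x) \<oplus>\<^bsub>function_module S M\<^esub> u = \<zero>\<^bsub>function_module S M\<^esub>"
          using u unfolding function_module_simps by (intro restrict_ext) (simp add: mem M.l_neg)
      qed
      show "\<zero>\<^bsub>function_module S M\<^esub> \<oplus>\<^bsub>function_module S M\<^esub> u = u"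
        using u unfolding function_module_simps by (intro extensionalityI[of _ S]) (simp_all add: mem PiE_iff)
    next
      fix u w assume "u \<in> carrier (function_module S M)" "w \<in> carrier (function_module S M)"
      then show "u \<oplus>\<^bsub>function_module S M\<^esub> w = w \<oplus>\<^bsub>function_module S M\<^esub> u"
        unfolding function_module_simps by (intro restrict_ext M.a_comm mem)
    next
      fix u w z assume "u \<in> carrier (function_module S M)" "w \<in> carrier (function_module S M)"
        "z \<in> carrier (function_module S M)"
      then show "u \<oplus>\<^bsub>function_module S M\<^esub> w \<oplus>\<^bsub>function_module S M\<^esub> z
          = u \<oplus>\<^bsub>function_module S M\<^esub> (w \<oplus>\<^bsub>function_module S M\<^esub> z)"
        unfolding function_module_simps by (intro restrict_ext) (simp add: mem M.a_assoc)
    qed (simp_all add: function_module_simps mem)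
  next
    fix u assume u: "u \<in> carrier (function_module S M)"
    then show "\<one>\<^bsub>rat_field\<^esub> \<odot>\<^bsub>function_module S M\<^esub> u = u"
      unfolding function_module_simps by (intro extensionalityI[of _ S]) (simp_all add: mem PiE_iff)
  qed (simp_all add: function_module_simps mem cring_rat_field rat_smult_distr rat_smult_assoc cong: restrict_cong)
qed

text \<open>Transport of structure along a map that is injective on the carrier.\<close>

definition image_module :: "('v \<Rightarrow> 'w) \<Rightarrow> (rat, 'v) module \<Rightarrow> (rat, 'w) module" where
  "image_module e M =
     (let d = inv_into (carrier M) e in
     \<lparr>carrier = e ` carrier M, monoid.mult = undefined, one = undefined, zero = e \<zero>\<^bsub>M\<^esub>,
      add = (\<lambda>x y. e (d x \<oplus>\<^bsub>M\<^esub> d y)), smult = (\<lambda>r x. e (r \<odot>\<^bsub>M\<^esub> d x))\<rparr>)"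

lemma image_module_simps:
  "carrier (image_module e M) = e ` carrier M"
  "\<zero>\<^bsub>image_module e M\<^esub> = e \<zero>\<^bsub>M\<^esub>"
  "inj_on e (carrier M) \<Longrightarrow> x \<in> carrier M \<Longrightarrow> y \<in> carrier M \<Longrightarrow> e x \<oplus>\<^bsub>image_module e M\<^esub> e y = e (x \<oplus>\<^bsub>M\<^esub> y)"
  "inj_on e (carrier M) \<Longrightarrow> x \<in> carrier M \<Longrightarrow> r \<odot>\<^bsub>image_module e M\<^esub> e x = e (r \<odot>\<^bsub>M\<^esub> x)"
  by (simp_all add: image_module_def Let_def)

lemma module_image_module:
  assumes "module rat_field M" "inj_on e (carrier M)"
  shows "module rat_field (image_module e M)"
proof -
  interpret rat_module M using assms(1) by (rule rat_moduleI)
  note [simp] = image_module_simps(1,2) image_module_simps(3,4)[OF assms(2)]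
  show ?thesis
  proof (rule moduleI)
    show "abelian_group (image_module e M)"
    proof (rule abelian_groupI)
      fix x assume "x \<in> carrier (image_module e M)"
      then obtain y where y: "x = e y" "y \<in> carrier M" by auto
      show "\<exists>z\<in>carrier (image_module e M). z \<oplus>\<^bsub>image_module e M\<^esub> x = \<zero>\<^bsub>image_module e M\<^esub>"
        by (rule bexI[of _ "e (\<ominus>\<^bsub>M\<^esub> y)"]) (use y in \<open>auto simp: l_neg\<close>)
    qed (auto simp: M.a_ac)
  qed (auto simp: cring_rat_field rat_smult_distr rat_smult_assoc)
qed

lemma image_module_linear_maps:
  assumes "module rat_field M" "inj_on e (carrier M)"
  shows "e \<in> linear_maps M (image_module e M)"
    and "inv_into (carrier M) e \<in> linear_maps (image_module e M) M"
proof -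
  interpret rat_module M using assms(1) by (rule rat_moduleI)
  note [simp] = image_module_simps(1,2) image_module_simps(3,4)[OF assms(2)]
  show "e \<in> linear_maps M (image_module e M)" by (rule linear_mapsI) auto
  show "inv_into (carrier M) e \<in> linear_maps (image_module e M) M"
    by (rule linear_mapsI) (auto simp: inv_into_f_f[OF assms(2)])
qed

subsection \<open>Averages\<close>

text \<open>
  Averages are used instead of sums because they behave well for nested index sets: averaging a
  constant changes nothing, and an average over a subgroup is absorbed by an average over a larger
  one.
\<close>

definition average :: "(rat, 'v) module \<Rightarrow> 'b set \<Rightarrow> ('b \<Rightarrow> 'v) \<Rightarrow> 'v" where
  "average M S F = inverse (of_nat (card S)) \<odot>\<^bsub>M\<^esub> finsum M F S"

context rat_module
begin

lemma average_closed [simp]: "F \<in> S \<rightarrow> carrier M \<Longrightarrow> average M S F \<in> carrier M"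
  by (simp add: average_def)

lemma average_cong:
  assumes "\<And>x. x \<in> S \<Longrightarrow> F x \<in> carrier M" "\<And>x. x \<in> S \<Longrightarrow> F x = F' x"
  shows "average M S F = average M S F'"
proof -
  have "finsum M F S = finsum M F' S" using assms by (intro M.finsum_cong') auto
  then show ?thesis by (simp add: average_def)
qed

lemma average_const:
  assumes "finite S" "S \<noteq> {}" "x \<in> carrier M"
  shows "average M S (\<lambda>_. x) = x"
proof -
  have "finsum M (\<lambda>_. x) S = of_nat (card S) \<odot> x"
    using \<open>finite S\<close>
  proof induction
    case (insert s S)
    then show ?case using assms(3) by (simp add: rat_smult_distr)
  qed (use assms(3) in simp)
  then show ?thesis using assms by (simp add: average_def rat_smult_assoc)
qed

text \<open>
  The function that is concentrated at \<open>s\<close> and has average \<open>x\<close>.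
\<close>

lemma average_point:
  assumes "finite S" "s \<in> S" "x \<in> carrier M"
  shows "average M S (\<lambda>t. if t = s then of_nat (card S) \<odot> x else \<zero>) = x"
proof -
  have "finsum M (\<lambda>t. if s = t then of_nat (card S) \<odot> x else \<zero>) S = of_nat (card S) \<odot> x"
    using M.finsum_singleton[of s S "\<lambda>_. of_nat (card S) \<odot> x"] assms by simp
  moreover have "(\<lambda>t. if s = t then of_nat (card S) \<odot> x else \<zero>) = (\<lambda>t. if t = s then of_nat (card S) \<odot> x else \<zero>)"
    by auto
  moreover have "card S \<noteq> 0" using assms by auto
  ultimately show ?thesis using assms by (simp add: average_def rat_smult_assoc)
qed

lemma average_add:
  assumes "F \<in> S \<rightarrow> carrier M" "F' \<in> S \<rightarrow> carrier M"
  shows "average M S (\<lambda>x. F x \<oplus> F' x) = average M S F \<oplus> average M S F'"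
  using assms by (simp add: average_def M.finsum_addf rat_smult_distr)

lemma average_reindex:
  assumes "bij_betw \<pi> S S'" "F \<in> S' \<rightarrow> carrier M"
  shows "average M S (\<lambda>x. F (\<pi> x)) = average M S' F"
proof -
  have "finsum M F (\<pi> ` S) = finsum M (\<lambda>x. F (\<pi> x)) S"
    using assms by (intro M.finsum_reindex) (auto simp: bij_betw_def)
  then show ?thesis using assms(1) bij_betw_same_card[OF assms(1)] by (simp add: average_def bij_betw_def)
qed

end

lemma linear_maps_finsum:
  assumes "module rat_field M" "module rat_field N" and f: "f \<in> linear_maps M N"
    and "finite S" and "F \<in> S \<rightarrow> carrier M"
  shows "f (finsum M F S) = finsum N (\<lambda>x. f (F x)) S"
proof -
  interpret M: rat_module M using assms(1) by (rule rat_moduleI)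
  interpret N: rat_module N using assms(2) by (rule rat_moduleI)
  show ?thesis using assms(4,5)
  proof induction
    case empty
    then show ?case using linear_maps_zero[OF assms(1-3)] by simp
  next
    case (insert s S)
    then have "f (F x) \<in> carrier N" if "x \<in> insert s S" for x using that linear_maps_closed[OF f] by blast
    then show ?case using insert linear_maps_add[OF f] by (simp add: Pi_iff)
  qed
qed

lemma linear_maps_average:
  assumes "module rat_field M" "module rat_field N" and f: "f \<in> linear_maps M N"
    and "finite S" and "F \<in> S \<rightarrow> carrier M"
  shows "f (average M S F) = average N S (\<lambda>x. f (F x))"
proof -
  interpret M: rat_module M using assms(1) by (rule rat_moduleI)
  show ?thesis using linear_maps_finsum[OF assms] linear_maps_smult[OF f] assms(5) by (simp add: average_def)
qed

context rat_module
begin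

lemma smult_linear_map: "(\<lambda>x. r \<odot> x) \<in> linear_maps M M"
  by (rule linear_mapsI) (simp_all add: rat_smult_distr rat_smult_assoc mult.commute)

lemma average_smult:
  assumes "finite S" "F \<in> S \<rightarrow> carrier M"
  shows "average M S (\<lambda>x. r \<odot> F x) = r \<odot> average M S F"
  using linear_maps_average[OF module_axioms module_axioms smult_linear_map assms] by simp

lemma average_swap:
  assumes "finite S" "finite S'" and F: "\<And>s t. s \<in> S \<Longrightarrow> t \<in> S' \<Longrightarrow> F s t \<in> carrier M"
  shows "average M S (\<lambda>s. average M S' (\<lambda>t. F s t)) = average M S' (\<lambda>t. average M S (\<lambda>s. F s t))"
proof -
  have sum_swap: "finsum M (\<lambda>s. finsum M (\<lambda>t. F s t) S') S = finsum M (\<lambda>t. finsum M (\<lambda>s. F s t) S) S'"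
    using \<open>finite S\<close> F
  proof induction
    case (insert s S)
    then have "finsum M (\<lambda>s. finsum M (\<lambda>t. F s t) S') (insert s S)
        = finsum M (\<lambda>t. F s t) S' \<oplus> finsum M (\<lambda>t. finsum M (\<lambda>s. F s t) S) S'"
      by (subst M.finsum_insert) auto
    also have "\<dots> = finsum M (\<lambda>t. F s t \<oplus> finsum M (\<lambda>s. F s t) S) S'"
      using insert.prems by (subst M.finsum_addf) auto
    also have "\<dots> = finsum M (\<lambda>t. finsum M (\<lambda>s. F s t) (insert s S)) S'"
      using insert by (intro M.finsum_cong') auto
    finally show ?case .
  qed simp
  have in1: "finsum M (\<lambda>t. F s t) S' \<in> carrier M" if "s \<in> S" for s using that F by (intro M.finsum_closed) auto
  have in2: "finsum M (\<lambda>s. F s t) S \<in> carrier M" if "t \<in> S'" for t using that F by (intro M.finsum_closed) auto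
  have out: "finsum M (\<lambda>s. r \<odot> c s) A = r \<odot> finsum M c A" if "finite A" "\<And>s. s \<in> A \<Longrightarrow> c s \<in> carrier M" for r c A
    using linear_maps_finsum[OF module_axioms module_axioms smult_linear_map[of r] that(1), of c] that(2) by auto
  show ?thesis
    unfolding average_def
    using in1 in2 by (simp add: out assms rat_smult_assoc sum_swap mult.commute)
qed

end

section \<open>Extension problems in other universes\<close>

lemma system_map_compose:
  assumes "system_map \<Gamma> V T W S f" "system_map \<Gamma> W S Z R g"
  shows "system_map \<Gamma> V T Z R (\<lambda>H n x. g H n (f H n x))"
proof (rule system_mapI)
  fix H n assume "subgroup H \<Gamma>"
  then show "(\<lambda>x. g H n (f H n x)) \<in> linear_maps (V H n) (Z H n)"
    using linear_maps_compose system_mapD(1) assms by metis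
next
  fix H K a n x
  assume *: "subgroup H \<Gamma>" "subgroup K \<Gamma>" "H \<subseteq> K" "a \<in> carrier \<Gamma>" and x: "x \<in> carrier (V H n)"
  then show "g K n (f K n (T H K a n x)) = R H K a n (g H n (f H n x))"
    using system_mapD(2)[OF assms(1) * x] system_mapD(2)[OF assms(2) *]
      linear_maps_closed[OF system_mapD(1)[OF assms(1) *(1)] x] by simp
qed

text \<open>
  Each space is carried to its copy by its own injection \<open>e H n\<close>; the copies are isomorphic to the
  original diagram by \<open>e\<close> and its inverse.
\<close>

lemma image_system:
  assumes A: "orbit_system \<Gamma> A T" and e: "\<And>H n. subgroup H \<Gamma> \<Longrightarrow> inj_on (e H n) (carrier (A H n))"
  defines "d \<equiv> \<lambda>H n. inv_into (carrier (A H n)) (e H n)"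
  defines "A' \<equiv> \<lambda>H n. image_module (e H n) (A H n)"
  defines "T' \<equiv> \<lambda>H K a n x. e K n (T H K a n (d H n x))"
  shows "orbit_system \<Gamma> A' T'" and "system_map \<Gamma> A T A' T' e" and "system_map \<Gamma> A' T' A T d"
proof -
  have d: "d H n (e H n x) = x" if "subgroup H \<Gamma>" "x \<in> carrier (A H n)" for H n x
    unfolding d_def using that e by simp
  have e_lin: "e H n \<in> linear_maps (A H n) (A' H n)" and d_lin: "d H n \<in> linear_maps (A' H n) (A H n)"
    if "subgroup H \<Gamma>" for H n
    using image_module_linear_maps orbit_systemD(1)[OF A that] e[OF that] unfolding A'_def d_def by blast+
  have carrier: "carrier (A' H n) = e H n ` carrier (A H n)" for H n
    by (simp add: A'_def image_module_simps)
  note lin = orbit_systemD(2)[OF A]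
  show "orbit_system \<Gamma> A' T'"
  proof (rule orbit_systemI)
    fix H n assume "subgroup H \<Gamma>"
    then show "module rat_field (A' H n)"
      unfolding A'_def using module_image_module orbit_systemD(1)[OF A] e by blast
  next
    fix H K a n
    assume "subgroup H \<Gamma>" "subgroup K \<Gamma>" "H \<subseteq> K" "a \<in> carrier \<Gamma>"
    then show "T' H K a n \<in> linear_maps (A' H n) (A' K n)"
      unfolding T'_def by (intro linear_maps_compose[OF linear_maps_compose[OF d_lin lin] e_lin])
  next
    fix H h n x assume "subgroup H \<Gamma>" "h \<in> H" "x \<in> carrier (A' H n)"
    then show "T' H H h n x = x" using orbit_systemD(3)[OF A] by (auto simp: T'_def carrier d)
  next
    fix H K L a b n x
    assume *: "subgroup H \<Gamma>" "subgroup K \<Gamma>" "subgroup L \<Gamma>" "H \<subseteq> K" "K \<subseteq> L" "a \<in> carrier \<Gamma>" "b \<in> carrier \<Gamma>"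
      and x: "x \<in> carrier (A' H n)"
    obtain y where y: "y \<in> carrier (A H n)" "x = e H n y" using x carrier by auto
    then show "T' H L (a \<otimes>\<^bsub>\<Gamma>\<^esub> b) n x = T' K L b n (T' H K a n x)"
      using * orbit_systemD(4)[OF A * y(1)] linear_maps_closed[OF lin[OF *(1,2,4,6)] y(1)]
      by (simp add: T'_def d)
  qed
  show "system_map \<Gamma> A T A' T' e"
    by (rule system_mapI) (simp_all add: e_lin T'_def d)
  show "system_map \<Gamma> A' T' A T d"
  proof (rule system_mapI)
    fix H K a n x
    assume *: "subgroup H \<Gamma>" "subgroup K \<Gamma>" "H \<subseteq> K" "a \<in> carrier \<Gamma>" and x: "x \<in> carrier (A' H n)"
    obtain y where y: "y \<in> carrier (A H n)" "x = e H n y" using x carrier by auto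
    then show "d K n (T' H K a n x) = T H K a n (d H n x)"
      using * linear_maps_closed[OF lin[OF *] y(1)] by (simp add: T'_def d)
  qed (rule d_lin)
qed

text \<open>
  Extensions exist in every universe whose test objects can be copied, value by value, into \<open>'u\<close>.
\<close>

lemma injective_system_extension:
  fixes U :: "'u itself" and A B :: "'g set \<Rightarrow> nat \<Rightarrow> (rat, 'w) module"
  assumes inj: "injective_system U \<Gamma> V T" and A: "orbit_system \<Gamma> A TA" and B: "orbit_system \<Gamma> B TB"
    and f: "system_map \<Gamma> A TA B TB f" and f_inj: "\<And>H n. subgroup H \<Gamma> \<Longrightarrow> inj_on (f H n) (carrier (A H n))"
    and g: "system_map \<Gamma> A TA V T g"
    and A_small: "\<And>H n. subgroup H \<Gamma> \<Longrightarrow> \<exists>e :: 'w \<Rightarrow> 'u. inj_on e (carrier (A H n))"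
    and B_small: "\<And>H n. subgroup H \<Gamma> \<Longrightarrow> \<exists>e :: 'w \<Rightarrow> 'u. inj_on e (carrier (B H n))"
  obtains h where "system_map \<Gamma> B TB V T h"
    and "\<And>H n x. subgroup H \<Gamma> \<Longrightarrow> x \<in> carrier (A H n) \<Longrightarrow> h H n (f H n x) = g H n x"
proof -
  define i :: "'g set \<Rightarrow> nat \<Rightarrow> 'w \<Rightarrow> 'u" where "i H n = (SOME e. inj_on e (carrier (A H n)))" for H n
  define j :: "'g set \<Rightarrow> nat \<Rightarrow> 'w \<Rightarrow> 'u" where "j H n = (SOME e. inj_on e (carrier (B H n)))" for H n
  define i' where "i' H n = inv_into (carrier (A H n)) (i H n)" for H n
  have i: "inj_on (i H n) (carrier (A H n))" if "subgroup H \<Gamma>" for H n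
    unfolding i_def using A_small[OF that] by (rule someI_ex)
  have j: "inj_on (j H n) (carrier (B H n))" if "subgroup H \<Gamma>" for H n
    unfolding j_def using B_small[OF that] by (rule someI_ex)
  note imA = image_system[OF A i, folded i'_def] and imB = image_system[OF B j]
  let ?f = "\<lambda>H n x. j H n (f H n (i' H n x))" and ?g = "\<lambda>H n x. g H n (i' H n x)"
  have f': "system_map \<Gamma> (\<lambda>H n. image_module (i H n) (A H n)) (\<lambda>H K a n x. i K n (TA H K a n (i' H n x)))
      (\<lambda>H n. image_module (j H n) (B H n))
      (\<lambda>H K a n x. j K n (TB H K a n (inv_into (carrier (B H n)) (j H n) x))) ?f"
    by (rule system_map_compose[OF system_map_compose[OF imA(3) f] imB(2)])
  have g': "system_map \<Gamma> (\<lambda>H n. image_module (i H n) (A H n)) (\<lambda>H K a n x. i K n (TA H K a n (i' H n x))) V T ?g"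
    by (rule system_map_compose[OF imA(3) g])
  have i'i: "i' H n (i H n x) = x" if "subgroup H \<Gamma>" "x \<in> carrier (A H n)" for H n x
    unfolding i'_def using that i by simp
  have f'_inj: "inj_on (?f H n) (carrier (image_module (i H n) (A H n)))" if H: "subgroup H \<Gamma>" for H n
  proof (rule inj_onI)
    fix x y assume "x \<in> carrier (image_module (i H n) (A H n))" "y \<in> carrier (image_module (i H n) (A H n))"
      and eq: "?f H n x = ?f H n y"
    then obtain x' y' where xy: "x = i H n x'" "y = i H n y'" "x' \<in> carrier (A H n)" "y' \<in> carrier (A H n)"
      by (auto simp: image_module_simps)
    then have "f H n x' = f H n y'"
      using eq inj_onD[OF j[OF H]] linear_maps_closed[OF system_mapD(1)[OF f H]] by (simp add: i'i H)
    then show "x = y" using f_inj[OF H] xy by (auto dest: inj_onD)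
  qed
  obtain h where h: "system_map \<Gamma> (\<lambda>H n. image_module (j H n) (B H n))
      (\<lambda>H K a n x. j K n (TB H K a n (inv_into (carrier (B H n)) (j H n) x))) V T h"
    and hf: "\<And>H n x. subgroup H \<Gamma> \<Longrightarrow> x \<in> carrier (image_module (i H n) (A H n)) \<Longrightarrow> h H n (?f H n x) = ?g H n x"
    using inj[unfolded injective_system_def, THEN conjunct2, rule_format, OF conjI[OF imA(1) conjI[OF imB(1) conjI[OF f']]]]
      f'_inj g' by blast
  show thesis
  proof (rule that)
    show "system_map \<Gamma> B TB V T (\<lambda>H n x. h H n (j H n x))"
      by (rule system_map_compose[OF imB(2) h])
    show "h H n (j H n (f H n x)) = g H n x" if "subgroup H \<Gamma>" "x \<in> carrier (A H n)" for H n x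
      using hf[of H "i H n x" n] that by (simp add: image_module_simps i'i)
  qed
qed

section \<open>Groups that split as a product of coprime factors\<close>

locale coprime_product = comm_group G for G (structure) +
  fixes P Q
  assumes P: "subgroup P G" and Q: "subgroup Q G"
    and finite_P: "finite P" and finite_Q: "finite Q"
    and coprime: "coprime (card P) (card Q)"
    and product: "carrier G = P <#> Q"
begin

abbreviation P_group (\<open>G\<^sub>P\<close>) where "G\<^sub>P \<equiv> G\<lparr>carrier := P\<rparr>"

text \<open>
  An exponent that is \<open>1\<close> modulo \<open>card P\<close> and \<open>0\<close> modulo \<open>card Q\<close>: raising to this power is the
  projection onto \<open>P\<close>. Describing the projection as a power map makes it preserve all subgroups.
\<close>

definition proj_exp :: nat where
  "proj_exp = (SOME e. \<exists>k l. e = card Q * k \<and> e = card P * l + 1)"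

definition proj1 where "proj1 x = x [^] proj_exp"

definition proj2 where "proj2 x = x \<otimes> inv (proj1 x)"

lemma pow_card:
  assumes "subgroup H G" "finite H" "x \<in> H"
  shows "x [^] card H = \<one>"
proof -
  interpret H: group "G\<lparr>carrier := H\<rparr>" using assms(1) by (rule subgroup.subgroup_is_group) (rule is_group)
  show ?thesis using H.pow_order_eq_1[of x] assms by (simp add: order_def nat_pow_consistent[symmetric])
qed

lemma proj1_P [simp]: "x \<in> P \<Longrightarrow> proj1 x = x"
  and proj1_Q: "x \<in> Q \<Longrightarrow> proj1 x = \<one>"
proof -
  have "card Q \<noteq> 0" using finite_Q subgroup.one_closed[OF Q] by auto
  then obtain k l where "card Q * k = card P * l + 1"
    using bezout_nat[of "card Q" "card P"] coprime by (auto simp: coprime_iff_gcd_eq_1 gcd.commute)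
  then have "\<exists>e k l. e = card Q * k \<and> e = card P * l + 1" by blast
  from someI_ex[OF this] obtain k l where e: "proj_exp = card Q * k" "proj_exp = card P * l + 1"
    unfolding proj_exp_def by blast
  show "proj1 x = x" if "x \<in> P"
  proof -
    have x: "x \<in> carrier G" using that P subgroup.mem_carrier by metis
    have "proj1 x = (x [^] card P) [^] l \<otimes> x" unfolding proj1_def e(2) using x by (simp add: nat_pow_mult[symmetric] nat_pow_pow)
    then show ?thesis using pow_card[OF P finite_P that] x by simp
  qed
  show "proj1 x = \<one>" if "x \<in> Q"
  proof -
    have x: "x \<in> carrier G" using that Q subgroup.mem_carrier by metis
    have "proj1 x = (x [^] card Q) [^] k" unfolding proj1_def e(1) using x by (simp add: nat_pow_pow)
    then show ?thesis using pow_card[OF Q finite_Q that] by simp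
  qed
qed

lemma mem_carrier [simp]: "x \<in> P \<Longrightarrow> x \<in> carrier G" "x \<in> Q \<Longrightarrow> x \<in> carrier G"
  using P Q subgroup.mem_carrier by metis+

lemma proj_closed [simp]: "x \<in> carrier G \<Longrightarrow> proj1 x \<in> carrier G" "x \<in> carrier G \<Longrightarrow> proj2 x \<in> carrier G"
  by (simp_all add: proj1_def proj2_def)

lemma proj1_mult: "x \<in> carrier G \<Longrightarrow> y \<in> carrier G \<Longrightarrow> proj1 (x \<otimes> y) = proj1 x \<otimes> proj1 y"
  by (simp add: proj1_def nat_pow_distrib)

lemma proj2_mult: "x \<in> carrier G \<Longrightarrow> y \<in> carrier G \<Longrightarrow> proj2 (x \<otimes> y) = proj2 x \<otimes> proj2 y"
  by (simp add: proj2_def proj1_mult inv_mult m_ac)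

lemma proj2_P: "x \<in> P \<Longrightarrow> proj2 x = \<one>"
  by (simp add: proj2_def)

lemma proj2_Q [simp]: "x \<in> Q \<Longrightarrow> proj2 x = x"
  by (simp add: proj2_def proj1_Q)

lemma proj_mult: "x \<in> carrier G \<Longrightarrow> proj1 x \<otimes> proj2 x = x"
proof -
  assume x: "x \<in> carrier G"
  have "proj1 x \<otimes> proj2 x = x \<otimes> (proj1 x \<otimes> inv (proj1 x))" unfolding proj2_def using x m_lcomm by simp
  then show ?thesis using x by simp
qed

lemma proj_in_factors: "x \<in> carrier G \<Longrightarrow> proj1 x \<in> P" "x \<in> carrier G \<Longrightarrow> proj2 x \<in> Q"
proof -
  have *: "proj1 x \<in> P \<and> proj2 x \<in> Q" if "x \<in> carrier G" for x
  proof -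
    have "x \<in> P <#> Q" using that product by simp
    then obtain a b where "a \<in> P" "b \<in> Q" "x = a \<otimes> b" unfolding set_mult_def by blast
    then show ?thesis by (simp add: proj1_mult proj2_mult proj1_Q proj2_P)
  qed
  then show "x \<in> carrier G \<Longrightarrow> proj1 x \<in> P" "x \<in> carrier G \<Longrightarrow> proj2 x \<in> Q" by blast+
qed

text \<open>Being a power of \<open>x\<close>, the first component of \<open>x\<close> lies in every subgroup containing \<open>x\<close>.\<close>

lemma proj_in_subgroup:
  assumes "subgroup L G" "x \<in> L"
  shows "proj1 x \<in> P \<inter> L" "proj2 x \<in> L \<inter> Q"
proof -
  have x: "x \<in> carrier G" using assms subgroup.mem_carrier by metis
  have "x [^] (k::nat) \<in> L" for k
    by (induction k) (use assms subgroup.one_closed subgroup.m_closed in \<open>auto simp: nat_pow_Suc\<close>)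
  then have 1: "proj1 x \<in> L" by (simp add: proj1_def)
  then have "proj2 x \<in> L" unfolding proj2_def using assms by (simp add: subgroup.m_closed subgroup.m_inv_closed)
  then show "proj1 x \<in> P \<inter> L" "proj2 x \<in> L \<inter> Q" using 1 proj_in_factors x by auto
qed

lemma factors_inter: "x \<in> P \<Longrightarrow> x \<in> Q \<Longrightarrow> x = \<one>"
  using proj1_P proj1_Q by metis

lemma comm_group_P: "comm_group G\<^sub>P"
proof -
  interpret P: group "G\<^sub>P" using P by (rule subgroup.subgroup_is_group) (rule is_group)
  show ?thesis by (rule P.group_comm_groupI) (simp add: m_comm)
qed

lemma subgroup_of_P_iff: "subgroup H (G\<lparr>carrier := P\<rparr>) \<longleftrightarrow> subgroup H G \<and> H \<subseteq> P"
  using subgroup_incl[OF _ P] incl_subgroup[OF P] subgroup.subset[of H "G\<lparr>carrier := P\<rparr>"] by auto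

lemma subgroup_inter_P: "subgroup L G \<Longrightarrow> subgroup (P \<inter> L) (G\<lparr>carrier := P\<rparr>)"
  using subgroups_Inter_pair[OF P] by (simp add: subgroup_of_P_iff)

lemma subgroup_mult_Q: "subgroup H (G\<lparr>carrier := P\<rparr>) \<Longrightarrow> subgroup (Q <#> H) G"
  using mult_subgroups[OF Q] by (simp add: subgroup_of_P_iff)

lemma Q_subset_mult: "subgroup H (G\<lparr>carrier := P\<rparr>) \<Longrightarrow> Q \<subseteq> Q <#> H"
  and subset_mult_Q: "subgroup H (G\<lparr>carrier := P\<rparr>) \<Longrightarrow> H \<subseteq> Q <#> H"
proof -
  assume H: "subgroup H (G\<lparr>carrier := P\<rparr>)"
  then have H': "subgroup H G" "H \<subseteq> P" by (simp_all add: subgroup_of_P_iff)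
  show "Q \<subseteq> Q <#> H"
  proof
    fix x assume "x \<in> Q"
    then have "x \<otimes> \<one> \<in> Q <#> H" using subgroup.one_closed[OF H'(1)] unfolding set_mult_def by blast
    then show "x \<in> Q <#> H" using \<open>x \<in> Q\<close> by simp
  qed
  show "H \<subseteq> Q <#> H"
  proof
    fix x assume "x \<in> H"
    then have "\<one> \<otimes> x \<in> Q <#> H" using subgroup.one_closed[OF Q] unfolding set_mult_def by blast
    moreover have "x \<in> P" using \<open>x \<in> H\<close> H'(2) by blast
    ultimately show "x \<in> Q <#> H" by simp
  qed
qed

lemma inter_mult_Q:
  assumes "subgroup H (G\<lparr>carrier := P\<rparr>)"
  shows "P \<inter> (Q <#> H) = H"
proof
  have H: "subgroup H G" "H \<subseteq> P" using assms by (simp_all add: subgroup_of_P_iff)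
  show "H \<subseteq> P \<inter> (Q <#> H)" using subset_mult_Q[OF assms] H by blast
  show "P \<inter> (Q <#> H) \<subseteq> H"
  proof
    fix x assume "x \<in> P \<inter> (Q <#> H)"
    then obtain u h where uh: "x \<in> P" "u \<in> Q" "h \<in> H" "x = u \<otimes> h" unfolding set_mult_def by auto
    have h: "h \<in> P" using uh H by blast
    have "x = proj1 x" using uh by simp
    also have "\<dots> = h" unfolding uh(4) using uh(2) h by (simp add: proj1_mult proj1_Q)
    finally show "x \<in> H" using uh by simp
  qed
qed

lemma mult_Q_inter:
  assumes "subgroup L G" "Q \<subseteq> L"
  shows "Q <#> (P \<inter> L) = L"
proof
  show "Q <#> (P \<inter> L) \<subseteq> L" using assms subgroup.m_closed[OF assms(1)] unfolding set_mult_def by blast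
  show "L \<subseteq> Q <#> (P \<inter> L)"
  proof
    fix x assume x: "x \<in> L"
    then have xc: "x \<in> carrier G" using assms subgroup.mem_carrier by metis
    have "x = proj2 x \<otimes> proj1 x" using proj_mult[OF xc] xc m_comm by simp
    then show "x \<in> Q <#> (P \<inter> L)" using proj_in_subgroup[OF assms(1) x] unfolding set_mult_def by blast
  qed
qed

end

text \<open>
  The factors meet trivially by Lagrange's theorem, so multiplication is injective on \<open>P \<times> Q\<close>, and
  it is onto by counting.
\<close>

lemma (in comm_group) coprime_productI:
  assumes P: "subgroup P G" and Q: "subgroup Q G" and fin: "finite P" "finite Q" and cop: "coprime (card P) (card Q)"
    and order: "order G = card P * card Q"
  shows "coprime_product G P Q"
proof (intro coprime_product.intro[OF comm_group_axioms] coprime_product_axioms.intro P Q fin cop)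
  have pos: "card P > 0" "card Q > 0" using fin subgroup.one_closed[OF P] subgroup.one_closed[OF Q] by (auto simp: card_gt_0_iff)
  have dvd: "card (P \<inter> Q) dvd card H" if H: "subgroup H G" "P \<inter> Q \<subseteq> H" for H
  proof -
    interpret H: group "G\<lparr>carrier := H\<rparr>" using H(1) by (rule subgroup.subgroup_is_group) (rule is_group)
    have "subgroup (P \<inter> Q) (G\<lparr>carrier := H\<rparr>)" using subgroup_incl[OF subgroups_Inter_pair[OF P Q] H] .
    from H.lagrange[OF this, symmetric] have "card H = card (rcosets\<^bsub>G\<lparr>carrier := H\<rparr>\<^esub> (P \<inter> Q)) * card (P \<inter> Q)"
      by (simp add: order_def)
    then show ?thesis by (rule dvdI[OF trans[OF _ mult.commute]])
  qed
  have "card (P \<inter> Q) dvd card P" "card (P \<inter> Q) dvd card Q" using dvd[OF P] dvd[OF Q] by auto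
  then have "card (P \<inter> Q) = 1" using cop coprime_common_divisor_nat by blast
  then obtain z where "P \<inter> Q = {z}" by (auto simp: card_1_singleton_iff)
  then have inter: "P \<inter> Q = {\<one>}" using subgroup.one_closed[OF P] subgroup.one_closed[OF Q] by auto
  have Pc: "x \<in> carrier G" if "x \<in> P" for x using that P subgroup.mem_carrier by metis
  have Qc: "x \<in> carrier G" if "x \<in> Q" for x using that Q subgroup.mem_carrier by metis
  have "inj_on (\<lambda>(x, y). x \<otimes> y) (P \<times> Q)"
  proof (rule inj_onI, clarify)
    fix x y x' y' assume *: "x \<in> P" "y \<in> Q" "x' \<in> P" "y' \<in> Q" and eq: "x \<otimes> y = x' \<otimes> y'"
    have "inv x' \<otimes> x = y' \<otimes> inv y"
    proof -
      have "inv x' \<otimes> x = inv x' \<otimes> (x \<otimes> y) \<otimes> inv y" using * Pc Qc by (simp add: m_assoc)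
      also have "\<dots> = y' \<otimes> inv y" unfolding eq using * Pc Qc by (simp add: m_assoc[symmetric])
      finally show ?thesis .
    qed
    moreover have "inv x' \<otimes> x \<in> P" "y' \<otimes> inv y \<in> Q"
      using * P Q by (simp_all add: subgroup.m_closed subgroup.m_inv_closed)
    ultimately have "inv x' \<otimes> x = \<one>" "y' \<otimes> inv y = \<one>" using inter by auto
    then have "inv x = inv x'" "y = y'"
      using * Pc Qc inv_equality[of "inv x'" x] inv_equality[of y' "inv y"] by simp_all
    then show "x = x' \<and> y = y'" using * Pc inv_inv by metis
  qed
  then have "card ((\<lambda>(x, y). x \<otimes> y) ` (P \<times> Q)) = order G" by (simp add: card_image card_cartesian_product order)
  moreover have "(\<lambda>(x, y). x \<otimes> y) ` (P \<times> Q) = P <#> Q" unfolding set_mult_def by auto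
  ultimately have "card (P <#> Q) = card (carrier G)" by (simp add: order_def)
  moreover have "finite (carrier G)" using order pos by (simp add: order_def card_ge_0_finite)
  moreover have "P <#> Q \<subseteq> carrier G" using set_mult_closed P Q subgroup.subset by metis
  ultimately show "carrier G = P <#> Q" using card_subset_eq by metis
qed

section \<open>Restriction to the orbits G/QH\<close>

context coprime_product
begin

text \<open>
  The zero space at \<open>L\<close> is taken as a subspace of \<open>A (P \<inter> L)\<close>, so that both cases share their
  operations and the structure maps are restrictions of those of \<open>A\<close>.
\<close>

definition zero_extension ::
    "('a set \<Rightarrow> nat \<Rightarrow> (rat, 'v) module) \<Rightarrow> 'a set \<Rightarrow> nat \<Rightarrow> (rat, 'v) module" where
  "zero_extension A L n =
     (A (P \<inter> L) n)\<lparr>carrier := (if Q \<subseteq> L then carrier (A (P \<inter> L) n) else {\<zero>\<^bsub>A (P \<inter> L) n\<^esub>})\<rparr>"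

definition zero_extension_map ::
    "('a set \<Rightarrow> 'a set \<Rightarrow> 'a \<Rightarrow> nat \<Rightarrow> 'v \<Rightarrow> 'v) \<Rightarrow> 'a set \<Rightarrow> 'a set \<Rightarrow> 'a \<Rightarrow> nat \<Rightarrow> 'v \<Rightarrow> 'v" where
  "zero_extension_map T L L' a = T (P \<inter> L) (P \<inter> L') (proj1 a)"

lemma zero_extension_carrier:
  assumes "orbit_system G\<^sub>P A T" "subgroup L G"
  shows "carrier (zero_extension A L n) \<subseteq> carrier (A (P \<inter> L) n)"
    and "\<not> Q \<subseteq> L \<Longrightarrow> x \<in> carrier (zero_extension A L n) \<Longrightarrow> x = \<zero>\<^bsub>A (P \<inter> L) n\<^esub>"
    and "\<zero>\<^bsub>A (P \<inter> L) n\<^esub> \<in> carrier (zero_extension A L n)"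
proof -
  interpret N: rat_module "A (P \<inter> L) n"
    using orbit_systemD(1)[OF assms(1)] subgroup_inter_P[OF assms(2)] by (blast intro: rat_moduleI)
  show "carrier (zero_extension A L n) \<subseteq> carrier (A (P \<inter> L) n)"
    and "\<not> Q \<subseteq> L \<Longrightarrow> x \<in> carrier (zero_extension A L n) \<Longrightarrow> x = \<zero>\<^bsub>A (P \<inter> L) n\<^esub>"
    and "\<zero>\<^bsub>A (P \<inter> L) n\<^esub> \<in> carrier (zero_extension A L n)"
    by (auto simp: zero_extension_def)
qed

lemma zero_extension_ops [simp]:
  "x \<oplus>\<^bsub>zero_extension A L n\<^esub> y = x \<oplus>\<^bsub>A (P \<inter> L) n\<^esub> y"
  "r \<odot>\<^bsub>zero_extension A L n\<^esub> x = r \<odot>\<^bsub>A (P \<inter> L) n\<^esub> x"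
  by (simp_all add: zero_extension_def)

text \<open>
  The condition \<open>L \<subseteq> L'\<close> excludes the only bad case, a nonzero space at \<open>L\<close> and the zero space at \<open>L'\<close>.
\<close>

lemma zero_extension_linear:
  assumes A: "orbit_system G\<^sub>P A T" and B: "orbit_system G\<^sub>P B S" and L: "subgroup L G" "subgroup L' G" "L \<subseteq> L'"
    and f: "f \<in> linear_maps (A (P \<inter> L) n) (B (P \<inter> L') n)"
  shows "f \<in> linear_maps (zero_extension A L n) (zero_extension B L' n)"
proof (rule linear_mapsI)
  fix x assume x: "x \<in> carrier (zero_extension A L n)"
  have mod: "module rat_field (A (P \<inter> L) n)" "module rat_field (B (P \<inter> L') n)"
    using orbit_systemD(1)[OF A subgroup_inter_P[OF L(1)]] orbit_systemD(1)[OF B subgroup_inter_P[OF L(2)]] .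
  show "f x \<in> carrier (zero_extension B L' n)"
  proof (cases "Q \<subseteq> L")
    case True
    then show ?thesis using x L(3) linear_maps_closed[OF f] by (auto simp: zero_extension_def)
  next
    case False
    then have "f x = \<zero>\<^bsub>B (P \<inter> L') n\<^esub>"
      using zero_extension_carrier(2)[OF A L(1) _ x] linear_maps_zero[OF mod f] by simp
    then show ?thesis using zero_extension_carrier(3)[OF B L(2)] by simp
  qed
qed (simp_all add: linear_maps_add[OF f] linear_maps_smult[OF f] subsetD[OF zero_extension_carrier(1)[OF A L(1)]])

lemma orbit_system_zero_extension:
  assumes A: "orbit_system G\<^sub>P A T"
  shows "orbit_system G (zero_extension A) (zero_extension_map T)"
proof (rule orbit_systemI)
  fix L n assume L: "subgroup L G"
  have mod: "module rat_field (A (P \<inter> L) n)" using orbit_systemD(1)[OF A subgroup_inter_P[OF L]] .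
  interpret N: rat_module "A (P \<inter> L) n" using mod by (rule rat_moduleI)
  show "module rat_field (zero_extension A L n)"
    unfolding zero_extension_def by (rule rat_submodule[OF mod]) (auto split: if_splits)
next
  fix L L' a n assume L: "subgroup L G" "subgroup L' G" "L \<subseteq> L'" and a: "a \<in> carrier G"
  show "zero_extension_map T L L' a n \<in> linear_maps (zero_extension A L n) (zero_extension A L' n)"
    unfolding zero_extension_map_def
    by (rule zero_extension_linear[OF A A L])
      (rule orbit_systemD(2)[OF A], use L a proj_in_factors subgroup_inter_P in auto)
next
  fix L h n x assume L: "subgroup L G" and h: "h \<in> L" and x: "x \<in> carrier (zero_extension A L n)"
  then show "zero_extension_map T L L h n x = x"
    using orbit_systemD(3)[OF A subgroup_inter_P[OF L]] proj_in_subgroup[OF L h] zero_extension_carrier(1)[OF A L]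
    unfolding zero_extension_map_def by blast
next
  fix L L' L'' a b n x
  assume L: "subgroup L G" "subgroup L' G" "subgroup L'' G" "L \<subseteq> L'" "L' \<subseteq> L''" and a: "a \<in> carrier G" "b \<in> carrier G"
    and x: "x \<in> carrier (zero_extension A L n)"
  then have "T (P \<inter> L) (P \<inter> L'') (proj1 a \<otimes>\<^bsub>G\<^sub>P\<^esub> proj1 b) n x
      = T (P \<inter> L') (P \<inter> L'') (proj1 b) n (T (P \<inter> L) (P \<inter> L') (proj1 a) n x)"
    by (intro orbit_systemD(4)[OF A] subgroup_inter_P)
      (use zero_extension_carrier(1)[OF A L(1)] proj_in_factors in auto)
  then show "zero_extension_map T L L'' (a \<otimes> b) n x = zero_extension_map T L' L'' b n (zero_extension_map T L L' a n x)"
    using a by (simp add: zero_extension_map_def proj1_mult)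
qed

text \<open>
  A map \<open>g\<close> from \<open>A\<close> to the restricted system gives a map from the zero extension of \<open>A\<close>, since
  \<open>L = Q(P \<inter> L)\<close> when \<open>Q \<subseteq> L\<close>. Conversely the zero extension has the value \<open>A H\<close> at \<open>QH\<close>, so an
  extension over \<open>G\<close> is evaluated at the subgroups \<open>QH\<close>.
\<close>

theorem injective_system_fixed_by_Q:
  fixes U :: "'u itself"
  assumes inj: "injective_system U G V T"
  shows "injective_system U G\<^sub>P (\<lambda>H. V (Q <#> H)) (\<lambda>H K. T (Q <#> H) (Q <#> K))"
proof -
  have V: "orbit_system G V T" using inj by (simp add: injective_system_def)
  have S_mono: "Q <#> H \<subseteq> Q <#> K" if "H \<subseteq> K" for H K using that by (auto simp: set_mult_def)
  have carr: "a \<in> carrier G" if "a \<in> carrier G\<^sub>P" for a using that by simp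
  have W: "orbit_system G\<^sub>P (\<lambda>H. V (Q <#> H)) (\<lambda>H K. T (Q <#> H) (Q <#> K))"
  proof (rule orbit_systemI)
    fix H K L a b n x
    assume "subgroup H G\<^sub>P" "subgroup K G\<^sub>P" "subgroup L G\<^sub>P" "H \<subseteq> K" "K \<subseteq> L" "a \<in> carrier G\<^sub>P" "b \<in> carrier G\<^sub>P"
      "x \<in> carrier (V (Q <#> H) n)"
    then show "T (Q <#> H) (Q <#> L) (a \<otimes>\<^bsub>G\<^sub>P\<^esub> b) n x
        = T (Q <#> K) (Q <#> L) b n (T (Q <#> H) (Q <#> K) a n x)"
      using orbit_systemD(4)[OF V subgroup_mult_Q subgroup_mult_Q subgroup_mult_Q S_mono S_mono carr carr, of H K L a b x n]
      by simp
  next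
    fix H h n x assume H: "subgroup H G\<^sub>P" and h: "h \<in> H" and x: "x \<in> carrier (V (Q <#> H) n)"
    show "T (Q <#> H) (Q <#> H) h n x = x"
      using orbit_systemD(3)[OF V subgroup_mult_Q[OF H] subsetD[OF subset_mult_Q[OF H] h] x] .
  next
    fix H K a n assume *: "subgroup H G\<^sub>P" "subgroup K G\<^sub>P" "H \<subseteq> K" "a \<in> carrier G\<^sub>P"
    show "T (Q <#> H) (Q <#> K) a n \<in> linear_maps (V (Q <#> H) n) (V (Q <#> K) n)"
      using orbit_systemD(2)[OF V subgroup_mult_Q[OF *(1)] subgroup_mult_Q[OF *(2)] S_mono[OF *(3)] carr[OF *(4)]] .
  qed (rule orbit_systemD(1)[OF V subgroup_mult_Q])
  show ?thesis
    unfolding injective_system_def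
  proof (intro conjI allI impI; (elim conjE)?)
    fix A B :: "'a set \<Rightarrow> nat \<Rightarrow> (rat, 'u) module"
    fix TA TB f g
    assume A: "orbit_system G\<^sub>P A TA" and B: "orbit_system G\<^sub>P B TB" and f: "system_map G\<^sub>P A TA B TB f"
      and f_inj: "\<forall>H n. subgroup H G\<^sub>P \<longrightarrow> inj_on (f H n) (carrier (A H n))"
      and g: "system_map G\<^sub>P A TA (\<lambda>H. V (Q <#> H)) (\<lambda>H K. T (Q <#> H) (Q <#> K)) g"
    define g' where "g' L n x = (if Q \<subseteq> L then g (P \<inter> L) n x else \<zero>\<^bsub>V L n\<^esub>)" for L n x
    note sub = subgroup_inter_P
    have f': "system_map G (zero_extension A) (zero_extension_map TA) (zero_extension B) (zero_extension_map TB) (\<lambda>L. f (P \<inter> L))"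
    proof (rule system_mapI)
      fix L n assume L: "subgroup L G"
      show "f (P \<inter> L) n \<in> linear_maps (zero_extension A L n) (zero_extension B L n)"
        by (rule zero_extension_linear[OF A B L L order_refl system_mapD(1)[OF f sub[OF L]]])
    next
      fix L L' a n x assume L: "subgroup L G" "subgroup L' G" "L \<subseteq> L'" and a: "a \<in> carrier G"
        and x: "x \<in> carrier (zero_extension A L n)"
      then show "f (P \<inter> L') n (zero_extension_map TA L L' a n x) = zero_extension_map TB L L' a n (f (P \<inter> L) n x)"
        unfolding zero_extension_map_def
        by (intro system_mapD(2)[OF f] sub) (use zero_extension_carrier(1)[OF A L(1)] proj_in_factors in auto)
    qed
    have g'_lin: "g' L n \<in> linear_maps (zero_extension A L n) (V L n)" if L: "subgroup L G" for L n
    proof (cases "Q \<subseteq> L")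
      case True
      have "g (P \<inter> L) n \<in> linear_maps (A (P \<inter> L) n) (V L n)"
        using system_mapD(1)[OF g sub[OF L]] mult_Q_inter[OF L True] by simp
      moreover have "g' L n = g (P \<inter> L) n" using True by (simp add: g'_def fun_eq_iff)
      ultimately show ?thesis using True by (simp add: linear_maps_def zero_extension_def)
    next
      case False
      then have "g' L n = (\<lambda>x. \<zero>\<^bsub>V L n\<^esub>)" by (simp add: g'_def fun_eq_iff)
      then show ?thesis using zero_linear_map[OF orbit_systemD(1)[OF V L]] by simp
    qed
    have g': "system_map G (zero_extension A) (zero_extension_map TA) V T g'"
    proof (rule system_mapI)
      fix L L' a n x assume L: "subgroup L G" "subgroup L' G" "L \<subseteq> L'" and a: "a \<in> carrier G"
        and x: "x \<in> carrier (zero_extension A L n)"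
      show "g' L' n (zero_extension_map TA L L' a n x) = T L L' a n (g' L n x)"
      proof (cases "Q \<subseteq> L")
        case True
        then have True': "Q \<subseteq> L'" using L by blast
        have PL: "P \<inter> L \<subseteq> P \<inter> L'" using L(3) by blast
        have x': "x \<in> carrier (A (P \<inter> L) n)" using zero_extension_carrier(1)[OF A L(1)] x by blast
        have a1: "proj1 a \<in> carrier G\<^sub>P" using a proj_in_factors by simp
        have gx: "g (P \<inter> L) n x \<in> carrier (V L n)"
          using linear_maps_closed[OF system_mapD(1)[OF g sub[OF L(1)]] x'] mult_Q_inter[OF L(1) True] by simp
        have "g (P \<inter> L') n (TA (P \<inter> L) (P \<inter> L') (proj1 a) n x) = T L L' (proj1 a) n (g (P \<inter> L) n x)"
          using system_mapD(2)[OF g sub[OF L(1)] sub[OF L(2)] PL a1 x']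
          by (simp add: mult_Q_inter[OF L(1) True] mult_Q_inter[OF L(2) True'])
        \<comment> \<open>The factor \<open>proj2 a\<close> lies in \<open>L'\<close>, so it does not change the coset \<open>a L'\<close>.\<close>
        also have "\<dots> = T L L' (proj1 a \<otimes> proj2 a) n (g (P \<inter> L) n x)"
          by (rule orbit_system_coset_invariant[OF V L _ gx, symmetric]) (use a proj_in_factors True' in auto)
        finally show ?thesis using a True True' by (simp add: g'_def zero_extension_map_def proj_mult)
      next
        case False
        have "zero_extension_map TA L L' a n x = \<zero>\<^bsub>A (P \<inter> L') n\<^esub>"
          unfolding zero_extension_map_def zero_extension_carrier(2)[OF A L(1) False x]
          using L a proj_in_factors
          by (intro linear_maps_zero[OF orbit_systemD(1)[OF A sub[OF L(1)]] orbit_systemD(1)[OF A sub[OF L(2)]]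
                orbit_systemD(2)[OF A sub[OF L(1)] sub[OF L(2)]]]) auto
        moreover have "g (P \<inter> L') n \<zero>\<^bsub>A (P \<inter> L') n\<^esub> = \<zero>\<^bsub>V L' n\<^esub>" if "Q \<subseteq> L'"
          using linear_maps_zero[OF orbit_systemD(1)[OF A sub[OF L(2)]] _ system_mapD(1)[OF g sub[OF L(2)]]]
            orbit_systemD(1)[OF V L(2)] mult_Q_inter[OF L(2) that] by simp
        moreover have "T L L' a n \<zero>\<^bsub>V L n\<^esub> = \<zero>\<^bsub>V L' n\<^esub>"
          by (rule linear_maps_zero[OF orbit_systemD(1)[OF V L(1)] orbit_systemD(1)[OF V L(2)] orbit_systemD(2)[OF V L a]])
        ultimately show ?thesis using False by (simp add: g'_def)
      qed
    qed (rule g'_lin)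
    have f'_inj: "inj_on (f (P \<inter> L) n) (carrier (zero_extension A L n))" if L: "subgroup L G" for L n
      using inj_on_subset[OF f_inj[rule_format, OF sub[OF L]] zero_extension_carrier(1)[OF A L]] .
    obtain h where h: "system_map G (zero_extension B) (zero_extension_map TB) V T h"
      and hf: "\<And>L n x. subgroup L G \<Longrightarrow> x \<in> carrier (zero_extension A L n) \<Longrightarrow> h L n (f (P \<inter> L) n x) = g' L n x"
      by (rule injective_system_extension[OF inj orbit_system_zero_extension[OF A] orbit_system_zero_extension[OF B] f' f'_inj g'])
        (blast intro: inj_on_id)+
    have full: "zero_extension A (Q <#> H) n = A H n"
      if H: "subgroup H G\<^sub>P" for H n and A :: "'a set \<Rightarrow> nat \<Rightarrow> (rat, 'u) module"
      using Q_subset_mult[OF H] inter_mult_Q[OF H] by (simp add: zero_extension_def)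
    show "\<exists>h. system_map G\<^sub>P B TB (\<lambda>H. V (Q <#> H)) (\<lambda>H K. T (Q <#> H) (Q <#> K)) h \<and>
        (\<forall>H n. subgroup H G\<^sub>P \<longrightarrow> (\<forall>x\<in>carrier (A H n). h H n (f H n x) = g H n x))"
    proof (intro exI conjI allI impI ballI)
      show "system_map G\<^sub>P B TB (\<lambda>H. V (Q <#> H)) (\<lambda>H K. T (Q <#> H) (Q <#> K)) (\<lambda>H. h (Q <#> H))"
      proof (rule system_mapI)
        show "h (Q <#> H) n \<in> linear_maps (B H n) (V (Q <#> H) n)" if "subgroup H G\<^sub>P" for H n
          using system_mapD(1)[OF h subgroup_mult_Q[OF that], of n] full[OF that, of B n] by simp
        show "h (Q <#> K) n (TB H K a n x) = T (Q <#> H) (Q <#> K) a n (h (Q <#> H) n x)"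
          if *: "subgroup H G\<^sub>P" "subgroup K G\<^sub>P" "H \<subseteq> K" "a \<in> carrier G\<^sub>P" "x \<in> carrier (B H n)" for H K a n x
          using system_mapD(2)[OF h subgroup_mult_Q[OF *(1)] subgroup_mult_Q[OF *(2)] S_mono[OF *(3)] carr[OF *(4)], of x n]
            full[OF *(1), of B n] * by (simp add: zero_extension_map_def inter_mult_Q)
      qed
      show "h (Q <#> H) n (f H n x) = g H n x" if H: "subgroup H G\<^sub>P" and x: "x \<in> carrier (A H n)" for H n x
        using hf[OF subgroup_mult_Q[OF H], of x n] full[OF H, of A n] x Q_subset_mult[OF H]
        by (simp add: g'_def inter_mult_Q[OF H])
    qed
  qed (rule W)
qed

end

section \<open>Restriction of the action to a factor\<close>

lemma (in group) bij_betw_left_translation: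
  assumes "subgroup K G" "k \<in> K"
  shows "bij_betw (\<lambda>x. k \<otimes> x) K K"
proof -
  note mem = subgroup.mem_carrier[OF assms(1)] and cl = subgroup.m_closed[OF assms(1)] subgroup.m_inv_closed[OF assms(1)]
  show ?thesis
    by (rule bij_betwI[of _ _ _ "\<lambda>x. inv k \<otimes> x"]) (use assms(2) in \<open>auto simp: cl mem m_assoc[symmetric]\<close>)
qed

text \<open>
  After interchanging the averages, the inner one runs over a translate of \<open>K'\<close> by an element of
  \<open>K\<close>, so it does not depend on that element.
\<close>

lemma (in comm_group) average_absorb:
  fixes M :: "(rat, 'v) module"
  assumes M: "module rat_field M" and K: "subgroup K G" "subgroup K' G" "K \<subseteq> K'" "finite K'"
    and F: "\<And>x. x \<in> K' \<Longrightarrow> F x \<in> carrier M"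
  shows "average M K' (\<lambda>x. average M K (\<lambda>k. F (x \<otimes> k))) = average M K' F"
proof -
  interpret M: rat_module M using M by (rule rat_moduleI)
  have K_fin: "finite K" "K \<noteq> {}" using K subgroup.one_closed[OF K(1)] finite_subset by auto
  have cl: "x \<otimes> k \<in> K'" if "x \<in> K'" "k \<in> K" for x k using that K subgroup.m_closed[OF K(2)] by blast
  have "average M K' (\<lambda>x. average M K (\<lambda>k. F (x \<otimes> k))) = average M K (\<lambda>k. average M K' (\<lambda>x. F (x \<otimes> k)))"
    using K_fin K(4) F cl by (intro M.average_swap) auto
  also have "\<dots> = average M K (\<lambda>k. average M K' F)"
  proof (rule M.average_cong)
    show "average M K' (\<lambda>x. F (x \<otimes> k)) \<in> carrier M" if "k \<in> K" for k
      using F cl that by (intro M.average_closed) auto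
    show "average M K' (\<lambda>x. F (x \<otimes> k)) = average M K' F" if k: "k \<in> K" for k
    proof -
      have k': "k \<in> K'" using k K(3) by blast
      have "average M K' (\<lambda>x. F (x \<otimes> k)) = average M K' (\<lambda>x. F (k \<otimes> x))"
        using F cl k subgroup.mem_carrier[OF K(2)] k' by (intro M.average_cong) (auto simp: m_comm)
      also have "\<dots> = average M K' F"
        using F by (intro M.average_reindex[OF bij_betw_left_translation[OF K(2) k']]) auto
      finally show ?thesis .
    qed
  qed
  also have "\<dots> = average M K' F"
    using K_fin F by (intro M.average_const) (auto intro!: M.average_closed)
  finally show ?thesis .
qed

context coprime_product
begin

text \<open>
  The left Kan extension of \<open>A\<close> along \<open>P/H \<mapsto> G/H\<close>. At \<open>L\<close> it is the sum of copies of \<open>A (P \<inter> L)\<close>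
  indexed by \<open>Q/(L \<inter> Q)\<close>, written as invariant functions on \<open>Q\<close>.
\<close>

definition induced ::
    "('a set \<Rightarrow> nat \<Rightarrow> (rat, 'v) module) \<Rightarrow> 'a set \<Rightarrow> nat \<Rightarrow> (rat, 'a \<Rightarrow> 'v) module" where
  "induced A L n = (function_module Q (A (P \<inter> L) n))
     \<lparr>carrier := {s \<in> Q \<rightarrow>\<^sub>E carrier (A (P \<inter> L) n). \<forall>x\<in>Q. \<forall>l\<in>L \<inter> Q. s (x \<otimes> l) = s x}\<rparr>"

text \<open>
  An element \<open>a = a\<^sub>P a\<^sub>Q\<close> acts on the coefficients by \<open>a\<^sub>P\<close> and on functions on \<open>Q\<close> by translation by
  \<open>a\<^sub>Q\<close>. The average over \<open>L' \<inter> Q\<close> produces an \<open>(L' \<inter> Q)\<close>-invariant function; up to a factor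
  it is the fold map of the summands that become identified over \<open>L'\<close>. With this normalisation
  the translations by elements of \<open>L\<close> act as the identity and composition holds without correction.
\<close>

definition induced_map ::
    "('a set \<Rightarrow> nat \<Rightarrow> (rat, 'v) module) \<Rightarrow> ('a set \<Rightarrow> 'a set \<Rightarrow> 'a \<Rightarrow> nat \<Rightarrow> 'v \<Rightarrow> 'v) \<Rightarrow>
     'a set \<Rightarrow> 'a set \<Rightarrow> 'a \<Rightarrow> nat \<Rightarrow> ('a \<Rightarrow> 'v) \<Rightarrow> 'a \<Rightarrow> 'v" where
  "induced_map A T L L' a n s =
     (\<lambda>y\<in>Q. average (A (P \<inter> L') n) (L' \<inter> Q)
        (\<lambda>l. T (P \<inter> L) (P \<inter> L') (proj1 a) n (s (y \<otimes> inv (proj2 a) \<otimes> l))))"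

lemma induced_simps:
  "carrier (induced A L n) = {s \<in> Q \<rightarrow>\<^sub>E carrier (A (P \<inter> L) n). \<forall>x\<in>Q. \<forall>l\<in>L \<inter> Q. s (x \<otimes> l) = s x}"
  "u \<oplus>\<^bsub>induced A L n\<^esub> w = (\<lambda>x\<in>Q. u x \<oplus>\<^bsub>A (P \<inter> L) n\<^esub> w x)"
  "r \<odot>\<^bsub>induced A L n\<^esub> u = (\<lambda>x\<in>Q. r \<odot>\<^bsub>A (P \<inter> L) n\<^esub> u x)"
  by (simp_all add: induced_def function_module_def)

lemma induced_carrierD:
  assumes "s \<in> carrier (induced A L n)"
  shows "\<And>x. x \<in> Q \<Longrightarrow> s x \<in> carrier (A (P \<inter> L) n)"
    and "\<And>x l. x \<in> Q \<Longrightarrow> l \<in> L \<inter> Q \<Longrightarrow> s (x \<otimes> l) = s x"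
    and "s \<in> extensional Q"
  using assms by (auto simp: induced_simps PiE_iff)

lemma Q_closed [simp]: "x \<in> Q \<Longrightarrow> y \<in> Q \<Longrightarrow> x \<otimes> y \<in> Q" "x \<in> Q \<Longrightarrow> inv x \<in> Q" "\<one> \<in> Q"
  using subgroup.m_closed[OF Q] subgroup.m_inv_closed[OF Q] subgroup.one_closed[OF Q] by auto

lemma subgroup_inter_Q: "subgroup L G \<Longrightarrow> subgroup (L \<inter> Q) G"
  using subgroups_Inter_pair[OF _ Q] by simp

lemma proj1_in_P_group: "a \<in> carrier G \<Longrightarrow> proj1 a \<in> carrier G\<^sub>P"
  using proj_in_factors by simp

lemma module_induced:
  assumes A: "orbit_system G\<^sub>P A T" and L: "subgroup L G"
  shows "module rat_field (induced A L n)"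
proof -
  have mod: "module rat_field (A (P \<inter> L) n)" using orbit_systemD(1)[OF A subgroup_inter_P[OF L]] .
  interpret N: rat_module "A (P \<inter> L) n" using mod by (rule rat_moduleI)
  have mem: "s x \<in> carrier (A (P \<inter> L) n)" if "s \<in> Q \<rightarrow>\<^sub>E carrier (A (P \<inter> L) n)" "x \<in> Q" for s x using that by auto
  show ?thesis
    unfolding induced_def
    by (rule rat_submodule[OF module_function_module[OF mod]]) (auto simp: function_module_simps mem)
qed

lemma induced_map_linear:
  assumes A: "orbit_system G\<^sub>P A T" and L: "subgroup L G" "subgroup L' G" "L \<subseteq> L'" and a: "a \<in> carrier G"
  shows "induced_map A T L L' a n \<in> linear_maps (induced A L n) (induced A L' n)"
proof -
  let ?N = "A (P \<inter> L) n" and ?N' = "A (P \<inter> L') n"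
  let ?t = "T (P \<inter> L) (P \<inter> L') (proj1 a) n" and ?c = "inv (proj2 a)"
  interpret N': rat_module ?N'
    using orbit_systemD(1)[OF A subgroup_inter_P[OF L(2)]] by (rule rat_moduleI)
  have t: "?t \<in> linear_maps ?N ?N'"
    using orbit_systemD(2)[OF A subgroup_inter_P[OF L(1)] subgroup_inter_P[OF L(2)] _ proj1_in_P_group[OF a]] L(3) by blast
  have c: "?c \<in> Q" using proj_in_factors[OF a] by simp
  have fin: "finite (L' \<inter> Q)" using finite_Q by simp
  have mem: "?t (s (y \<otimes> ?c \<otimes> l)) \<in> carrier ?N'"
    if "s \<in> carrier (induced A L n)" "y \<in> Q" "l \<in> L' \<inter> Q" for s y l
    using that c induced_carrierD(1)[OF that(1)] linear_maps_closed[OF t] by simp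
  show ?thesis
  proof (rule linear_mapsI)
    fix s assume s: "s \<in> carrier (induced A L n)"
    have "induced_map A T L L' a n s (x \<otimes> k) = induced_map A T L L' a n s x" if x: "x \<in> Q" and k: "k \<in> L' \<inter> Q" for x k
    proof -
      have "average ?N' (L' \<inter> Q) (\<lambda>l. ?t (s (x \<otimes> k \<otimes> ?c \<otimes> l))) = average ?N' (L' \<inter> Q) (\<lambda>l. ?t (s (x \<otimes> ?c \<otimes> (k \<otimes> l))))"
      proof (rule N'.average_cong)
        fix l assume l: "l \<in> L' \<inter> Q"
        show "?t (s (x \<otimes> k \<otimes> ?c \<otimes> l)) \<in> carrier ?N'" using mem[OF s _ l, of "x \<otimes> k"] x k by simp
        have "x \<otimes> k \<otimes> ?c \<otimes> l = x \<otimes> ?c \<otimes> (k \<otimes> l)" using x k l c by (simp add: m_ac)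
        then show "?t (s (x \<otimes> k \<otimes> ?c \<otimes> l)) = ?t (s (x \<otimes> ?c \<otimes> (k \<otimes> l)))" by simp
      qed
      also have "\<dots> = average ?N' (L' \<inter> Q) (\<lambda>l. ?t (s (x \<otimes> ?c \<otimes> l)))"
        using mem[OF s x]
        by (intro N'.average_reindex[OF bij_betw_left_translation[OF subgroup_inter_Q[OF L(2)] k]]) auto
      finally show ?thesis using x k by (simp add: induced_map_def)
    qed
    moreover have "induced_map A T L L' a n s x \<in> carrier ?N'" if "x \<in> Q" for x
      using mem[OF s that] that by (auto simp: induced_map_def intro!: N'.average_closed)
    moreover have "induced_map A T L L' a n s \<in> extensional Q" by (simp add: induced_map_def)
    ultimately show "induced_map A T L L' a n s \<in> carrier (induced A L' n)" by (auto simp: induced_simps PiE_iff)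
  next
    fix s u assume s: "s \<in> carrier (induced A L n)" and u: "u \<in> carrier (induced A L n)"
    have "average ?N' (L' \<inter> Q) (\<lambda>l. ?t ((\<lambda>x\<in>Q. s x \<oplus>\<^bsub>?N\<^esub> u x) (y \<otimes> ?c \<otimes> l)))
        = average ?N' (L' \<inter> Q) (\<lambda>l. ?t (s (y \<otimes> ?c \<otimes> l))) \<oplus>\<^bsub>?N'\<^esub> average ?N' (L' \<inter> Q) (\<lambda>l. ?t (u (y \<otimes> ?c \<otimes> l)))"
      if y: "y \<in> Q" for y
    proof -
      have "average ?N' (L' \<inter> Q) (\<lambda>l. ?t ((\<lambda>x\<in>Q. s x \<oplus>\<^bsub>?N\<^esub> u x) (y \<otimes> ?c \<otimes> l)))
          = average ?N' (L' \<inter> Q) (\<lambda>l. ?t (s (y \<otimes> ?c \<otimes> l)) \<oplus>\<^bsub>?N'\<^esub> ?t (u (y \<otimes> ?c \<otimes> l)))"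
        using mem[OF s y] mem[OF u y] y c induced_carrierD(1)[OF s] induced_carrierD(1)[OF u]
        by (intro N'.average_cong[symmetric]) (simp_all add: linear_maps_add[OF t])
      also have "\<dots> = average ?N' (L' \<inter> Q) (\<lambda>l. ?t (s (y \<otimes> ?c \<otimes> l))) \<oplus>\<^bsub>?N'\<^esub> average ?N' (L' \<inter> Q) (\<lambda>l. ?t (u (y \<otimes> ?c \<otimes> l)))"
        using mem[OF s y] mem[OF u y] by (intro N'.average_add) auto
      finally show ?thesis .
    qed
    then show "induced_map A T L L' a n (s \<oplus>\<^bsub>induced A L n\<^esub> u)
        = induced_map A T L L' a n s \<oplus>\<^bsub>induced A L' n\<^esub> induced_map A T L L' a n u"
      unfolding induced_simps by (simp add: induced_map_def cong: restrict_cong)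
  next
    fix r s assume s: "s \<in> carrier (induced A L n)"
    have "average ?N' (L' \<inter> Q) (\<lambda>l. ?t ((\<lambda>x\<in>Q. r \<odot>\<^bsub>?N\<^esub> s x) (y \<otimes> ?c \<otimes> l)))
        = r \<odot>\<^bsub>?N'\<^esub> average ?N' (L' \<inter> Q) (\<lambda>l. ?t (s (y \<otimes> ?c \<otimes> l)))"
      if y: "y \<in> Q" for y
    proof -
      have "average ?N' (L' \<inter> Q) (\<lambda>l. ?t ((\<lambda>x\<in>Q. r \<odot>\<^bsub>?N\<^esub> s x) (y \<otimes> ?c \<otimes> l)))
          = average ?N' (L' \<inter> Q) (\<lambda>l. r \<odot>\<^bsub>?N'\<^esub> ?t (s (y \<otimes> ?c \<otimes> l)))"
        using mem[OF s y] y c induced_carrierD(1)[OF s]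
        by (intro N'.average_cong[symmetric]) (simp_all add: linear_maps_smult[OF t])
      also have "\<dots> = r \<odot>\<^bsub>?N'\<^esub> average ?N' (L' \<inter> Q) (\<lambda>l. ?t (s (y \<otimes> ?c \<otimes> l)))"
        using mem[OF s y] fin by (intro N'.average_smult) auto
      finally show ?thesis .
    qed
    then show "induced_map A T L L' a n (r \<odot>\<^bsub>induced A L n\<^esub> s) = r \<odot>\<^bsub>induced A L' n\<^esub> induced_map A T L L' a n s"
      unfolding induced_simps by (simp add: induced_map_def cong: restrict_cong)
  qed
qed

text \<open>
  The composite is an average over \<open>L'' \<inter> Q\<close> of averages over \<open>L' \<inter> Q\<close>, and the inner ones are
  absorbed.
\<close>

lemma induced_map_compose:
  assumes A: "orbit_system G\<^sub>P A T" and L: "subgroup L G" "subgroup L' G" "subgroup L'' G" "L \<subseteq> L'" "L' \<subseteq> L''"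
    and ab: "a \<in> carrier G" "b \<in> carrier G" and s: "s \<in> carrier (induced A L n)"
  shows "induced_map A T L L'' (a \<otimes> b) n s = induced_map A T L' L'' b n (induced_map A T L L' a n s)"
proof (rule extensionalityI[of _ Q])
  let ?N = "A (P \<inter> L) n" and ?N' = "A (P \<inter> L') n" and ?N'' = "A (P \<inter> L'') n"
  let ?t = "T (P \<inter> L) (P \<inter> L') (proj1 a) n" and ?t' = "T (P \<inter> L') (P \<inter> L'') (proj1 b) n"
  let ?c = "inv (proj2 a)" and ?d = "inv (proj2 b)"
  note sub = subgroup_inter_P
  note mod = orbit_systemD(1)[OF A sub[OF L(1)], of n] orbit_systemD(1)[OF A sub[OF L(2)], of n] orbit_systemD(1)[OF A sub[OF L(3)], of n]
  interpret N': rat_module ?N' using mod(2) by (rule rat_moduleI)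
  interpret N'': rat_module ?N'' using mod(3) by (rule rat_moduleI)
  have t: "?t \<in> linear_maps ?N ?N'"
    using orbit_systemD(2)[OF A sub[OF L(1)] sub[OF L(2)] _ proj1_in_P_group[OF ab(1)]] L(4) by blast
  have t': "?t' \<in> linear_maps ?N' ?N''"
    using orbit_systemD(2)[OF A sub[OF L(2)] sub[OF L(3)] _ proj1_in_P_group[OF ab(2)]] L(5) by blast
  have c: "?c \<in> Q" "?d \<in> Q" using proj_in_factors[OF ab(1)] proj_in_factors[OF ab(2)] by simp_all
  have fin: "finite (L' \<inter> Q)" "finite (L'' \<inter> Q)" using finite_Q by simp_all
  have tt': "T (P \<inter> L) (P \<inter> L'') (proj1 (a \<otimes> b)) n x = ?t' (?t x)" if "x \<in> carrier ?N" for x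
    using orbit_systemD(4)[OF A sub[OF L(1)] sub[OF L(2)] sub[OF L(3)] _ _ proj1_in_P_group[OF ab(1)] proj1_in_P_group[OF ab(2)] that]
      L(4,5) ab by (auto simp: proj1_mult)
  have cd: "inv (proj2 (a \<otimes> b)) = ?c \<otimes> ?d" using ab by (simp add: proj2_mult inv_mult)
  have smem: "s x \<in> carrier ?N" if "x \<in> Q" for x using induced_carrierD(1)[OF s that] .
  fix y assume y: "y \<in> Q"
  define F where "F z = ?t' (?t (s (y \<otimes> (?c \<otimes> ?d) \<otimes> z)))" for z
  have F: "F z \<in> carrier ?N''" if "z \<in> Q" for z
    using that y c smem linear_maps_closed[OF t] linear_maps_closed[OF t'] by (simp add: F_def)
  have "induced_map A T L' L'' b n (induced_map A T L L' a n s) y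
      = average ?N'' (L'' \<inter> Q) (\<lambda>m. ?t' (average ?N' (L' \<inter> Q) (\<lambda>l. ?t (s (y \<otimes> ?d \<otimes> m \<otimes> ?c \<otimes> l)))))"
    unfolding induced_map_def using y c smem linear_maps_closed[OF t] linear_maps_closed[OF t']
    by (simp, intro N''.average_cong) (auto intro!: linear_maps_closed[OF t'] N'.average_closed)
  also have "\<dots> = average ?N'' (L'' \<inter> Q) (\<lambda>m. average ?N'' (L' \<inter> Q) (\<lambda>l. F (m \<otimes> l)))"
  proof (rule N''.average_cong)
    fix m assume m: "m \<in> L'' \<inter> Q"
    have *: "?t (s (y \<otimes> ?d \<otimes> m \<otimes> ?c \<otimes> l)) \<in> carrier ?N'" if "l \<in> L' \<inter> Q" for l
      using that y c m smem linear_maps_closed[OF t] by simp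
    then show "?t' (average ?N' (L' \<inter> Q) (\<lambda>l. ?t (s (y \<otimes> ?d \<otimes> m \<otimes> ?c \<otimes> l)))) \<in> carrier ?N''"
      by (intro linear_maps_closed[OF t'] N'.average_closed) auto
    have "?t' (average ?N' (L' \<inter> Q) (\<lambda>l. ?t (s (y \<otimes> ?d \<otimes> m \<otimes> ?c \<otimes> l))))
        = average ?N'' (L' \<inter> Q) (\<lambda>l. ?t' (?t (s (y \<otimes> ?d \<otimes> m \<otimes> ?c \<otimes> l))))"
      using * by (intro linear_maps_average[OF mod(2,3) t' fin(1)]) auto
    also have "\<dots> = average ?N'' (L' \<inter> Q) (\<lambda>l. F (m \<otimes> l))"
    proof (rule N''.average_cong)
      fix l assume l: "l \<in> L' \<inter> Q"
      show "?t' (?t (s (y \<otimes> ?d \<otimes> m \<otimes> ?c \<otimes> l))) \<in> carrier ?N''" using *[OF l] linear_maps_closed[OF t'] by blast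
      have "y \<otimes> ?d \<otimes> m \<otimes> ?c \<otimes> l = y \<otimes> (?c \<otimes> ?d) \<otimes> (m \<otimes> l)" using y c m l by (simp add: m_ac)
      then show "?t' (?t (s (y \<otimes> ?d \<otimes> m \<otimes> ?c \<otimes> l))) = F (m \<otimes> l)" by (simp add: F_def)
    qed
    finally show "?t' (average ?N' (L' \<inter> Q) (\<lambda>l. ?t (s (y \<otimes> ?d \<otimes> m \<otimes> ?c \<otimes> l)))) = average ?N'' (L' \<inter> Q) (\<lambda>l. F (m \<otimes> l))" .
  qed
  also have "\<dots> = average ?N'' (L'' \<inter> Q) F"
    using L(5) F by (intro average_absorb[OF mod(3) subgroup_inter_Q[OF L(2)] subgroup_inter_Q[OF L(3)]]) (auto simp: fin)
  also have "\<dots> = induced_map A T L L'' (a \<otimes> b) n s y"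
    unfolding induced_map_def cd using y c smem F
    by (simp, intro N''.average_cong) (auto simp: F_def tt')
  finally show "induced_map A T L L'' (a \<otimes> b) n s y = induced_map A T L' L'' b n (induced_map A T L L' a n s) y" ..
qed (simp_all add: induced_map_def)

lemma orbit_system_induced:
  assumes A: "orbit_system G\<^sub>P A T"
  shows "orbit_system G (induced A) (induced_map A T)"
proof (rule orbit_systemI)
  fix L h n s assume L: "subgroup L G" and h: "h \<in> L" and s: "s \<in> carrier (induced A L n)"
  let ?N = "A (P \<inter> L) n" and ?c = "inv (proj2 h)"
  interpret N: rat_module ?N using orbit_systemD(1)[OF A subgroup_inter_P[OF L]] by (rule rat_moduleI)
  have c: "?c \<in> L \<inter> Q" using proj_in_subgroup[OF L h] subgroup.m_inv_closed[OF subgroup_inter_Q[OF L]] by blast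
  show "induced_map A T L L h n s = s"
  proof (rule extensionalityI[of _ Q])
    fix y assume y: "y \<in> Q"
    have sy: "s y \<in> carrier ?N" using induced_carrierD(1)[OF s y] .
    have "average ?N (L \<inter> Q) (\<lambda>l. T (P \<inter> L) (P \<inter> L) (proj1 h) n (s (y \<otimes> ?c \<otimes> l))) = average ?N (L \<inter> Q) (\<lambda>_. s y)"
    proof (rule N.average_cong[symmetric])
      fix l assume l: "l \<in> L \<inter> Q"
      have "s (y \<otimes> ?c \<otimes> l) = s y"
        using induced_carrierD(2)[OF s] y c l by (metis IntD2 Q_closed(1))
      then show "s y = T (P \<inter> L) (P \<inter> L) (proj1 h) n (s (y \<otimes> ?c \<otimes> l))"
        using orbit_systemD(3)[OF A subgroup_inter_P[OF L] proj_in_subgroup(1)[OF L h] sy] by simp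
    qed (rule sy)
    also have "\<dots> = s y"
      using finite_Q subgroup.one_closed[OF subgroup_inter_Q[OF L]] by (intro N.average_const sy) auto
    finally show "induced_map A T L L h n s y = s y" using y by (simp add: induced_map_def)
  qed (use induced_carrierD(3)[OF s] in \<open>simp_all add: induced_map_def\<close>)
qed (rule module_induced[OF A] induced_map_linear[OF A] induced_map_compose[OF A]; assumption)+

lemma induced_functorial:
  assumes A: "orbit_system G\<^sub>P A TA" and B: "orbit_system G\<^sub>P B TB" and f: "system_map G\<^sub>P A TA B TB f"
  shows "system_map G (induced A) (induced_map A TA) (induced B) (induced_map B TB) (\<lambda>L n s. \<lambda>x\<in>Q. f (P \<inter> L) n (s x))"
proof (rule system_mapI)
  fix L n assume L: "subgroup L G"
  have f': "f (P \<inter> L) n \<in> linear_maps (A (P \<inter> L) n) (B (P \<inter> L) n)"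
    using system_mapD(1)[OF f subgroup_inter_P[OF L]] .
  show "(\<lambda>s. \<lambda>x\<in>Q. f (P \<inter> L) n (s x)) \<in> linear_maps (induced A L n) (induced B L n)"
  proof (rule linear_mapsI)
    fix s assume "s \<in> carrier (induced A L n)"
    note s = induced_carrierD[OF this]
    show "(\<lambda>x\<in>Q. f (P \<inter> L) n (s x)) \<in> carrier (induced B L n)"
      using s(1,2) linear_maps_closed[OF f'] by (simp add: induced_simps)
    show "(\<lambda>x\<in>Q. f (P \<inter> L) n ((r \<odot>\<^bsub>induced A L n\<^esub> s) x)) = r \<odot>\<^bsub>induced B L n\<^esub> (\<lambda>x\<in>Q. f (P \<inter> L) n (s x))" for r
      using s(1) linear_maps_smult[OF f'] by (simp add: induced_simps cong: restrict_cong)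
    fix u assume "u \<in> carrier (induced A L n)"
    note u = induced_carrierD[OF this]
    show "(\<lambda>x\<in>Q. f (P \<inter> L) n ((s \<oplus>\<^bsub>induced A L n\<^esub> u) x))
        = (\<lambda>x\<in>Q. f (P \<inter> L) n (s x)) \<oplus>\<^bsub>induced B L n\<^esub> (\<lambda>x\<in>Q. f (P \<inter> L) n (u x))"
      using s(1) u(1) linear_maps_add[OF f'] by (simp add: induced_simps cong: restrict_cong)
  qed
next
  fix L L' a n s assume L: "subgroup L G" "subgroup L' G" "L \<subseteq> L'" and a: "a \<in> carrier G"
    and s: "s \<in> carrier (induced A L n)"
  let ?N = "A (P \<inter> L) n" and ?N' = "A (P \<inter> L') n" and ?M' = "B (P \<inter> L') n"
  let ?t = "TA (P \<inter> L) (P \<inter> L') (proj1 a) n" and ?c = "inv (proj2 a)"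
  note sub = subgroup_inter_P
  have PL: "P \<inter> L \<subseteq> P \<inter> L'" using L(3) by blast
  have t: "?t \<in> linear_maps ?N ?N'"
    using orbit_systemD(2)[OF A sub[OF L(1)] sub[OF L(2)] PL proj1_in_P_group[OF a]] .
  have c: "?c \<in> Q" using proj_in_factors[OF a] by simp
  interpret M': rat_module ?M' using orbit_systemD(1)[OF B sub[OF L(2)]] by (rule rat_moduleI)
  have f': "f (P \<inter> L') n \<in> linear_maps ?N' ?M'" using system_mapD(1)[OF f sub[OF L(2)]] .
  show "(\<lambda>x\<in>Q. f (P \<inter> L') n (induced_map A TA L L' a n s x))
      = induced_map B TB L L' a n (\<lambda>x\<in>Q. f (P \<inter> L) n (s x))"
  proof (rule extensionalityI[of _ Q])
    fix y assume y: "y \<in> Q"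
    have mem: "s (y \<otimes> ?c \<otimes> l) \<in> carrier ?N" if "l \<in> L' \<inter> Q" for l
      using induced_carrierD(1)[OF s] y c that by simp
    have mem': "?t (s (y \<otimes> ?c \<otimes> l)) \<in> carrier ?N'" if "l \<in> L' \<inter> Q" for l
      using linear_maps_closed[OF t mem[OF that]] .
    have "f (P \<inter> L') n (average ?N' (L' \<inter> Q) (\<lambda>l. ?t (s (y \<otimes> ?c \<otimes> l))))
        = average ?M' (L' \<inter> Q) (\<lambda>l. f (P \<inter> L') n (?t (s (y \<otimes> ?c \<otimes> l))))"
      using mem' finite_Q
      by (intro linear_maps_average[OF orbit_systemD(1)[OF A sub[OF L(2)]] orbit_systemD(1)[OF B sub[OF L(2)]] f']) auto
    also have "\<dots> = average ?M' (L' \<inter> Q)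
        (\<lambda>l. TB (P \<inter> L) (P \<inter> L') (proj1 a) n ((\<lambda>x\<in>Q. f (P \<inter> L) n (s x)) (y \<otimes> ?c \<otimes> l)))"
      using linear_maps_closed[OF f' mem'] y c system_mapD(2)[OF f sub[OF L(1)] sub[OF L(2)] PL proj1_in_P_group[OF a] mem]
      by (intro M'.average_cong) simp_all
    finally show "(\<lambda>x\<in>Q. f (P \<inter> L') n (induced_map A TA L L' a n s x)) y
        = induced_map B TB L L' a n (\<lambda>x\<in>Q. f (P \<inter> L) n (s x)) y"
      using y by (simp add: induced_map_def)
  qed (simp_all add: induced_map_def)
qed

text \<open>
  The map \<open>induced A \<rightarrow> V\<close> that corresponds to \<open>g\<close>: the summand at \<open>x \<in> Q\<close> is mapped by \<open>g\<close>
  followed by translation by \<open>x\<close>. Naturality is a change of variables in the average over \<open>Q\<close>,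
  together with the triviality of the action of \<open>L' \<inter> Q\<close> on \<open>V L'\<close>.
\<close>

lemma induced_adjoint:
  assumes V: "orbit_system G V T" and A: "orbit_system G\<^sub>P A TA" and g: "system_map G\<^sub>P A TA V T g"
  shows "system_map G (induced A) (induced_map A TA) V T
    (\<lambda>L n s. average (V L n) Q (\<lambda>x. T (P \<inter> L) L x n (g (P \<inter> L) n (s x))))"
proof (rule system_mapI)
  note sub = subgroup_inter_P
  have PL_sub: "subgroup (P \<inter> L) G" if "subgroup L G" for L using sub[OF that] by (simp add: subgroup_of_P_iff)
  have lin: "(\<lambda>u. T (P \<inter> L) L x n (g (P \<inter> L) n u)) \<in> linear_maps (A (P \<inter> L) n) (V L n)"
    if "subgroup L G" "x \<in> carrier G" for L x n
    using linear_maps_compose[OF system_mapD(1)[OF g sub[OF that(1)]] orbit_systemD(2)[OF V PL_sub[OF that(1)] that(1) _ that(2)]]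
    by simp
  {
    fix L n assume L: "subgroup L G"
    let ?g = "\<lambda>x u. T (P \<inter> L) L x n (g (P \<inter> L) n u)"
    interpret V: rat_module "V L n" using orbit_systemD(1)[OF V L] by (rule rat_moduleI)
    show "(\<lambda>s. average (V L n) Q (\<lambda>x. ?g x (s x))) \<in> linear_maps (induced A L n) (V L n)"
    proof (rule linear_mapsI)
      fix s assume "s \<in> carrier (induced A L n)"
      note s = induced_carrierD(1)[OF this]
      have mem: "?g x (s x) \<in> carrier (V L n)" if "x \<in> Q" for x
        using linear_maps_closed[OF lin[OF L] s[OF that]] that by simp
      show "average (V L n) Q (\<lambda>x. ?g x (s x)) \<in> carrier (V L n)" using mem by (intro V.average_closed) auto
      show "average (V L n) Q (\<lambda>x. ?g x ((r \<odot>\<^bsub>induced A L n\<^esub> s) x)) = r \<odot>\<^bsub>V L n\<^esub> average (V L n) Q (\<lambda>x. ?g x (s x))" for r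
      proof -
        have "average (V L n) Q (\<lambda>x. ?g x ((r \<odot>\<^bsub>induced A L n\<^esub> s) x)) = average (V L n) Q (\<lambda>x. r \<odot>\<^bsub>V L n\<^esub> ?g x (s x))"
          using mem s by (intro V.average_cong[symmetric]) (simp_all add: induced_simps linear_maps_smult[OF lin[OF L]])
        then show ?thesis using mem finite_Q by (subst V.average_smult[symmetric]) auto
      qed
      fix u assume "u \<in> carrier (induced A L n)"
      note u = induced_carrierD(1)[OF this]
      have memu: "?g x (u x) \<in> carrier (V L n)" if "x \<in> Q" for x
        using linear_maps_closed[OF lin[OF L] u[OF that]] that by simp
      show "average (V L n) Q (\<lambda>x. ?g x ((s \<oplus>\<^bsub>induced A L n\<^esub> u) x))
          = average (V L n) Q (\<lambda>x. ?g x (s x)) \<oplus>\<^bsub>V L n\<^esub> average (V L n) Q (\<lambda>x. ?g x (u x))"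
      proof -
        have "average (V L n) Q (\<lambda>x. ?g x ((s \<oplus>\<^bsub>induced A L n\<^esub> u) x))
            = average (V L n) Q (\<lambda>x. ?g x (s x) \<oplus>\<^bsub>V L n\<^esub> ?g x (u x))"
          using mem memu s u by (intro V.average_cong[symmetric]) (simp_all add: induced_simps linear_maps_add[OF lin[OF L]])
        then show ?thesis using mem memu by (subst V.average_add[symmetric]) auto
      qed
    qed
  }
  fix L L' a n s assume L: "subgroup L G" "subgroup L' G" "L \<subseteq> L'" and a: "a \<in> carrier G"
    and s: "s \<in> carrier (induced A L n)"
  let ?N = "A (P \<inter> L) n" and ?N' = "A (P \<inter> L') n"
  let ?t = "TA (P \<inter> L) (P \<inter> L') (proj1 a) n" and ?c = "inv (proj2 a)"
  have PL: "P \<inter> L \<subseteq> P \<inter> L'" "P \<inter> L \<subseteq> L'" "P \<inter> L' \<subseteq> L'" using L(3) by blast+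
  note modV = orbit_systemD(1)[OF V L(1), of n] orbit_systemD(1)[OF V L(2), of n]
  interpret V': rat_module "V L' n" using modV(2) by (rule rat_moduleI)
  interpret N': rat_module ?N' using orbit_systemD(1)[OF A sub[OF L(2)]] by (rule rat_moduleI)
  have t: "?t \<in> linear_maps ?N ?N'"
    using orbit_systemD(2)[OF A sub[OF L(1)] sub[OF L(2)] PL(1) proj1_in_P_group[OF a]] .
  have c: "?c \<in> Q" "proj2 a \<in> Q" and a1: "proj1 a \<in> carrier G" using proj_in_factors[OF a] a by simp_all
  have smem: "s x \<in> carrier ?N" if "x \<in> Q" for x using induced_carrierD(1)[OF s that] .
  have gs: "g (P \<inter> L) n (s x) \<in> carrier (V (P \<inter> L) n)" if "x \<in> Q" for x
    using linear_maps_closed[OF system_mapD(1)[OF g sub[OF L(1)]] smem[OF that]] .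
  have Tg: "T (P \<inter> L) K z n (g (P \<inter> L) n (s x)) \<in> carrier (V K n)"
    if "x \<in> Q" "z \<in> carrier G" "subgroup K G" "P \<inter> L \<subseteq> K" for x z K
    using linear_maps_closed[OF orbit_systemD(2)[OF V PL_sub[OF L(1)] that(3,4,2)] gs[OF that(1)]] .
  \<comment> \<open>Both sides of the naturality square are equal to the average of this function over \<open>Q\<close>.\<close>
  define F where "F z = T (P \<inter> L) L' (proj1 a \<otimes> proj2 a \<otimes> z) n (g (P \<inter> L) n (s z))" for z
  have F: "F z \<in> carrier (V L' n)" if "z \<in> Q" for z
    unfolding F_def using Tg[OF that _ L(2) PL(2)] that a1 c by simp
  have "average (V L' n) Q (\<lambda>x. T (P \<inter> L') L' x n (g (P \<inter> L') n (induced_map A TA L L' a n s x)))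
      = average (V L' n) Q (\<lambda>x. average (V L' n) (L' \<inter> Q) (\<lambda>l. F (?c \<otimes> (x \<otimes> l))))"
  proof (rule V'.average_cong)
    fix x assume x: "x \<in> Q"
    have mem: "?t (s (x \<otimes> ?c \<otimes> l)) \<in> carrier ?N'" if "l \<in> L' \<inter> Q" for l
      using linear_maps_closed[OF t smem] x c that by simp
    have ind: "induced_map A TA L L' a n s x = average ?N' (L' \<inter> Q) (\<lambda>l. ?t (s (x \<otimes> ?c \<otimes> l)))"
      using x by (simp add: induced_map_def)
    have "induced_map A TA L L' a n s x \<in> carrier ?N'" unfolding ind using mem by (intro N'.average_closed) auto
    then show "T (P \<inter> L') L' x n (g (P \<inter> L') n (induced_map A TA L L' a n s x)) \<in> carrier (V L' n)"
      using linear_maps_closed[OF lin[OF L(2)]] x by simp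
    have "T (P \<inter> L') L' x n (g (P \<inter> L') n (induced_map A TA L L' a n s x))
        = average (V L' n) (L' \<inter> Q) (\<lambda>l. T (P \<inter> L') L' x n (g (P \<inter> L') n (?t (s (x \<otimes> ?c \<otimes> l)))))"
      unfolding ind using mem x finite_Q
      by (intro linear_maps_average[OF orbit_systemD(1)[OF A sub[OF L(2)]] modV(2) lin[OF L(2)]]) auto
    also have "\<dots> = average (V L' n) (L' \<inter> Q) (\<lambda>l. F (?c \<otimes> (x \<otimes> l)))"
    proof (rule V'.average_cong)
      fix l assume l: "l \<in> L' \<inter> Q"
      show "T (P \<inter> L') L' x n (g (P \<inter> L') n (?t (s (x \<otimes> ?c \<otimes> l)))) \<in> carrier (V L' n)"
        using linear_maps_closed[OF lin[OF L(2)] mem[OF l]] x by simp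
      have z: "x \<otimes> ?c \<otimes> l = ?c \<otimes> (x \<otimes> l)" "?c \<otimes> (x \<otimes> l) \<in> Q" using x c l by (simp_all add: m_ac)
      let ?z = "?c \<otimes> (x \<otimes> l)"
      have "T (P \<inter> L') L' x n (g (P \<inter> L') n (?t (s ?z)))
          = T (P \<inter> L') L' x n (T (P \<inter> L) (P \<inter> L') (proj1 a) n (g (P \<inter> L) n (s ?z)))"
        using system_mapD(2)[OF g sub[OF L(1)] sub[OF L(2)] PL(1) proj1_in_P_group[OF a] smem[OF z(2)]] by simp
      also have "\<dots> = T (P \<inter> L) L' (proj1 a \<otimes> x) n (g (P \<inter> L) n (s ?z))"
        using orbit_systemD(4)[OF V PL_sub[OF L(1)] PL_sub[OF L(2)] L(2) PL(1,3) a1 _ gs[OF z(2)]] x by simp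
      \<comment> \<open>The coset of \<open>L'\<close> does not change on multiplying by \<open>l \<in> L'\<close>.\<close>
      also have "\<dots> = T (P \<inter> L) L' (proj1 a \<otimes> x \<otimes> l) n (g (P \<inter> L) n (s ?z))"
        using orbit_system_coset_invariant[OF V PL_sub[OF L(1)] L(2) PL(2) _ gs[OF z(2)]] x a1 l by simp
      also have "proj1 a \<otimes> x \<otimes> l = proj1 a \<otimes> proj2 a \<otimes> ?z"
      proof -
        have "proj2 a \<otimes> ?z = (proj2 a \<otimes> ?c) \<otimes> (x \<otimes> l)"
          using c x l by (intro m_assoc[symmetric]) simp_all
        also have "\<dots> = x \<otimes> l" using c x l by (simp only: r_inv mem_carrier) simp
        finally show ?thesis using a1 c x l z(2) by (simp only: m_assoc mem_carrier IntD2)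
      qed
      finally show "T (P \<inter> L') L' x n (g (P \<inter> L') n (?t (s (x \<otimes> ?c \<otimes> l)))) = F ?z"
        unfolding z(1) F_def .
    qed
    finally show "T (P \<inter> L') L' x n (g (P \<inter> L') n (induced_map A TA L L' a n s x))
        = average (V L' n) (L' \<inter> Q) (\<lambda>l. F (?c \<otimes> (x \<otimes> l)))" .
  qed
  also have "\<dots> = average (V L' n) Q (\<lambda>x. F (?c \<otimes> x))"
    using F c finite_Q by (intro average_absorb[OF modV(2) subgroup_inter_Q[OF L(2)] Q]) auto
  also have "\<dots> = average (V L' n) Q F"
    using F by (intro V'.average_reindex[OF bij_betw_left_translation[OF Q c(1)]]) auto
  also have "\<dots> = average (V L' n) Q (\<lambda>x. T L L' a n (T (P \<inter> L) L x n (g (P \<inter> L) n (s x))))"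
  proof (rule V'.average_cong)
    fix x assume x: "x \<in> Q"
    show "F x \<in> carrier (V L' n)" using F[OF x] .
    have "T L L' a n (T (P \<inter> L) L x n (g (P \<inter> L) n (s x))) = T (P \<inter> L) L' (x \<otimes> a) n (g (P \<inter> L) n (s x))"
      using orbit_systemD(4)[OF V PL_sub[OF L(1)] L(1,2) _ L(3) _ a gs[OF x]] x by simp
    then show "F x = T L L' a n (T (P \<inter> L) L x n (g (P \<inter> L) n (s x)))"
      using a x by (simp add: F_def proj_mult m_comm)
  qed
  also have "\<dots> = T L L' a n (average (V L n) Q (\<lambda>x. T (P \<inter> L) L x n (g (P \<inter> L) n (s x))))"
    using Tg[OF _ _ L(1)] finite_Q
    by (intro linear_maps_average[OF modV orbit_systemD(2)[OF V L a], symmetric]) auto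
  finally show "average (V L' n) Q (\<lambda>x. T (P \<inter> L') L' x n (g (P \<inter> L') n (induced_map A TA L L' a n s x)))
      = T L L' a n (average (V L n) Q (\<lambda>x. T (P \<inter> L) L x n (g (P \<inter> L) n (s x))))" .
qed

text \<open>
  The inclusion of the summand at \<open>1\<close>, that is, the unit \<open>A \<rightarrow> F\<^sup>*F\<^sub>!A\<close> of the Kan extension; the
  factor \<open>card Q\<close> makes the average equal to \<open>b\<close>.
\<close>

definition point_mass :: "(rat, 'v) module \<Rightarrow> 'v \<Rightarrow> 'a \<Rightarrow> 'v" where
  "point_mass M b = (\<lambda>x\<in>Q. if x = \<one> then of_nat (card Q) \<odot>\<^bsub>M\<^esub> b else \<zero>\<^bsub>M\<^esub>)"

text \<open>
  For \<open>H \<subseteq> P\<close> the group \<open>H \<inter> Q\<close> is trivial, so the averages in the structure maps have one term.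
\<close>

lemma point_mass_system_map:
  assumes A: "orbit_system G\<^sub>P A T"
  shows "system_map G\<^sub>P A T (induced A) (induced_map A T) (\<lambda>H n. point_mass (A H n))"
proof (rule system_mapI)
  have PH: "P \<inter> H = H" "H \<inter> Q = {\<one>}" if "subgroup H G\<^sub>P" for H
    using that factors_inter subgroup.one_closed[of H G] by (auto simp: subgroup_of_P_iff)
  {
    fix H n assume H: "subgroup H G\<^sub>P"
    interpret N: rat_module "A H n" using orbit_systemD(1)[OF A H] by (rule rat_moduleI)
    show "point_mass (A H n) \<in> linear_maps (A H n) (induced A H n)"
      by (rule linear_mapsI)
        (auto simp: induced_simps PH[OF H] point_mass_def N.rat_smult_distr N.rat_smult_assoc mult.commute intro!: restrict_ext)
  }
  fix H K a n b assume H: "subgroup H G\<^sub>P" "subgroup K G\<^sub>P" "H \<subseteq> K" "a \<in> carrier G\<^sub>P" and b: "b \<in> carrier (A H n)"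
  note mod = orbit_systemD(1)[OF A H(1), of n] orbit_systemD(1)[OF A H(2), of n]
  interpret N: rat_module "A H n" using mod(1) by (rule rat_moduleI)
  interpret N': rat_module "A K n" using mod(2) by (rule rat_moduleI)
  have t: "T H K a n \<in> linear_maps (A H n) (A K n)" using orbit_systemD(2)[OF A H] .
  have a: "a \<in> P" using H by simp
  show "point_mass (A K n) (T H K a n b) = induced_map A T H K a n (point_mass (A H n) b)"
  proof (rule extensionalityI[of _ Q])
    fix y assume y: "y \<in> Q"
    have pm: "point_mass (A H n) b y \<in> carrier (A H n)" using y b by (simp add: point_mass_def)
    have "induced_map A T H K a n (point_mass (A H n) b) y
        = average (A K n) {\<one>} (\<lambda>l. T H K a n (point_mass (A H n) b (y \<otimes> l)))"
      using y a by (simp add: induced_map_def PH[OF H(1)] PH[OF H(2)] proj2_P)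
    also have "\<dots> = average (A K n) {\<one>} (\<lambda>l. T H K a n (point_mass (A H n) b y))"
      using y linear_maps_closed[OF t pm] by (intro N'.average_cong) auto
    also have "\<dots> = T H K a n (point_mass (A H n) b y)"
      using linear_maps_closed[OF t pm] by (intro N'.average_const) auto
    also have "\<dots> = point_mass (A K n) (T H K a n b) y"
      using y b linear_maps_zero[OF mod t] by (simp add: point_mass_def linear_maps_smult[OF t])
    finally show "point_mass (A K n) (T H K a n b) y = induced_map A T H K a n (point_mass (A H n) b) y" ..
  qed (simp_all add: point_mass_def induced_map_def)
qed

text \<open>
  The extension problem over \<open>P\<close> is induced up to \<open>G\<close> and solved there; the solution is precomposed
  with the point masses.
\<close>

theorem injective_system_restriction:
  fixes U :: "'u itself"
  assumes inj: "injective_system U G V T"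
  shows "injective_system U G\<^sub>P V T"
proof -
  have V: "orbit_system G V T" using inj by (simp add: injective_system_def)
  have subG: "subgroup H G" if "subgroup H G\<^sub>P" for H using that by (simp add: subgroup_of_P_iff)
  have W: "orbit_system G\<^sub>P V T"
  proof (rule orbit_systemI)
    fix H K L a b n x
    assume *: "subgroup H G\<^sub>P" "subgroup K G\<^sub>P" "subgroup L G\<^sub>P" "H \<subseteq> K" "K \<subseteq> L" "a \<in> carrier G\<^sub>P" "b \<in> carrier G\<^sub>P"
      "x \<in> carrier (V H n)"
    then show "T H L (a \<otimes>\<^bsub>G\<^sub>P\<^esub> b) n x = T K L b n (T H K a n x)"
      using orbit_systemD(4)[OF V subG[OF *(1)] subG[OF *(2)] subG[OF *(3)] *(4,5) _ _ *(8)] by simp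
  next
    fix H h n x assume "subgroup H G\<^sub>P" "h \<in> H" "x \<in> carrier (V H n)"
    then show "T H H h n x = x" by (rule orbit_systemD(3)[OF V subG])
  next
    fix H K a n assume *: "subgroup H G\<^sub>P" "subgroup K G\<^sub>P" "H \<subseteq> K" "a \<in> carrier G\<^sub>P"
    then show "T H K a n \<in> linear_maps (V H n) (V K n)"
      using orbit_systemD(2)[OF V subG[OF *(1)] subG[OF *(2)] *(3)] by simp
  qed (rule orbit_systemD(1)[OF V subG])
  show ?thesis
    unfolding injective_system_def
  proof (intro conjI allI impI; (elim conjE)?)
    fix A B :: "'a set \<Rightarrow> nat \<Rightarrow> (rat, 'u) module"
    fix TA TB f g
    assume A: "orbit_system G\<^sub>P A TA" and B: "orbit_system G\<^sub>P B TB" and f: "system_map G\<^sub>P A TA B TB f"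
      and f_inj: "\<forall>H n. subgroup H G\<^sub>P \<longrightarrow> inj_on (f H n) (carrier (A H n))"
      and g: "system_map G\<^sub>P A TA V T g"
    let ?f = "\<lambda>L n s. \<lambda>x\<in>Q. f (P \<inter> L) n (s x)"
    let ?g = "\<lambda>L n s. average (V L n) Q (\<lambda>x. T (P \<inter> L) L x n (g (P \<inter> L) n (s x)))"
    have f'_inj: "inj_on (?f L n) (carrier (induced A L n))" if L: "subgroup L G" for L n
    proof (rule inj_onI)
      fix s u assume s: "s \<in> carrier (induced A L n)" and u: "u \<in> carrier (induced A L n)" and eq: "?f L n s = ?f L n u"
      show "s = u"
      proof (rule extensionalityI[OF induced_carrierD(3)[OF s] induced_carrierD(3)[OF u]])
        fix x assume x: "x \<in> Q"
        have "f (P \<inter> L) n (s x) = f (P \<inter> L) n (u x)" using fun_cong[OF eq, of x] x by simp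
        then show "s x = u x"
          using inj_onD[OF f_inj[rule_format, OF subgroup_inter_P[OF L]]] induced_carrierD(1)[OF s x] induced_carrierD(1)[OF u x]
          by blast
      qed
    qed
    have small: "\<exists>e :: ('a \<Rightarrow> 'u) \<Rightarrow> 'u. inj_on e (carrier (induced A L n))"
      if A: "orbit_system G\<^sub>P A TA" and L: "subgroup L G" for A :: "'a set \<Rightarrow> nat \<Rightarrow> (rat, 'u) module" and TA L n
    proof -
      obtain e :: "('a \<Rightarrow> 'u) \<Rightarrow> 'u" where "inj_on e (Q \<rightarrow>\<^sub>E carrier (A (P \<inter> L) n))"
        using rat_module_encode_functions[OF orbit_systemD(1)[OF A subgroup_inter_P[OF L]] finite_Q] by blast
      moreover have "carrier (induced A L n) \<subseteq> Q \<rightarrow>\<^sub>E carrier (A (P \<inter> L) n)" by (auto simp: induced_simps)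
      ultimately show ?thesis using inj_on_subset by blast
    qed
    obtain h where h: "system_map G (induced B) (induced_map B TB) V T h"
      and hf: "\<And>L n s. subgroup L G \<Longrightarrow> s \<in> carrier (induced A L n) \<Longrightarrow> h L n (?f L n s) = ?g L n s"
      using injective_system_extension[OF inj orbit_system_induced[OF A] orbit_system_induced[OF B]
          induced_functorial[OF A B f] f'_inj induced_adjoint[OF V A g] small[OF A] small[OF B]] by blast
    have h_P: "system_map G\<^sub>P (induced B) (induced_map B TB) V T h"
    proof (rule system_mapI)
      fix H K a n x
      assume *: "subgroup H G\<^sub>P" "subgroup K G\<^sub>P" "H \<subseteq> K" "a \<in> carrier G\<^sub>P" "x \<in> carrier (induced B H n)"
      show "h K n (induced_map B TB H K a n x) = T H K a n (h H n x)"
        using system_mapD(2)[OF h subG[OF *(1)] subG[OF *(2)] *(3) _ *(5)] *(4) by simp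
    qed (rule system_mapD(1)[OF h subG])
    show "\<exists>h. system_map G\<^sub>P B TB V T h \<and> (\<forall>H n. subgroup H G\<^sub>P \<longrightarrow> (\<forall>x\<in>carrier (A H n). h H n (f H n x) = g H n x))"
    proof (intro exI conjI allI impI ballI)
      show "system_map G\<^sub>P B TB V T (\<lambda>H n b. h H n (point_mass (B H n) b))"
        by (rule system_map_compose[OF point_mass_system_map[OF B] h_P])
      fix H n b assume H: "subgroup H G\<^sub>P" and b: "b \<in> carrier (A H n)"
      have PH: "P \<inter> H = H" using H by (auto simp: subgroup_of_P_iff)
      note mod = orbit_systemD(1)[OF A H, of n] orbit_systemD(1)[OF B H, of n] orbit_systemD(1)[OF V subG[OF H], of n]
      interpret N: rat_module "A H n" using mod(1) by (rule rat_moduleI)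
      interpret W: rat_module "V H n" using mod(3) by (rule rat_moduleI)
      have f': "f H n \<in> linear_maps (A H n) (B H n)" using system_mapD(1)[OF f H] .
      have g': "g H n \<in> linear_maps (A H n) (V H n)" using system_mapD(1)[OF g H] .
      have gb: "g H n b \<in> carrier (V H n)" using linear_maps_closed[OF g' b] .
      have tlin: "T H H x n \<in> linear_maps (V H n) (V H n)" if "x \<in> Q" for x
        using orbit_systemD(2)[OF V subG[OF H] subG[OF H] order_refl] that by simp
      have T1: "T H H \<one> n (g H n b) = g H n b"
        using orbit_systemD(3)[OF V subG[OF H] subgroup.one_closed[OF subG[OF H]] gb] .
      have "point_mass (B H n) (f H n b) = ?f H n (point_mass (A H n) b)"
        using b linear_maps_zero[OF mod(1,2) f']
        by (auto simp: point_mass_def PH linear_maps_smult[OF f'] fun_eq_iff)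
      then have "h H n (point_mass (B H n) (f H n b)) = ?g H n (point_mass (A H n) b)"
        using hf[OF subG[OF H] linear_maps_closed[OF system_mapD(1)[OF point_mass_system_map[OF A] H] b]] by simp
      also have "\<dots> = average (V H n) Q (\<lambda>x. if x = \<one> then of_nat (card Q) \<odot>\<^bsub>V H n\<^esub> g H n b else \<zero>\<^bsub>V H n\<^esub>)"
      proof (rule W.average_cong[symmetric])
        fix x assume x: "x \<in> Q"
        show "(if x = \<one> then of_nat (card Q) \<odot>\<^bsub>V H n\<^esub> g H n b else \<zero>\<^bsub>V H n\<^esub>) \<in> carrier (V H n)" using gb by simp
        show "(if x = \<one> then of_nat (card Q) \<odot>\<^bsub>V H n\<^esub> g H n b else \<zero>\<^bsub>V H n\<^esub>)
            = T (P \<inter> H) H x n (g (P \<inter> H) n (point_mass (A H n) b x))"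
          using x b gb T1 linear_maps_zero[OF mod(1,3) g'] linear_maps_zero[OF mod(3,3) tlin[OF x]]
          by (auto simp: PH point_mass_def linear_maps_smult[OF g'] linear_maps_smult[OF tlin])
      qed
      also have "\<dots> = g H n b" using finite_Q gb by (intro W.average_point) auto
      finally show "h H n (point_mass (B H n) (f H n b)) = g H n b" .
    qed
  qed (rule W)
qed

end

section \<open>Cohomology diagrams\<close>

lemma cohomology_diagram_eq:
  "cohomology_diagram X \<phi> = translation_diagram (\<lambda>H n. cohomology n (fixed_space X \<phi> H))
     (\<lambda>H K a n. cohomology_map n (fixed_space X \<phi> K) (\<phi> a))"
  by (simp add: cohomology_diagram_def translation_diagram_def orbit_action_def)

text \<open>
  Simplices only take values in the space, so the values of the map elsewhere are irrelevant. This
  disposes of the choice of coset representatives, and of the difference between the action on \<open>X\<close>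
  and the one restricted to \<open>X\<^sup>Q\<close>.
\<close>

lemma cohomology_map_cong:
  assumes "\<And>x. x \<in> topspace Y \<Longrightarrow> f x = g x"
  shows "cohomology_map n Y f = cohomology_map n Y g"
proof -
  have "simplex_map n f \<sigma> = simplex_map n g \<sigma>" if "singular_simplex n Y \<sigma>" for \<sigma>
    using that assms by (auto simp: simplex_map_def singular_simplex_def continuous_map_def restrict_def fun_eq_iff Pi_iff)
  then have "cochain_pullback n Y f = cochain_pullback n Y g" by (intro ext) (simp add: cochain_pullback_def)
  then show ?thesis by (intro ext) (simp add: cohomology_map_def)
qed

lemma orbit_system_cohomology:
  assumes "comm_group \<Gamma>" and X: "group_space \<Gamma> X \<phi>"
  shows "orbit_system \<Gamma> (\<lambda>H n. cohomology n (fixed_space X \<phi> H))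
    (\<lambda>H K a n. cohomology_map n (fixed_space X \<phi> K) (\<phi> a))"
proof (rule comm_group.orbit_system_of_translation_diagram[OF assms(1)])
  interpret group_action \<Gamma> "topspace X" \<phi> using X by (simp add: group_space_def)
  show "vec_diagram \<Gamma> (translation_diagram (\<lambda>H n. cohomology n (fixed_space X \<phi> H))
      (\<lambda>H K a n. cohomology_map n (fixed_space X \<phi> K) (\<phi> a)))"
    using vec_diagram_cohomology_diagram[OF X] by (simp add: cohomology_diagram_eq)
  fix H K a k n assume *: "subgroup K \<Gamma>" "a \<in> carrier \<Gamma>" "k \<in> K"
  have "k \<in> carrier \<Gamma>" using subgroup.mem_carrier[OF *(1,3)] .
  then show "cohomology_map n (fixed_space X \<phi> K) (\<phi> (a \<otimes>\<^bsub>\<Gamma>\<^esub> k)) = cohomology_map n (fixed_space X \<phi> K) (\<phi> a)"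
    using * composition_rule by (intro cohomology_map_cong) (auto simp: topspace_fixed_space)
qed

text \<open>
  Stated with the union \<open>Q \<union> H\<close> so that it holds for arbitrary sets \<open>H\<close>, as does the equality of the
  corresponding diagrams; the subgroup \<open>QH\<close> has the same fixed points.
\<close>

lemma fixed_space_Un:
  "fixed_space (fixed_space X \<phi> Q) (action_on (fixed_space X \<phi> Q) \<phi>) H = fixed_space X \<phi> (Q \<union> H)"
proof -
  have "{x \<in> topspace (fixed_space X \<phi> Q). \<forall>h\<in>H. action_on (fixed_space X \<phi> Q) \<phi> h x = x}
      = {x \<in> topspace X. \<forall>h\<in>Q \<union> H. \<phi> h x = x}"
    by (auto simp: topspace_fixed_space action_on_def)
  moreover have "{x \<in> topspace X. \<forall>h\<in>Q. \<phi> h x = x} \<inter> {x \<in> topspace X. \<forall>h\<in>Q \<union> H. \<phi> h x = x}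
      = {x \<in> topspace X. \<forall>h\<in>Q \<union> H. \<phi> h x = x}" by auto
  ultimately show ?thesis unfolding fixed_space_def by (simp add: subtopology_subtopology)
qed

lemma fixed_space_set_mult:
  assumes X: "group_space \<Gamma> X \<phi>" and Q: "subgroup Q \<Gamma>" and H: "subgroup H \<Gamma>"
  shows "fixed_space X \<phi> (Q <#>\<^bsub>\<Gamma>\<^esub> H) = fixed_space X \<phi> (Q \<union> H)"
proof -
  interpret group_action \<Gamma> "topspace X" \<phi> using X by (simp add: group_space_def)
  interpret group \<Gamma> using group_hom group_hom.axioms(1) by blast
  have act: "\<phi> (u \<otimes>\<^bsub>\<Gamma>\<^esub> h) x = \<phi> u (\<phi> h x)" if "u \<in> Q" "h \<in> H" "x \<in> topspace X" for u h x
    using composition_rule[OF that(3) subgroup.mem_carrier[OF Q that(1)] subgroup.mem_carrier[OF H that(2)]] .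
  have sub: "Q \<union> H \<subseteq> Q <#>\<^bsub>\<Gamma>\<^esub> H"
  proof
    fix u assume "u \<in> Q \<union> H"
    moreover from this have "u \<in> carrier \<Gamma>" using subgroup.subset[OF Q] subgroup.subset[OF H] by blast
    moreover have "u \<otimes>\<^bsub>\<Gamma>\<^esub> \<one>\<^bsub>\<Gamma>\<^esub> \<in> Q <#>\<^bsub>\<Gamma>\<^esub> H" if "u \<in> Q"
      using that subgroup.one_closed[OF H] unfolding set_mult_def by blast
    moreover have "\<one>\<^bsub>\<Gamma>\<^esub> \<otimes>\<^bsub>\<Gamma>\<^esub> u \<in> Q <#>\<^bsub>\<Gamma>\<^esub> H" if "u \<in> H"
      using that subgroup.one_closed[OF Q] unfolding set_mult_def by blast
    ultimately show "u \<in> Q <#>\<^bsub>\<Gamma>\<^esub> H" by auto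
  qed
  have "{x \<in> topspace X. \<forall>h\<in>Q <#>\<^bsub>\<Gamma>\<^esub> H. \<phi> h x = x} = {x \<in> topspace X. \<forall>h\<in>Q \<union> H. \<phi> h x = x}"
  proof (intro equalityI subsetI)
    fix x assume "x \<in> {x \<in> topspace X. \<forall>h\<in>Q <#>\<^bsub>\<Gamma>\<^esub> H. \<phi> h x = x}"
    then show "x \<in> {x \<in> topspace X. \<forall>h\<in>Q \<union> H. \<phi> h x = x}" using sub by blast
  next
    fix x assume x: "x \<in> {x \<in> topspace X. \<forall>h\<in>Q \<union> H. \<phi> h x = x}"
    then show "x \<in> {x \<in> topspace X. \<forall>h\<in>Q <#>\<^bsub>\<Gamma>\<^esub> H. \<phi> h x = x}" using act by (auto simp: set_mult_def)
  qed
  then show ?thesis by (simp add: fixed_space_def)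
qed

context coprime_product
begin

theorem injective_cohomology_fixed_space:
  fixes U :: "'u itself"
  assumes X: "group_space G X \<phi>" and inj: "injective_diagram U G (cohomology_diagram X \<phi>)"
  shows "injective_diagram U G\<^sub>P (cohomology_diagram (fixed_space X \<phi> Q) (action_on (fixed_space X \<phi> Q) \<phi>))"
proof -
  note V = orbit_system_cohomology[OF comm_group_axioms X]
  have "injective_system U G (\<lambda>H n. cohomology n (fixed_space X \<phi> H))
      (\<lambda>H K a n. cohomology_map n (fixed_space X \<phi> K) (\<phi> a))"
    using injective_translation_diagram_iff[OF V, THEN iffD1, OF inj[unfolded cohomology_diagram_eq]] .
  from injective_system_fixed_by_Q[OF this]
  have *: "injective_system U G\<^sub>P (\<lambda>H n. cohomology n (fixed_space X \<phi> (Q \<union> H)))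
    (\<lambda>H K a n. cohomology_map n (fixed_space X \<phi> (Q \<union> K)) (action_on (fixed_space X \<phi> Q) \<phi> a))"
  proof (rule comm_group.injective_system_cong[OF comm_group_P])
    fix H n assume H: "subgroup H G\<^sub>P"
    then show "cohomology n (fixed_space X \<phi> (Q \<union> H)) = cohomology n (fixed_space X \<phi> (Q <#> H))"
      using fixed_space_set_mult[OF X Q] by (simp add: subgroup_of_P_iff)
  next
    fix H K a n assume K: "subgroup K G\<^sub>P"
    have "cohomology_map n (fixed_space X \<phi> (Q \<union> K)) (action_on (fixed_space X \<phi> Q) \<phi> a)
        = cohomology_map n (fixed_space X \<phi> (Q \<union> K)) (\<phi> a)"
      by (rule cohomology_map_cong) (simp add: action_on_def topspace_fixed_space)
    then show "cohomology_map n (fixed_space X \<phi> (Q \<union> K)) (action_on (fixed_space X \<phi> Q) \<phi> a)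
        = cohomology_map n (fixed_space X \<phi> (Q <#> K)) (\<phi> a)"
      using K fixed_space_set_mult[OF X Q] by (simp add: subgroup_of_P_iff)
  qed
  then have "orbit_system G\<^sub>P (\<lambda>H n. cohomology n (fixed_space X \<phi> (Q \<union> H)))
    (\<lambda>H K a n. cohomology_map n (fixed_space X \<phi> (Q \<union> K)) (action_on (fixed_space X \<phi> Q) \<phi> a))"
    by (simp add: injective_system_def)
  from comm_group.injective_translation_diagram_iff[OF comm_group_P this, THEN iffD2, OF *]
  show ?thesis by (simp add: cohomology_diagram_eq fixed_space_Un)
qed

theorem injective_cohomology_restriction:
  fixes U :: "'u itself"
  assumes X: "group_space G X \<phi>" and inj: "injective_diagram U G (cohomology_diagram X \<phi>)"
  shows "injective_diagram U G\<^sub>P (cohomology_diagram X \<phi>)"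
proof -
  note V = orbit_system_cohomology[OF comm_group_axioms X]
  have "injective_system U G (\<lambda>H n. cohomology n (fixed_space X \<phi> H))
      (\<lambda>H K a n. cohomology_map n (fixed_space X \<phi> K) (\<phi> a))"
    using injective_translation_diagram_iff[OF V, THEN iffD1, OF inj[unfolded cohomology_diagram_eq]] .
  note * = injective_system_restriction[OF this]
  then have "orbit_system G\<^sub>P (\<lambda>H n. cohomology n (fixed_space X \<phi> H))
      (\<lambda>H K a n. cohomology_map n (fixed_space X \<phi> K) (\<phi> a))"
    by (simp add: injective_system_def)
  from comm_group.injective_translation_diagram_iff[OF comm_group_P this, THEN iffD2, OF *]
  show ?thesis by (simp add: cohomology_diagram_eq)
qed

end

theorem proposition3p6:
  fixes G :: "('g, 'm) monoid_scheme"
    and X :: "'a topology"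
    and \<phi> :: "'g \<Rightarrow> 'a \<Rightarrow> 'a"
    and p q :: nat
    and P Q :: "'g set"
  assumes "prime p" and "prime q" and "p \<noteq> q"
    and "group G" and "cyclic_group G" and "order G = p * q"
    and "subgroup P G" and "card P = p"
    and "subgroup Q G" and "card Q = q"
    and "group_space G X \<phi>"
    and "\<And>H. subgroup H G \<Longrightarrow>
           topspace (fixed_space X \<phi> H) \<noteq> {} \<and> simply_connected_space (fixed_space X \<phi> H)"
    and "injective_diagram TYPE('u) G (cohomology_diagram X \<phi>)"
  shows "injective_diagram TYPE('u) (G\<lparr>carrier := P\<rparr>)
           (cohomology_diagram (fixed_space X \<phi> Q) (action_on (fixed_space X \<phi> Q) \<phi>))
       \<and> injective_diagram TYPE('u) (G\<lparr>carrier := Q\<rparr>)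
           (cohomology_diagram (fixed_space X \<phi> P) (action_on (fixed_space X \<phi> P) \<phi>))
       \<and> injective_diagram TYPE('u) (G\<lparr>carrier := P\<rparr>) (cohomology_diagram X \<phi>)
       \<and> injective_diagram TYPE('u) (G\<lparr>carrier := Q\<rparr>) (cohomology_diagram X \<phi>)"
proof -
  interpret comm_group G using assms(4,5) by (simp add: group.cyclic_imp_abelian_group)
  have fin: "finite P" "finite Q"
    using assms(1,2,8,10) prime_gt_0_nat card_ge_0_finite by metis+
  have cop: "coprime (card P) (card Q)" "coprime (card Q) (card P)"
    using primes_coprime[of p q] primes_coprime[of q p] assms(1-3,8,10) by simp_all
  interpret PQ: coprime_product G P Q
    using coprime_productI[OF assms(7,9) fin cop(1)] assms(6,8,10) by simp
  interpret QP: coprime_product G Q P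
    using coprime_productI[OF assms(9,7) fin(2,1) cop(2)] assms(6,8,10) by (simp add: mult.commute)
  show ?thesis
    using PQ.injective_cohomology_fixed_space[OF assms(11,13)] QP.injective_cohomology_fixed_space[OF assms(11,13)]
      PQ.injective_cohomology_restriction[OF assms(11,13)] QP.injective_cohomology_restriction[OF assms(11,13)]
    by blast
qed

end
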